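(* Let $G$ be a connected cubic graph. 1. If $G$ is orientably one-face-embeddable, then $\operatorname{Z}(G) \le \alpha(G) + 1$. 2. If $G$ is orientably two-face-embeddable, then $\operatorname{Z}(G) \le \alpha(G) + 2$.
   Context: All graphs are simple, finite and undirected. A graph is cubic if it is $3$-regular. $\alpha(G)$ is the independence number of $G$. Zero forcing: given a set $B\subseteq V(G)$ of initially blue vertices (the rest white), if a blue vertex has exactly one white neighbor $w$, it can force $w$ to become blue; this rule is applied repeatedly. $B$ is a zero forcing set if all vertices can eventually become blue. $\operatorname{Z}(G)$ is the minimum cardinality of a zero forcing set of $G$. A cellular embedding of a graph $G$ on a closed, orientable surface $\mathcal{S}$ is a drawing of $G$ on $\mathcal{S}$ in which no edges cross and each face is homeomorphic to a disc. $G$ is orientably one-face-embeddable (respectively, orientably two-face-embeddable) if it has a cellular embedding on a closed orientable surface with exactly one face (respectively, exactly two faces). *)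

theory Defs
  imports
    "Graph_Theory.Graph_Theory"
    "HOL-Complex_Analysis.Complex_Analysis"
begin

definition cubic :: "'v pair_pre_digraph \<Rightarrow> bool" where
  "cubic G \<longleftrightarrow> (\<forall>v \<in> pverts G. out_degree (with_proj G) v = 3)"

definition neighbors :: "'v pair_pre_digraph \<Rightarrow> 'v \<Rightarrow> 'v set" where
  "neighbors G u = {w. (u, w) \<in> parcs G}"

definition independent_vertices :: "'v pair_pre_digraph \<Rightarrow> 'v set \<Rightarrow> bool" where
  "independent_vertices G I \<longleftrightarrow> I \<subseteq> pverts G \<and> (\<forall>u \<in> I. \<forall>v \<in> I. (u, v) \<notin> parcs G)"

definition independence_number :: "'v pair_pre_digraph \<Rightarrow> nat" where
  "independence_number G = Max (card ` {I. independent_vertices G I})"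

definition force_step :: "'v pair_pre_digraph \<Rightarrow> 'v set \<Rightarrow> 'v set \<Rightarrow> bool" where
  "force_step G B B' \<longleftrightarrow> (\<exists>u \<in> B. \<exists>w. neighbors G u - B = {w} \<and> B' = insert w B)"

definition zero_forcing_set :: "'v pair_pre_digraph \<Rightarrow> 'v set \<Rightarrow> bool" where
  "zero_forcing_set G B \<longleftrightarrow> B \<subseteq> pverts G \<and> (force_step G)\<^sup>*\<^sup>* B (pverts G)"

definition zero_forcing_number :: "'v pair_pre_digraph \<Rightarrow> nat" where
  "zero_forcing_number G = Min (card ` {B. zero_forcing_set G B})"

(* A surface is given as an abstract topology; charts take values in the complex plane. *)
definition planar_chart :: "'s topology \<Rightarrow> 's set \<Rightarrow> ('s \<Rightarrow> complex) \<Rightarrow> bool" where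
  "planar_chart S U \<phi> \<longleftrightarrow>
     openin S U \<and> open (\<phi> ` U) \<and> homeomorphic_map (subtopology S U) (top_of_set (\<phi> ` U)) \<phi>"

(* For a homeomorphism f between open subsets of the plane: the local degree of f at every
   point is 1, i.e. the image of a small counterclockwise circle about z winds once
   counterclockwise around f z. No differentiability is assumed. *)
definition orientation_preserving_on :: "complex set \<Rightarrow> (complex \<Rightarrow> complex) \<Rightarrow> bool" where
  "orientation_preserving_on D f \<longleftrightarrow>
     (\<forall>z \<in> D. \<forall>\<^sub>F r in at_right 0. winding_number (f \<circ> circlepath z r) (f z) = 1)"

definition oriented_atlas :: "'s topology \<Rightarrow> ('s set \<times> ('s \<Rightarrow> complex)) set \<Rightarrow> bool" where
  "oriented_atlas S \<A> \<longleftrightarrow>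
     (\<forall>(U, \<phi>) \<in> \<A>. planar_chart S U \<phi>) \<and>
     (\<Union>(U, \<phi>) \<in> \<A>. U) = topspace S \<and>
     (\<forall>(U, \<phi>) \<in> \<A>. \<forall>(V, \<psi>) \<in> \<A>.
        orientation_preserving_on (\<phi> ` (U \<inter> V)) (\<psi> \<circ> inv_into U \<phi>))"

(* Second countability is automatic: a compact space is covered by finitely many charts. *)
definition closed_orientable_surface :: "'s topology \<Rightarrow> bool" where
  "closed_orientable_surface S \<longleftrightarrow>
     topspace S \<noteq> {} \<and> connected_space S \<and> compact_space S \<and> Hausdorff_space S \<and>
     (\<exists>\<A>. oriented_atlas S \<A>)"

(* The vertex v is drawn as the point p v and the undirected edge {u, v} as the simple arc
   c (u, v), traversed from p u to p v; the two arcs (u, v) and (v, u) of the symmetric digraph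
   representing the graph yield the same curve in opposite directions. *)
definition graph_drawing ::
    "'v pair_pre_digraph \<Rightarrow> 's topology \<Rightarrow> ('v \<Rightarrow> 's) \<Rightarrow> ('v \<times> 'v \<Rightarrow> real \<Rightarrow> 's) \<Rightarrow> bool" where
  "graph_drawing G S p c \<longleftrightarrow>
     p ` pverts G \<subseteq> topspace S \<and> inj_on p (pverts G) \<and>
     (\<forall>(u, v) \<in> parcs G.
        pathin S (c (u, v)) \<and> inj_on (c (u, v)) {0..1} \<and>
        c (u, v) 0 = p u \<and> c (u, v) 1 = p v \<and>
        (\<forall>t \<in> {0..1}. c (v, u) t = c (u, v) (1 - t)) \<and>
        c (u, v) ` {0<..<1} \<inter> p ` pverts G = {}) \<and>
     (\<forall>(u, v) \<in> parcs G. \<forall>(x, y) \<in> parcs G. {u, v} \<noteq> {x, y} \<longrightarrow>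
        c (u, v) ` {0<..<1} \<inter> c (x, y) ` {0<..<1} = {})"

definition drawing_image ::
    "'v pair_pre_digraph \<Rightarrow> ('v \<Rightarrow> 's) \<Rightarrow> ('v \<times> 'v \<Rightarrow> real \<Rightarrow> 's) \<Rightarrow> 's set" where
  "drawing_image G p c = p ` pverts G \<union> (\<Union>e \<in> parcs G. c e ` {0..1})"

definition faces ::
    "'v pair_pre_digraph \<Rightarrow> 's topology \<Rightarrow> ('v \<Rightarrow> 's) \<Rightarrow> ('v \<times> 'v \<Rightarrow> real \<Rightarrow> 's) \<Rightarrow> 's set set" where
  "faces G S p c = connected_components_of (subtopology S (topspace S - drawing_image G p c))"

definition cellular_embedding ::
    "'v pair_pre_digraph \<Rightarrow> 's topology \<Rightarrow> ('v \<Rightarrow> 's) \<Rightarrow> ('v \<times> 'v \<Rightarrow> real \<Rightarrow> 's) \<Rightarrow> bool" where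
  "cellular_embedding G S p c \<longleftrightarrow>
     graph_drawing G S p c \<and>
     (\<forall>F \<in> faces G S p c. subtopology S F homeomorphic_space top_of_set (ball (0::complex) 1))"

(* HOL cannot quantify over types inside a formula, so the type 's of points of the surface is
   a parameter. A result assuming this for a free 's covers surfaces on every type. *)
definition orientably_face_embeddable ::
    "'s itself \<Rightarrow> nat \<Rightarrow> 'v pair_pre_digraph \<Rightarrow> bool" where
  "orientably_face_embeddable _ k G \<longleftrightarrow>
     (\<exists>(S :: 's topology) p c. closed_orientable_surface S \<and> cellular_embedding G S p c \<and>
        card (faces G S p c) = k)"

end

theory Submission imports Defs begin

text \<open>
The surface enters through face tracing only. In an oriented surface every directed edge has a left side,
and at a vertex the edges are cyclically ordered; following an edge to its head and leaving along the next edge in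
this order keeps the same face on the left. This defines a permutation of the arcs, and its orbits
are the boundary walks of the faces. All that is needed is one inequality: if every face is a disc, there
are at most as many orbits as faces (\<open>face_tracing\<close>). To prove it, take a function on arcs that is
constant on orbits and spread it to a locally constant function on the complement of the drawing, close to the drawing:
on the left of an arc it takes the value of the arc. A disc has a connected end, hence
each face sees one value only. The topological work lies in making sense of the left side when edges are
arbitrary arcs and charts arbitrary homeomorphisms. The left side is defined by the jump of the winding
number across an edge, corners at a vertex are described by Jordan curves (\<open>corner_loop\<close>), and local degree one
of the chart changes makes the notion independent of the chart (\<open>winding_number_orientation_preserving\<close>, \<open>side_common\<close>).

With one face, the arcs of the graph form a single cyclic word. Choose an edge whose two occurrences are
as close to each other as possible. Either it leads to a leaf, which is pruned, or it
is followed by an edge with which it is interleaved, and then deleting both edges leaves a single cyclic word again.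
In the end this yields a spanning tree such that the remaining edges fall into adjacent pairs, centred at an
independent set \<open>K\<close> of leaves of the tree, one half of Xuong's theorem
(\<open>face_word_spanning_pairing\<close>). If \<open>K\<close> is blue, then the remaining vertices induce a tree of maximum degree
three, as far as forcing is concerned, and a bottom-up argument on this tree finds vertices \<open>J\<close>, such that \<open>K \<union> J\<close> is independent,
together with at most \<open>|J| + 1\<close> additional blue vertices that force everything (\<open>tree_forcing\<close>). So \<open>|K| + |J| + 1\<close> vertices suffice.

With two faces, some edge lies on both of them. Its deletion merges the faces, the previous argument applies,
and putting the edge back costs at most one further blue vertex (\<open>forced_extra_edge\<close>).
\<close>

section \<open>Planar loops cut out by arms from a common centre\<close>

text \<open>A curve that winds once around \<open>x\<close> is homotopic, in the punctured disc, to
a small circle around \<open>x\<close>, and the homotopy is carried along by \<open>f\<close>; the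
local degree of \<open>f\<close> at \<open>x\<close> is the winding number of the image circle. This
is how an orientation of the surface lets the two sides of a curve be told apart in all charts at
once.\<close>
lemma winding_number_orientation_preserving:
  assumes f: "continuous_on (ball z0 R) f" "inj_on f (ball z0 R)"
      "orientation_preserving_on (ball z0 R) f"
    and g: "path g" "pathfinish g = pathstart g" "path_image g \<subseteq> ball z0 R"
    and x: "x \<in> ball z0 R" "x \<notin> path_image g"
    and n: "winding_number g x \<in> {0, 1}"
  shows "winding_number (f \<circ> g) (f x) = winding_number g x"
proof -
  have "compact (insert x (path_image g))"
    by (simp add: compact_path_image g)
  moreover have "insert x (path_image g) \<subseteq> ball z0 R" using g x by auto
  ultimately obtain R' where R': "R' < R" "insert x (path_image g) \<subseteq> ball z0 R'"
  proof -
    have "compact (dist z0 ` insert x (path_image g))"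
      by (intro compact_continuous_image continuous_intros) (simp add: compact_path_image g)
    then obtain M where M: "M \<in> dist z0 ` insert x (path_image g)"
      "\<And>y. y \<in> insert x (path_image g) \<Longrightarrow> dist z0 y \<le> M"
      using compact_attains_sup[of "dist z0 ` insert x (path_image g)"] by blast
    have "M < R" using M(1) g x by auto
    then obtain R' where "M < R'" "R' < R" using dense by blast
    with M(2) that[of R'] show thesis by force
  qed
  have "\<forall>\<^sub>F r in at_right 0. winding_number (f \<circ> circlepath x r) (f x) = 1"
    using f(3) x(1) by (simp add: orientation_preserving_on_def)
  moreover have "0 < R' - dist z0 x" using R' by auto
  then have "\<forall>\<^sub>F r in at_right 0. r < R' - dist z0 x"
    unfolding eventually_at_right_field by blast
  ultimately have "\<forall>\<^sub>F r in at_right 0. winding_number (f \<circ> circlepath x r) (f x) = 1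
     \<and> r < R' - dist z0 x \<and> 0 < r"
    by (intro eventually_conj eventually_at_right_less)
  then obtain r where r: "winding_number (f \<circ> circlepath x r) (f x) = 1"
      "r < R' - dist z0 x" "0 < r"
    using eventually_happens'[of "at_right (0::real)"] by (auto simp: trivial_limit_at_right_real)
  define k where "k = (if winding_number g x = 0 then (\<lambda>_. x + of_real r) else circlepath x r)"
  have kb: "k t \<in> cball x r" for t
    using r(3) by (auto simp: k_def circlepath dist_norm norm_mult)
  have k: "path k" "pathfinish k = pathstart k" "x \<notin> path_image k" "winding_number k x = winding_number g x"
    using r n by (auto simp: k_def pathfinish_def pathstart_def path_image_def circlepath
        winding_number_zero_const winding_number_circlepath_centre path_def intro!: continuous_intros)
      (simp_all add: circlepath[symmetric] winding_number_circlepath_centre)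
  have hom: "homotopic_loops (-{x}) g k"
    using winding_number_homotopic_loops_eq[of g x k] g k x by auto
  define h where "h = f \<circ> closest_point (cball z0 R')"
  have "dist z0 x < R'" using R' by auto
  then have R'0: "0 < R'" using zero_le_dist[of z0 x] by linarith
  have cpin: "closest_point (cball z0 R') w \<in> cball z0 R'" for w
    using R'0 by (intro closest_point_in_set) auto
  have "continuous_on (-{x}) h"
    unfolding h_def
  proof (rule continuous_on_compose)
    show "continuous_on (-{x}) (closest_point (cball z0 R'))"
      using R'0 by (intro continuous_on_closest_point) auto
    have "closest_point (cball z0 R') ` (-{x}) \<subseteq> cball z0 R'" using cpin by blast
    also have "\<dots> \<subseteq> ball z0 R" using R' by auto
    finally show "continuous_on (closest_point (cball z0 R') ` (-{x})) f"
      using continuous_on_subset[OF f(1)] by blast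
  qed
  moreover have "h \<in> (-{x}) \<rightarrow> -{f x}"
  proof
    fix w assume w: "w \<in> -{x}"
    have "closest_point (cball z0 R') w \<noteq> x"
    proof
      assume eq: "closest_point (cball z0 R') w = x"
      show False
      proof (cases "w \<in> cball z0 R'")
        case True then show ?thesis using w closest_point_self[OF True] eq by auto
      next
        case False
        have ri: "rel_interior (cball z0 R') = ball z0 R'" using R'0 by (simp add: rel_interior_nonempty_interior)
        have "affine hull (cball z0 R') = UNIV" using R'0 by (intro affine_hull_nonempty_interior) auto
        then have "closest_point (cball z0 R') w \<in> ball z0 R' \<longleftrightarrow> w \<in> ball z0 R'"
          using closest_point_in_rel_interior[of "cball z0 R'" w] R'0 ri by auto
        then show False using eq R' False by auto
      qed
    qed
    moreover have "closest_point (cball z0 R') w \<in> ball z0 R" using cpin[of w] R' by auto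
    ultimately show "h w \<in> -{f x}"
      using f(2) x(1) by (auto simp: h_def inj_on_def)
  qed
  ultimately have "homotopic_loops (-{f x}) (h \<circ> g) (h \<circ> k)"
    using homotopic_loops_continuous_image[OF hom] by blast
  then have "winding_number (h \<circ> g) (f x) = winding_number (h \<circ> k) (f x)"
    by (rule winding_number_homotopic_loops)
  moreover have "winding_number (h \<circ> g) (f x) = winding_number (f \<circ> g) (f x)"
  proof (rule winding_number_cong)
    fix t :: real assume "0 \<le> t" "t \<le> 1"
    then have "g t \<in> path_image g" by (simp add: path_image_def)
    then have "g t \<in> cball z0 R'" using R' ball_subset_cball[of z0 R'] by blast
    then show "(h \<circ> g) t = (f \<circ> g) t" by (simp add: h_def closest_point_self)
  qed
  moreover have "winding_number (h \<circ> k) (f x) = winding_number (f \<circ> k) (f x)"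
  proof (rule winding_number_cong)
    fix t :: real
    have "dist z0 (k t) \<le> dist z0 x + dist x (k t)" by (rule dist_triangle)
    then have "k t \<in> cball z0 R'" using kb[of t] r by auto
    then show "(h \<circ> k) t = (f \<circ> k) t" by (simp add: h_def closest_point_self)
  qed
  moreover have "winding_number (f \<circ> k) (f x) = winding_number g x"
  proof (cases "winding_number g x = 0")
    case True
    have "x + of_real r \<in> ball z0 R"
    proof -
      have "dist z0 (x + of_real r) \<le> dist z0 x + dist x (x + of_real r)" by (rule dist_triangle)
      then show ?thesis using r R' by (auto simp: dist_norm)
    qed
    moreover have "x + of_real r \<noteq> x" using r by simp
    ultimately have "f (x + of_real r) \<noteq> f x" using f(2) x(1) unfolding inj_on_def by blast
    then show ?thesis using True by (simp add: k_def o_def winding_number_zero_const)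
  next
    case False
    then show ?thesis using n r by (simp add: k_def)
  qed
  ultimately show ?thesis by simp
qed

text \<open>The typical arm is the beginning of a drawn edge in a chart, cut where the edge first
leaves a small disc around its starting point.\<close>
definition is_arm :: "complex \<Rightarrow> real \<Rightarrow> (real \<Rightarrow> complex) \<Rightarrow> bool" where
  "is_arm z0 r g \<longleftrightarrow> arc g \<and> pathstart g = z0 \<and> pathfinish g \<in> sphere z0 r \<and>
     path_image g - {pathfinish g} \<subseteq> ball z0 r"

text \<open>The boundary of the sector that lies between two arms.\<close>
definition corner_loop :: "(real \<Rightarrow> complex) \<Rightarrow> (real \<Rightarrow> complex) \<Rightarrow> (real \<Rightarrow> complex) \<Rightarrow> real \<Rightarrow> complex" where
  "corner_loop g q h = g +++ (q +++ reversepath h)"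

lemma ball_Un_sphere_part:
  fixes y :: complex
  assumes "y \<in> sphere z0 r" "0 < r" "0 < e"
  shows "\<exists>a. a \<in> ball y e \<and> a \<notin> cball z0 r" 
proof -
  define a where "a = y + of_real (e / (2*r)) * (y - z0)"
  have nr: "norm (y - z0) = r" using assms by (auto simp: dist_norm norm_minus_commute)
  have ya: "dist y a = e/2" using assms nr by (auto simp: a_def dist_norm norm_mult norm_divide)
  have "a - z0 = of_real (1 + e/(2*r)) * (y - z0)" by (simp add: a_def algebra_simps)
  then have "dist z0 a = (1 + e/(2*r)) * r" 
    using assms nr by (simp only: dist_norm norm_minus_commute[of z0] norm_mult norm_of_real) (simp add: divide_nonneg_pos)
  moreover have "(1 + e/(2*r)) * r = r + e/2" using assms by (simp add: distrib_right)
  ultimately have "dist z0 a = r + e/2" by simp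
  with ya show ?thesis using assms by (intro exI[of _ a]) auto
qed

text \<open>A chord of a disc through its centre, formed by two arms, splits the bounding circle
into two arcs. Both corner loops are Jordan curves, their winding numbers add up to that of the
circle, and each of them winds positively around its own sector. Orientation and the cyclic order of
arms around a point are thereby read off from winding numbers.\<close>
lemma corner_loop:
  assumes C: "simple_path C" "pathfinish C = pathstart C" "path_image C = sphere z0 r"
      "\<forall>x \<in> ball z0 r. winding_number C x = 1"
    and r: "0 < r"
    and g: "is_arm z0 r g" and h: "is_arm z0 r h"
    and gh: "path_image g \<inter> path_image h = {z0}"
    and u: "0 \<le> u" "u < w" "w \<le> 1" and fin: "pathfinish g = C u" "pathfinish h = C w"
  defines "q \<equiv> subpath u w C"
  shows "simple_path (corner_loop g q h)"
    and "pathfinish (corner_loop g q h) = pathstart (corner_loop g q h)"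
    and "path_image (corner_loop g q h) = path_image g \<union> path_image q \<union> path_image h"
    and "\<And>x. x \<notin> path_image (corner_loop g q h) \<Longrightarrow>
       winding_number (corner_loop g q h) x = winding_number g x + winding_number q x - winding_number h x"
    and "\<And>x. x \<notin> path_image (corner_loop g q h) \<Longrightarrow> winding_number (corner_loop g q h) x \<in> {0,1}"
    and "path_image q \<subseteq> sphere z0 r"
proof -
  let ?k = "corner_loop g q h"
  note g' = g[unfolded is_arm_def] and h' = h[unfolded is_arm_def]
  have C01: "C 0 = C 1" using C(2) by (simp add: pathfinish_def pathstart_def)
  have Cinj: "C a = C b \<Longrightarrow> a \<in> {0..1} \<Longrightarrow> b \<in> {0..1} \<Longrightarrow> a = b \<or> {a,b} = {0,1}" for a b
    using C(1) unfolding simple_path_def loop_free_def by blast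
  have z0s: "z0 \<notin> sphere z0 r" using r by auto
  have ne: "C u \<noteq> C w"
  proof
    assume "C u = C w"
    then have "pathfinish g \<in> path_image g \<inter> path_image h"
      using fin pathfinish_in_path_image[of g] pathfinish_in_path_image[of h] by simp
    then show False using gh g' z0s by auto
  qed
  have paths: "path C" "path g" "path h" using C(1) g' h' by (auto simp: simple_path_imp_path arc_imp_path)
  have qarc: "arc q" unfolding q_def using C(1) u ne by (intro arc_simple_path_subpath) auto
  have qs: "path_image q \<subseteq> sphere z0 r"
    unfolding q_def C(3)[symmetric] using u by (intro path_image_subpath_subset) auto
  then show "path_image q \<subseteq> sphere z0 r" .
  have q_ends: "pathstart q = C u" "pathfinish q = C w" by (auto simp: q_def)
  have bs: "ball z0 r \<inter> sphere z0 r = {}" by auto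
  have hq: "path_image q \<inter> path_image h \<subseteq> {C w}" using qs h' bs unfolding fin by blast
  have gq: "path_image q \<inter> path_image g \<subseteq> {C u}" using qs g' bs unfolding fin by blast
  have arc2: "arc (q +++ reversepath h)"
    using qarc h' hq fin q_ends by (intro arc_join) (auto simp: arc_reversepath)
  have im2: "path_image (q +++ reversepath h) = path_image q \<union> path_image h"
    using q_ends fin by (simp add: path_image_join)
  show simp: "simple_path ?k"
    unfolding corner_loop_def
    by (rule simple_path_join_loop) (use g' h' arc2 q_ends fin im2 gq gh in auto)
  show loop: "pathfinish ?k = pathstart ?k" using g' h' by (simp add: corner_loop_def)
  show im: "path_image ?k = path_image g \<union> path_image q \<union> path_image h"
    using q_ends fin im2 by (simp add: corner_loop_def path_image_join Un_assoc)
  show wn: "winding_number ?k x = winding_number g x + winding_number q x - winding_number h x"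
    if "x \<notin> path_image ?k" for x
  proof -
    have "x \<notin> path_image g" "x \<notin> path_image q" "x \<notin> path_image h" using that im by auto
    then show ?thesis
      using paths qarc q_ends fin arc2 im2
      by (simp add: corner_loop_def winding_number_join arc_imp_path winding_number_reversepath)
  qed
  define y where "y = C ((u+w)/2)"
  let ?m = "(u+w)/2"
  have m01: "?m \<in> {0..1}" "u < ?m" "?m < w" using u by auto
  define q1 where "q1 = subpath 0 u C" define q2 where "q2 = subpath w 1 C"
  have p12: "path q1" "path q2" using u paths by (auto simp: q1_def q2_def)
  have im12: "path_image q1 = C ` {0..u}" "path_image q2 = C ` {w..1}"
    using u by (auto simp: q1_def q2_def path_image_subpath)
  have y1: "y \<notin> path_image q1" "y \<notin> path_image q2"
  proof -
    have "C t \<noteq> y" if "t \<in> {0..u} \<union> {w..1}" for t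
      using Cinj[of t ?m] that m01 u unfolding y_def by (auto simp: doubleton_eq_iff)
    then show "y \<notin> path_image q1" "y \<notin> path_image q2" unfolding im12 by blast+
  qed
  have ys: "y \<in> sphere z0 r" unfolding y_def C(3)[symmetric] path_image_def using m01 by auto
  have "y \<noteq> C u" "y \<noteq> C w" unfolding y_def using Cinj[of ?m u] Cinj[of ?m w] m01 u by (auto simp: doubleton_eq_iff)
  then have y2: "y \<notin> path_image g" "y \<notin> path_image h" using ys g' h' fin by auto
  define D where "D x = winding_number g x - winding_number h x - winding_number q1 x - winding_number q2 x" for x
  have contD: "continuous (at y) D"
    unfolding D_def using y1 y2 paths p12 by (intro continuous_intros continuous_at_winding_number) auto
  let ?F = "path_image g \<union> path_image h \<union> path_image q1 \<union> path_image q2"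
  have "closed ?F" using paths p12 by (intro closed_Un closed_path_image)
  then obtain e1 where e1: "0 < e1" "ball y e1 \<inter> ?F = {}"
    using y1 y2 openE[of "- ?F" y] by (metis Compl_iff UnE disjoint_eq_subset_Compl open_Compl)
  obtain e2 where e2: "0 < e2" "\<And>x. dist x y < e2 \<Longrightarrow> dist (D x) (D y) < 1/4"
    using contD[unfolded continuous_at_eps_delta, rule_format, of "1/4"] by auto
  define e where "e = Min {e1, e2}"
  have "ball y e \<subseteq> ball y e1" by (auto simp: e_def)
  then have e: "0 < e" "ball y e \<inter> ?F = {}" "\<And>x. x \<in> ball y e \<Longrightarrow> dist (D x) (D y) < 1/4"
    subgoal using e1(1) e2(1) by (simp add: e_def)
    subgoal using e1(2) \<open>ball y e \<subseteq> ball y e1\<close> by blast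
    subgoal for x using e2(2)[of x] by (simp add: e_def dist_commute)
    done
  have DC: "D x = winding_number ?k x - winding_number C x" if "x \<in> ball y e" "x \<notin> sphere z0 r" for x
  proof -
    have nC: "x \<notin> path_image C" using that C by simp
    have "x \<notin> path_image q" using that qs by auto
    moreover have "x \<notin> ?F" using e(2) that by blast
    ultimately have "x \<notin> path_image ?k" using im by blast
    moreover have "winding_number C x = winding_number q1 x + winding_number q x + winding_number q2 x"
      using winding_number_subpath_combine[OF paths(1) nC, of 0 u w] winding_number_subpath_combine[OF paths(1) nC, of 0 w 1] u
      by (simp add: q1_def q2_def q_def)
    ultimately show ?thesis using wn by (simp add: D_def)
  qed
  have incb: "path_image ?k \<subseteq> cball z0 r" 
  proof -
    have "path_image g \<subseteq> cball z0 r" "path_image h \<subseteq> cball z0 r"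
      using g' h' ball_subset_cball[of z0 r] sphere_cball[of z0 r] by blast+
    then show ?thesis using im qs sphere_cball[of z0 r] by blast
  qed
  obtain x1 where x1: "x1 \<in> ball y e" "x1 \<notin> cball z0 r" using ball_Un_sphere_part[OF ys r e(1)] by auto
  have "winding_number ?k x1 = 0"
    using winding_number_zero_outside[of ?k "cball z0 r" x1] simp loop incb x1 by (simp add: simple_path_imp_path)
  moreover have "winding_number C x1 = 0"
    using winding_number_zero_outside[of C "cball z0 r" x1] C x1 by (simp add: simple_path_imp_path sphere_cball)
  ultimately have D1: "D x1 = 0" using DC[OF x1(1)] x1 by auto
  have "y \<in> closure (ball z0 r)" using ys r by auto
  then obtain x2 where x2: "x2 \<in> ball z0 r" "x2 \<in> ball y e"
    using e(1) centre_in_ball[of y e] open_Int_closure_eq_empty[OF open_ball, of y e "ball z0 r"] by blast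
  have nk: "x2 \<notin> path_image ?k" using im qs e(2) x2 bs by blast
  have D2: "D x2 = winding_number ?k x2 - 1" using DC[OF x2(2)] bspec[OF C(4) x2(1)] x2 by auto
  have "dist (D x1) (D x2) < 1/2"
    using e(3)[OF x1(1)] e(3)[OF x2(2)] dist_triangle3[of "D x1" "D x2" "D y"] by (simp add: dist_commute)
  then have "norm (winding_number ?k x2 - 1) < 1/2" using D1 D2 by (simp add: dist_norm norm_minus_commute)
  moreover have cases: "winding_number ?k x2 \<in> {-1,0,1}" using simple_closed_path_winding_number_cases[OF simp loop nk] .
  ultimately have one: "winding_number ?k x2 = 1" by auto
  have in_or_out: "x \<in> inside (path_image ?k) \<or> winding_number ?k x = 0" if "x \<notin> path_image ?k" for x
    using that inside_Un_outside[of "path_image ?k"] winding_number_zero_in_outside[of ?k x]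
      loop simple_path_imp_path[OF simp] by blast
  then have x2in: "x2 \<in> inside (path_image ?k)" using nk one by force
  have ins: "winding_number ?k z = 1" if "z \<in> inside (path_image ?k)" for z
    by (rule simple_closed_path_winding_number_inside[OF simp])
      (use one that x2in in auto)
  show "winding_number ?k x \<in> {0,1}" if "x \<notin> path_image ?k" for x
    using ins in_or_out[OF that] by auto
qed

text \<open>The Jordan curve theorem: every point of a simple closed curve is a limit of points
inside and of points outside.\<close>
lemma simple_loop_both_sides:
  assumes "simple_path k" "pathfinish k = pathstart k"
    and k: "\<And>x. x \<notin> path_image k \<Longrightarrow> winding_number k x \<in> {0,1}"
    and y: "y \<in> path_image k" "open O'" "y \<in> O'"
  shows "\<exists>x \<in> O' - path_image k. winding_number k x = 1"
    and "\<exists>x \<in> O' - path_image k. winding_number k x = 0"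
proof -
  note J = Jordan_inside_outside[OF assms(1,2)]
  have "y \<in> closure (inside (path_image k))" "y \<in> closure (outside (path_image k))"
    using J y(1) by (auto simp: frontier_def)
  then obtain a b where ab: "a \<in> inside (path_image k)" "a \<in> O'" "b \<in> outside (path_image k)" "b \<in> O'"
    using y(2,3) open_Int_closure_eq_empty[OF y(2)] by blast
  have a: "a \<notin> path_image k" and b: "b \<notin> path_image k" 
    using ab inside_no_overlap[of "path_image k"] outside_no_overlap[of "path_image k"] by blast+
  have "winding_number k a \<noteq> 0"
    using simple_closed_path_norm_winding_number_inside[OF assms(1) ab(1)] by auto
  then have "winding_number k a = 1" using k[OF a] by auto
  then show "\<exists>x \<in> O' - path_image k. winding_number k x = 1" using ab a by auto
  have "winding_number k b = 0"
    using winding_number_zero_in_outside assms(1,2) ab(3) simple_path_imp_path by blast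
  then show "\<exists>x \<in> O' - path_image k. winding_number k x = 0" using ab b by auto
qed

lemma based_circle:
  assumes r: "0 < r" and b: "b \<in> sphere z0 r"
  obtains C where "simple_path C" "pathfinish C = pathstart C" "path_image C = sphere z0 r"
      "\<And>x. x \<in> ball z0 r \<Longrightarrow> winding_number C x = 1" "C 0 = b" "C 1 = b"
proof -
  have "b \<in> path_image (circlepath z0 r)" using assms by simp
  then obtain a where a: "a \<in> {0..1}" "circlepath z0 r a = b" by (auto simp: path_image_def)
  let ?C = "shiftpath a (circlepath z0 r)"
  have loop: "pathfinish (circlepath z0 r) = pathstart (circlepath z0 r)" by simp
  have st: "pathstart ?C = b" using a by (simp add: pathstart_shiftpath)
  have fi: "pathfinish ?C = b" using a loop by (simp add: pathfinish_shiftpath)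
  show thesis
  proof (rule that[of ?C])
    show "simple_path ?C" using simple_path_shiftpath[OF _ loop, of a] a r by (simp add: simple_path_circlepath)
    show "path_image ?C = sphere z0 r" using path_image_shiftpath[OF a(1) loop] r by simp
    fix x assume "x \<in> ball z0 r"
    then have x: "norm (x - z0) < r" by (simp add: dist_norm norm_minus_commute)
    show "winding_number ?C x = 1"
      using winding_number_shiftpath[of "circlepath z0 r" x a] a x winding_number_circlepath[OF x] by (auto simp: dist_norm norm_minus_commute)
  qed (use st fi in \<open>auto simp: pathstart_def pathfinish_def\<close>)
qed

text \<open>Cutting an arc at its first exit from the disc turns its beginning into an arm.\<close>
lemma first_exit_arm:
  assumes g: "arc g" "pathstart g = z0" and r: "0 < r" "r \<le> dist z0 (pathfinish g)"
  obtains s where "0 < s" "s \<le> 1" "is_arm z0 r (subpath 0 s g)"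
proof -
  have "path g" using g by (simp add: arc_imp_path)
  moreover have "pathfinish g \<notin> ball z0 r" using r by auto
  ultimately obtain u where u: "0 \<le> u" "u \<le> 1" "\<And>x. 0 \<le> x \<and> x < u \<Longrightarrow> g x \<in> interior (ball z0 r)"
     "g u \<notin> interior (ball z0 r)" "u = 0 \<or> g u \<in> closure (ball z0 r)"
    using subpath_to_frontier_explicit[of g "ball z0 r"] by metis
  have u0: "u \<noteq> 0" using u(4) g(2) r by (auto simp: pathstart_def)
  then have gu: "g u \<in> sphere z0 r" using u r by auto
  have "is_arm z0 r (subpath 0 u g)"
    unfolding is_arm_def
  proof (intro conjI)
    show "arc (subpath 0 u g)" using g u u0 by (intro arc_subpath_arc) auto
    show "pathstart (subpath 0 u g) = z0" using g by (simp add: pathstart_def subpath_def)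
    show "pathfinish (subpath 0 u g) \<in> sphere z0 r" using gu by simp
    show "path_image (subpath 0 u g) - {pathfinish (subpath 0 u g)} \<subseteq> ball z0 r"
    proof
      fix y assume "y \<in> path_image (subpath 0 u g) - {pathfinish (subpath 0 u g)}"
      then obtain t where t: "t \<in> {0..u}" "y = g t" "y \<noteq> g u" using u by (auto simp: path_image_subpath)
      then have "t \<noteq> u" by blast
      then have "t < u" using t(1) by simp
      then show "y \<in> ball z0 r" using u(3)[of t] t by auto
    qed
  qed
  with that[of u] u u0 show thesis by auto
qed

section \<open>Drawings in charts and the sides of an edge\<close>

text \<open>Splitting and reversing, for curves that are continuous on a part of
\<open>[0,1]\<close> only: the preimage of a chart domain under a drawn edge is such a part.\<close>
lemma winding_number_subpath_combine_on:
  assumes g: "continuous_on {a..b} g" and z: "z \<notin> g ` {a..b}"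
    and uvw: "u \<in> {a..b}" "v \<in> {a..b}" "w \<in> {a..b}"
  shows "winding_number (subpath u v g) z + winding_number (subpath v w g) z = winding_number (subpath u w g) z"
proof (cases "a < b")
  case False
  then have "u = v" "v = w" using uvw by auto
  moreover have "z \<noteq> g w" using z uvw by auto
  ultimately show ?thesis by simp
next
  case ab: True
  define G where "G = subpath a b g"
  let ?n = "\<lambda>u. (u - a) / (b - a)"
  have path: "path G"
  proof -
    have "continuous_on {0..1} (g \<circ> (\<lambda>x. (b - a) * x + a))"
    proof (rule continuous_on_compose)
      have "(\<lambda>x. (b - a) * x + a) ` {0..1} \<subseteq> {a..b}"
      proof
        fix y assume "y \<in> (\<lambda>x. (b - a) * x + a) ` {0..1}"
        then obtain x where x': "y = (b - a) * x + a" "x \<in> {0..1}" by (rule imageE)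
        then have x: "y = (b - a) * x + a" "0 \<le> x" "x \<le> 1" by simp_all
        have "0 \<le> (b-a) * x" "(b-a) * x \<le> (b-a) * 1" using x ab by (auto intro: mult_left_mono)
        then show "y \<in> {a..b}" using x by auto
      qed
      then show "continuous_on ((\<lambda>x. (b - a) * x + a) ` {0..1}) g" using continuous_on_subset[OF g] by blast
    qed (intro continuous_intros)
    then show ?thesis by (simp add: G_def subpath_def path_def o_def)
  qed
  have im: "path_image G = g ` {a..b}" using ab by (simp add: G_def path_image_subpath)
  have sub: "subpath (?n u) (?n v) G = subpath u v g" for u v
  proof
    fix x
    have "(b-a) * ?n w = w - a" for w using ab by simp
    then have "((b-a) * ?n v - (b-a) * ?n u) * x + (b-a) * ?n u + a = (v - u) * x + u" by simp
    then have "(b-a) * ((?n v - ?n u) * x + ?n u) + a = (v - u) * x + u" by (simp only: algebra_simps)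
    then show "subpath (?n u) (?n v) G x = subpath u v g x" by (simp add: G_def subpath_def)
  qed
  have "?n u \<in> {0..1}" if "u \<in> {a..b}" for u using that ab by (auto simp: field_simps)
  with winding_number_subpath_combine[OF path, of z "?n u" "?n v" "?n w"] z im uvw sub show ?thesis by auto
qed

lemma corner_loop_winding:
  assumes "path g" "path q" "path h" "pathfinish g = pathstart q" "pathfinish q = pathfinish h"
    "x \<notin> path_image g" "x \<notin> path_image q" "x \<notin> path_image h"
  shows "winding_number (corner_loop g q h) x = winding_number g x + winding_number q x - winding_number h x"
  using assms by (simp add: corner_loop_def winding_number_join winding_number_reversepath path_image_join)

locale oriented_drawing =
  fixes G :: "'v pair_pre_digraph" and S :: "'s topology" and \<A> p c
  assumes graph: "pair_graph G" and hausdorff: "Hausdorff_space S" and compact: "compact_space S"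
    and atlas: "oriented_atlas S \<A>" and drawing: "graph_drawing G S p c"
begin

abbreviation "\<Gamma> \<equiv> drawing_image G p c"

lemma swap_arc: "e \<in> parcs G \<Longrightarrow> prod.swap e \<in> parcs G"
  using graph unfolding pair_graph_def pair_pseudo_graph_def pair_sym_digraph_def pair_sym_digraph_axioms_def
  by (cases e) (auto simp: symmetric_def sym_def)

lemma no_loop: "e \<in> parcs G \<Longrightarrow> fst e \<noteq> snd e"
  using graph pair_loopfree_digraph.pair_no_loops[of G e] by (simp add: pair_graph_def pair_digraph_def)

lemma arc_ends: "e \<in> parcs G \<Longrightarrow> fst e \<in> pverts G" "e \<in> parcs G \<Longrightarrow> snd e \<in> pverts G"
  using graph by (auto simp: pair_graph_def pair_digraph_def pair_loopfree_digraph_def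
      pair_wf_digraph.arc_fst_in_verts pair_wf_digraph.arc_snd_in_verts)

lemma finites: "finite (pverts G)" "finite (parcs G)"
  using graph by (auto simp: pair_graph_def pair_digraph_def pair_fin_digraph.pair_finite_verts pair_fin_digraph.pair_finite_arcs)

lemma curve:
  assumes "e \<in> parcs G"
  shows "pathin S (c e)" "inj_on (c e) {0..1}" "c e 0 = p (fst e)" "c e 1 = p (snd e)"
    "c e ` {0<..<1} \<inter> p ` pverts G = {}"
    "\<And>t. t \<in> {0..1} \<Longrightarrow> c (prod.swap e) t = c e (1 - t)"
  using drawing assms unfolding graph_drawing_def by (cases e; fastforce)+

lemma curves_disjoint:
  assumes "e \<in> parcs G" "e' \<in> parcs G" "e' \<noteq> e" "e' \<noteq> prod.swap e"
  shows "c e ` {0<..<1} \<inter> c e' ` {0<..<1} = {}"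
proof -
  obtain u v x y where e: "e = (u,v)" "e' = (x,y)" by (metis surj_pair)
  then have "{u,v} \<noteq> {x,y}" using assms by (auto simp: doubleton_eq_iff)
  moreover have "\<forall>(u, v) \<in> parcs G. \<forall>(x, y) \<in> parcs G. {u, v} \<noteq> {x, y} \<longrightarrow>
        c (u, v) ` {0<..<1} \<inter> c (x, y) ` {0<..<1} = {}"
    using drawing unfolding graph_drawing_def by (elim conjE)
  from bspec[OF this assms(1)] have "\<forall>(x, y) \<in> parcs G. {u, v} \<noteq> {x, y} \<longrightarrow>
        c (u, v) ` {0<..<1} \<inter> c (x, y) ` {0<..<1} = {}" unfolding e by simp
  from bspec[OF this assms(2)] have "{u, v} \<noteq> {x, y} \<longrightarrow> c e ` {0<..<1} \<inter> c e' ` {0<..<1} = {}" unfolding e by simp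
  ultimately show ?thesis by blast
qed

lemma p_inj: "inj_on p (pverts G)" and p_in: "p ` pverts G \<subseteq> topspace S"
  using drawing by (auto simp: graph_drawing_def)

lemma curve_interior_not_vertex: "e \<in> parcs G \<Longrightarrow> 0 < t \<Longrightarrow> t < 1 \<Longrightarrow> v \<in> pverts G \<Longrightarrow> c e t \<noteq> p v"
  using curve(5)[of e] by (metis disjoint_iff greaterThanLessThan_iff imageI)

lemma curve_eq_cases:
  assumes "e \<in> parcs G" "e' \<in> parcs G" "0 < t" "t < 1" "0 \<le> t'" "t' \<le> 1" "c e t = c e' t'"
  shows "e' = e \<and> t' = t \<or> e' = prod.swap e \<and> t' = 1 - t"
proof -
  have t': "0 < t'" "t' < 1"
    using curve_interior_not_vertex[OF assms(1,3,4)] assms(5,6,7) curve(3,4)[OF assms(2)] arc_ends[OF assms(2)]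
    by (metis order_le_less)+
  then have "c e t \<in> c e ` {0<..<1}" "c e' t' \<in> c e' ` {0<..<1}" using assms by (intro imageI; simp)+
  then have "c e t \<in> c e ` {0<..<1} \<inter> c e' ` {0<..<1}" using assms(7) by simp
  then have "e' = e \<or> e' = prod.swap e" using curves_disjoint[OF assms(1,2)] by blast
  then show ?thesis
  proof
    assume "e' = e"
    then show ?thesis using assms curve(2)[OF assms(1)] t' unfolding inj_on_def by auto
  next
    assume sw: "e' = prod.swap e"
    then have "c e t = c e (1 - t')" using curve(6)[OF assms(1), of t'] t' assms by auto
    then have "t = 1 - t'" using assms(3,4) curve(2)[OF assms(1)] t' unfolding inj_on_def by auto
    then show ?thesis using sw by auto
  qed
qed

lemma curve_closed:
  assumes "e \<in> parcs G" "0 \<le> a" "b \<le> 1"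
  shows "closedin S (c e ` {a..b})"
proof -
  have "compactin (top_of_set {0..1}) {a..b}" using assms by (auto simp: compactin_subtopology)
  then have "compactin S (c e ` {a..b})"
    using curve(1)[OF assms(1)] image_compactin unfolding pathin_def by blast
  then show ?thesis using hausdorff compactin_imp_closedin by blast
qed

lemma finite_closed: "finite X \<Longrightarrow> X \<subseteq> topspace S \<Longrightarrow> closedin S X"
  using closedin_Hausdorff_finite[OF hausdorff] by blast

lemma \<Gamma>_closed: "closedin S \<Gamma>"
  unfolding drawing_image_def
  using finites finite_closed[of "p ` pverts G"] p_in curve_closed[of _ 0 1]
  by (auto intro!: closedin_Un closedin_Union)

lemma \<Gamma>_in: "\<Gamma> \<subseteq> topspace S" using \<Gamma>_closed closedin_subset by blast

lemma in_\<Gamma>_cases: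
  assumes "x \<in> \<Gamma>"
  obtains v where "v \<in> pverts G" "x = p v" | e t where "e \<in> parcs G" "0 < t" "t < 1" "x = c e t"
proof -
  consider "x \<in> p ` pverts G" | e t where "e \<in> parcs G" "t \<in> {0..1}" "x = c e t" "x \<notin> p ` pverts G"
    using assms unfolding drawing_image_def by blast
  then show thesis
  proof cases
    case 1 then show ?thesis using that(1) by blast
  next
    case 2
    have "t \<noteq> 0" "t \<noteq> 1" using 2 curve(3,4)[OF 2(1)] arc_ends[OF 2(1)] by auto
    then show ?thesis using that(2)[OF 2(1), of t] 2 by auto
  qed
qed

lemma curve_in_\<Gamma>: "e \<in> parcs G \<Longrightarrow> 0 \<le> t \<Longrightarrow> t \<le> 1 \<Longrightarrow> c e t \<in> \<Gamma>"
  unfolding drawing_image_def using atLeastAtMost_iff[of t 0 1] by blast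

lemma chart:
  assumes "(U,\<phi>) \<in> \<A>"
  shows "openin S U" "open (\<phi> ` U)" "homeomorphic_map (subtopology S U) (top_of_set (\<phi> ` U)) \<phi>"
    "inj_on \<phi> U" "U \<subseteq> topspace S"
proof -
  show *: "openin S U" "open (\<phi> ` U)" "homeomorphic_map (subtopology S U) (top_of_set (\<phi> ` U)) \<phi>"
    using atlas assms unfolding oriented_atlas_def planar_chart_def by blast+
  then show "U \<subseteq> topspace S" using openin_subset by blast
  then show "inj_on \<phi> U" using homeomorphic_imp_injective_map[OF *(3)] by (simp add: Int_absorb1)
qed

lemma chart_cover: "x \<in> topspace S \<Longrightarrow> \<exists>(U,\<phi>) \<in> \<A>. x \<in> U"
  using atlas unfolding oriented_atlas_def by blast

lemma chart_open_preimage: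
  assumes "(U,\<phi>) \<in> \<A>" "open O'" shows "openin S {x\<in>U. \<phi> x \<in> O'}"
proof -
  have "continuous_map (subtopology S U) euclidean \<phi>"
    using homeomorphic_imp_continuous_map[OF chart(3)[OF assms(1)]]
    by (simp add: continuous_map_in_subtopology)
  then have "openin (subtopology S U) {x \<in> topspace (subtopology S U). \<phi> x \<in> O'}"
    by (rule openin_continuous_map_preimage) (use assms(2) in simp)
  moreover have "topspace (subtopology S U) = U"
    by (rule topspace_subtopology_subset[OF chart(5)[OF assms(1)]])
  ultimately have "openin (subtopology S U) {x \<in> U. \<phi> x \<in> O'}" by (simp only:)
  then show ?thesis using openin_open_subtopology[OF chart(1)[OF assms(1)]] by blast
qed

lemma chart_open_image:
  assumes "(U,\<phi>) \<in> \<A>" "openin S W" "W \<subseteq> U" shows "open (\<phi> ` W)"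
proof -
  have "openin (subtopology S U) W" using assms chart(1) openin_open_subtopology by blast
  then have "openin (top_of_set (\<phi> ` U)) (\<phi> ` W)"
    using homeomorphic_imp_open_map[OF chart(3)[OF assms(1)]] by (simp add: open_map_def)
  then show ?thesis using chart(2)[OF assms(1)] openin_open_trans by blast
qed

lemma chart_curve_continuous:
  assumes "(U,\<phi>) \<in> \<A>" "e \<in> parcs G" "0 \<le> a" "b \<le> 1" "c e ` {a..b} \<subseteq> U"
  shows "continuous_on {a..b} (\<phi> \<circ> c e)"
proof -
  have "continuous_map (subtopology S U) euclidean \<phi>"
    using homeomorphic_imp_continuous_map[OF chart(3)[OF assms(1)]]
    by (simp add: continuous_map_in_subtopology)
  moreover have "continuous_map (top_of_set {a..b}) (subtopology S U) (c e)"
  proof -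
    have "continuous_map (top_of_set {0..1}) S (c e)" using curve(1)[OF assms(2)] by (simp add: pathin_def)
    then have "continuous_map (top_of_set {a..b}) S (c e)"
      using continuous_map_from_subtopology_mono[of euclidean "{0..1}" S "c e" "{a..b}"] assms(3,4) by auto
    then show ?thesis using assms(5) by (auto simp: continuous_map_in_subtopology)
  qed
  ultimately have "continuous_map (top_of_set {a..b}) euclidean (\<phi> \<circ> c e)" by (rule continuous_map_compose[rotated])
  then show ?thesis by simp
qed

lemma chart_curve_inj:
  assumes "(U,\<phi>) \<in> \<A>" "e \<in> parcs G" "0 \<le> a" "b \<le> 1" "c e ` {a..b} \<subseteq> U"
  shows "inj_on (\<phi> \<circ> c e) {a..b}"
proof (rule comp_inj_on)
  show "inj_on (c e) {a..b}" using curve(2)[OF assms(2)] by (rule inj_on_subset) (use assms in auto)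
  show "inj_on \<phi> (c e ` {a..b})" using chart(4)[OF assms(1)] assms(5) by (rule inj_on_subset)
qed

lemma subpath_path_on:
  fixes g :: "real \<Rightarrow> complex"
  assumes "continuous_on {a..b} g" "u \<in> {a..b}" "v \<in> {a..b}"
  shows "path (subpath u v g)"
proof -
  have "continuous_on {0..1} (g \<circ> (\<lambda>x. (v - u) * x + u))"
  proof (rule continuous_on_compose)
    have "(\<lambda>x. (v - u) * x + u) ` {0..1} \<subseteq> closed_segment u v"
      unfolding closed_segment_real_eq by auto
    also have "\<dots> \<subseteq> {a..b}" using assms(2,3) by (auto simp: closed_segment_eq_real_ivl split: if_splits)
    finally show "continuous_on ((\<lambda>x. (v - u) * x + u) ` {0..1}) g" using continuous_on_subset[OF assms(1)] by blast
  qed (intro continuous_intros)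
  then show ?thesis by (simp add: subpath_def path_def o_def)
qed

lemma subpath_arc_on:
  fixes g :: "real \<Rightarrow> complex"
  assumes "continuous_on {a..b} g" "inj_on g {a..b}" "u \<in> {a..b}" "v \<in> {a..b}" "u < v"
  shows "arc (subpath u v g)"
  unfolding arc_def
proof
  show "path (subpath u v g)" using subpath_path_on assms by blast
  show "inj_on (subpath u v g) {0..1}"
  proof (rule inj_onI)
    fix x y :: real assume xy: "x \<in> {0..1}" "y \<in> {0..1}" "subpath u v g x = subpath u v g y"
    have "(v-u) * z + u \<in> {a..b}" if "z \<in> {0..1}" for z
    proof -
      have "0 \<le> (v-u)*z" "(v-u) * z \<le> (v-u)*1" using that assms(5) by (auto intro: mult_left_mono)
      then show ?thesis using assms(3,4) by auto
    qed
    then have "(v-u) * x + u = (v-u) * y + u" using xy assms(2) unfolding subpath_def inj_on_def by blast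
    then show "x = y" using assms(5) by simp
  qed
qed

text \<open>Statements about all points off the drawing that are close to \<open>q\<close>, that is,
germs at \<open>q\<close>.\<close>
definition near :: "'s \<Rightarrow> ('s \<Rightarrow> bool) \<Rightarrow> bool" where
  "near q Q \<longleftrightarrow> (\<exists>O'. openin S O' \<and> q \<in> O' \<and> (\<forall>x \<in> O' - \<Gamma>. Q x))"

lemma near_conj: "near q Q \<Longrightarrow> near q R \<Longrightarrow> near q (\<lambda>x. Q x \<and> R x)"
  unfolding near_def by (metis (no_types, opaque_lifting) DiffD1 DiffD2 DiffI IntD1 IntD2 IntI openin_Int)

lemma near_mono: "near q Q \<Longrightarrow> (\<And>x. x \<notin> \<Gamma> \<Longrightarrow> Q x \<Longrightarrow> R x) \<Longrightarrow> near q R"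
  unfolding near_def by blast

lemma near_openin: "openin S O' \<Longrightarrow> q \<in> O' \<Longrightarrow> near q (\<lambda>x. x \<in> O')"
  unfolding near_def by blast

text \<open>The condition that neither the set nor its complement is empty as a germ; it excludes
degenerate choices of a side below.\<close>
definition both_sides :: "'s \<Rightarrow> 's set \<Rightarrow> bool" where
  "both_sides q P \<longleftrightarrow> \<not> near q (\<lambda>x. x \<in> P) \<and> \<not> near q (\<lambda>x. x \<notin> P)"

text \<open>The set \<open>P\<close> is, near the point \<open>c e t\<close>, the left side of the
directed edge \<open>e\<close>. The winding number of a short piece of the edge, taken around a
point off the edge, is not an integer, but it jumps by one when that point crosses the edge. Up to a
correction \<open>\<l>\<close> that is continuous at the point it is therefore the indicator
function of the left side.\<close>
definition side_in :: "'s set \<Rightarrow> ('s \<Rightarrow> complex) \<Rightarrow> 'v \<times> 'v \<Rightarrow> real \<Rightarrow> 's set \<Rightarrow> bool" where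
  "side_in U \<phi> e t P \<longleftrightarrow> both_sides (c e t) P \<and> (\<exists>a b \<l>. 0 \<le> a \<and> a < t \<and> t < b \<and> b \<le> 1 \<and>
     c e ` {a..b} \<subseteq> U \<and> isCont \<l> (\<phi> (c e t)) \<and>
     near (c e t) (\<lambda>x. winding_number (subpath a b (\<phi> \<circ> c e)) (\<phi> x) + \<l> (\<phi> x) = of_bool (x \<in> P)))"

definition side :: "'v \<times> 'v \<Rightarrow> real \<Rightarrow> 's set \<Rightarrow> bool" where
  "side e t P \<longleftrightarrow> (\<exists>(U,\<phi>) \<in> \<A>. side_in U \<phi> e t P)"

lemma near_continuous:
  fixes h :: "complex \<Rightarrow> 'b::metric_space"
  assumes "(U,\<phi>) \<in> \<A>" "q \<in> U" "isCont h (\<phi> q)" "0 < \<epsilon>"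
  shows "near q (\<lambda>x. dist (h (\<phi> x)) (h (\<phi> q)) < \<epsilon>)"
proof -
  obtain \<delta> where \<delta>: "0 < \<delta>" "\<And>z. dist z (\<phi> q) < \<delta> \<Longrightarrow> dist (h z) (h (\<phi> q)) < \<epsilon>"
    using assms(3,4) unfolding continuous_at_eps_delta by blast
  have "openin S {x\<in>U. \<phi> x \<in> ball (\<phi> q) \<delta>}" by (rule chart_open_preimage) (use assms in auto)
  then show ?thesis unfolding near_def
    by (rule_tac exI[of _ "{x\<in>U. \<phi> x \<in> ball (\<phi> q) \<delta>}"]) (use \<delta> assms in \<open>auto simp: dist_commute\<close>)
qed

text \<open>Two left sides of the same directed edge have indicator functions whose difference is
the difference of two continuous corrections, plus the winding numbers of two remaining pieces of
the edge, which are continuous at the point as well. An integer valued function with a limit is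
constant near the point, and \<open>both_sides\<close> forces that constant to be zero.\<close>
lemma side_in_unique:
  assumes U: "(U,\<phi>) \<in> \<A>" and e: "e \<in> parcs G" and P: "side_in U \<phi> e t P" and P': "side_in U \<phi> e t P'"
  shows "near (c e t) (\<lambda>x. x \<in> P \<longleftrightarrow> x \<in> P')"
proof -
  let ?g = "\<phi> \<circ> c e" let ?q = "c e t"
  obtain a b l where 1: "0 \<le> a" "a < t" "t < b" "b \<le> 1" "c e ` {a..b} \<subseteq> U" "isCont l (\<phi> ?q)"
     "near ?q (\<lambda>x. winding_number (subpath a b ?g) (\<phi> x) + l (\<phi> x) = of_bool (x \<in> P))"
    using P unfolding side_in_def by blast
  obtain a' b' l' where 2: "0 \<le> a'" "a' < t" "t < b'" "b' \<le> 1" "c e ` {a'..b'} \<subseteq> U" "isCont l' (\<phi> ?q)"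
     "near ?q (\<lambda>x. winding_number (subpath a' b' ?g) (\<phi> x) + l' (\<phi> x) = of_bool (x \<in> P'))"
    using P' unfolding side_in_def by blast
  define a0 where "a0 = max a a'" define b0 where "b0 = min b b'"
  have ab0: "a \<le> a0" "a' \<le> a0" "a0 < t" "t < b0" "b0 \<le> b" "b0 \<le> b'" using 1 2 by (auto simp: a0_def b0_def)
  have cont: "continuous_on {a..b} ?g" "continuous_on {a'..b'} ?g"
    using chart_curve_continuous[OF U e] 1 2 by auto
  have inj: "inj_on ?g {a..b}" "inj_on ?g {a'..b'}" using chart_curve_inj[OF U e] 1 2 by auto
  have qU: "?q \<in> U" using 1 by auto
  define h where "h z = winding_number (subpath a a0 ?g) z + winding_number (subpath b0 b ?g) z + l z
     - (winding_number (subpath a' a0 ?g) z + winding_number (subpath b0 b' ?g) z + l' z)" for z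
  have cw: "isCont (winding_number (subpath u v ?g)) (\<phi> ?q)"
    if as: "continuous_on {a1..b1} ?g" "inj_on ?g {a1..b1}" "u \<in> {a1..b1}" "v \<in> {a1..b1}" "u \<le> v" "t \<in> {a1..b1}" "t \<notin> {u..v}"
    for a1 b1 u v
  proof (rule continuous_at_winding_number)
    show "path (subpath u v ?g)" using subpath_path_on[OF as(1,3,4)] .
    show "\<phi> ?q \<notin> path_image (subpath u v ?g)"
    proof
      assume "\<phi> ?q \<in> path_image (subpath u v ?g)"
      then obtain s where s: "s \<in> {u..v}" "?g t = ?g s" using as(5) by (auto simp: path_image_subpath)
      then have "t = s" using inj_onD[OF as(2) s(2)] as by auto
      then show False using s as by auto
    qed
  qed
  have conth: "isCont h (\<phi> ?q)"
  proof -
    have "isCont (winding_number (subpath a a0 ?g)) (\<phi> ?q)" "isCont (winding_number (subpath b0 b ?g)) (\<phi> ?q)"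
      by (rule cw[OF cont(1) inj(1)]; use 1(2,3) ab0 in simp)+
    moreover have "isCont (winding_number (subpath a' a0 ?g)) (\<phi> ?q)" "isCont (winding_number (subpath b0 b' ?g)) (\<phi> ?q)"
      by (rule cw[OF cont(2) inj(2)]; use 2(2,3) ab0 in simp)+
    ultimately show ?thesis unfolding h_def by (intro isCont_diff isCont_add 1(6) 2(6))
  qed
  have offg: "\<phi> x \<notin> ?g ` {a1..b1}" if as: "x \<in> U" "x \<notin> \<Gamma>" "0 \<le> a1" "b1 \<le> 1" "c e ` {a1..b1} \<subseteq> U" for x a1 b1
  proof
    assume "\<phi> x \<in> ?g ` {a1..b1}"
    then obtain s where s: "s \<in> {a1..b1}" "\<phi> x = \<phi> (c e s)" by auto
    then have "x = c e s" using inj_onD[OF chart(4)[OF U] s(2) as(1)] as(5) by blast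
    then show False using as s curve_in_\<Gamma>[OF e, of s] by auto
  qed
  have hval: "near ?q (\<lambda>x. h (\<phi> x) = of_bool (x \<in> P) - of_bool (x \<in> P'))"
  proof (rule near_mono[OF near_conj[OF near_conj[OF 1(7) 2(7)] near_openin[OF chart(1)[OF U] qU]]])
    fix x assume x: "x \<notin> \<Gamma>" "((winding_number (subpath a b ?g) (\<phi> x) + l (\<phi> x) = of_bool (x \<in> P)) \<and>
       (winding_number (subpath a' b' ?g) (\<phi> x) + l' (\<phi> x) = of_bool (x \<in> P'))) \<and> x \<in> U"
    have n1: "\<phi> x \<notin> ?g ` {a..b}" and n2: "\<phi> x \<notin> ?g ` {a'..b'}" using offg x 1 2 by auto
    note w1 = winding_number_subpath_combine_on[OF cont(1) n1]
    note w2 = winding_number_subpath_combine_on[OF cont(2) n2]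
    have "winding_number (subpath a b ?g) (\<phi> x) = winding_number (subpath a a0 ?g) (\<phi> x)
        + winding_number (subpath a0 b0 ?g) (\<phi> x) + winding_number (subpath b0 b ?g) (\<phi> x)"
    proof -
      have m: "a \<in> {a..b}" "a0 \<in> {a..b}" "b0 \<in> {a..b}" "b \<in> {a..b}" using ab0 by auto
      show ?thesis using w1[OF m(1,2,4)] w1[OF m(2,3,4)] by (simp only: add.assoc)
    qed
    moreover have "winding_number (subpath a' b' ?g) (\<phi> x) = winding_number (subpath a' a0 ?g) (\<phi> x)
        + winding_number (subpath a0 b0 ?g) (\<phi> x) + winding_number (subpath b0 b' ?g) (\<phi> x)"
    proof -
      have m: "a' \<in> {a'..b'}" "a0 \<in> {a'..b'}" "b0 \<in> {a'..b'}" "b' \<in> {a'..b'}" using ab0 by auto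
      show ?thesis using w2[OF m(1,2,4)] w2[OF m(2,3,4)] by (simp only: add.assoc)
    qed
    ultimately show "h (\<phi> x) = of_bool (x \<in> P) - of_bool (x \<in> P')"
      unfolding h_def x(2)[THEN conjunct1, THEN conjunct1, symmetric] x(2)[THEN conjunct1, THEN conjunct2, symmetric]
      by (simp only: algebra_simps)
  qed
  obtain O' where O': "openin S O'" "?q \<in> O'" "\<And>x. x \<in> O' - \<Gamma> \<Longrightarrow> h (\<phi> x) = of_bool (x \<in> P) - of_bool (x \<in> P')"
     "\<And>x. x \<in> O' - \<Gamma> \<Longrightarrow> dist (h (\<phi> x)) (h (\<phi> ?q)) < 1/2"
  proof -
    have "near ?q (\<lambda>x. dist (h (\<phi> x)) (h (\<phi> ?q)) < 1/2)" by (rule near_continuous[OF U qU conth]) simp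
    from near_conj[OF hval this] show ?thesis using that unfolding near_def by blast
  qed
  have eq: "h (\<phi> x) = h (\<phi> y)" if "x \<in> O' - \<Gamma>" "y \<in> O' - \<Gamma>" for x y
  proof -
    have "dist (h (\<phi> x)) (h (\<phi> y)) < 1"
      using O'(4)[OF that(1)] O'(4)[OF that(2)] dist_triangle2[of "h (\<phi> x)" "h (\<phi> y)" "h (\<phi> ?q)"] by linarith
    then show ?thesis unfolding O'(3)[OF that(1)] O'(3)[OF that(2)]
      by (cases "x \<in> P"; cases "x \<in> P'"; cases "y \<in> P"; cases "y \<in> P'"; simp add: dist_norm)
  qed
  obtain x1 x2 where x: "x1 \<in> O' - \<Gamma>" "x1 \<in> P" "x2 \<in> O' - \<Gamma>" "x2 \<notin> P"
    using P O'(1,2) unfolding side_in_def both_sides_def near_def by metis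
  have h0: "h (\<phi> x1) = 0"
    using eq[OF x(1,3)] x(2,4) unfolding O'(3)[OF x(1)] O'(3)[OF x(3)]
    by (cases "x1 \<in> P'"; cases "x2 \<in> P'"; simp)
  show ?thesis unfolding near_def
  proof (intro exI conjI ballI)
    fix y assume y: "y \<in> O' - \<Gamma>"
    show "y \<in> P \<longleftrightarrow> y \<in> P'" 
      using trans[OF eq[OF y x(1)] h0] unfolding O'(3)[OF y] by (cases "y \<in> P"; cases "y \<in> P'"; simp)
  qed (use O' in auto)
qed

end

section \<open>Small neighbourhoods of interior points of edges\<close>

lemma is_arm_cong:
  assumes "is_arm z0 r g" "\<And>x. x \<in> {0..1} \<Longrightarrow> g x = h x"
  shows "is_arm z0 r h"
proof -
  have "path_image h = path_image g" "pathstart h = pathstart g" "pathfinish h = pathfinish g"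
    using assms(2) by (auto simp: path_image_def pathstart_def pathfinish_def intro!: image_cong)
  moreover have "arc h"
  proof -
    have "arc g" using assms(1) by (simp add: is_arm_def)
    then have g: "continuous_on {0..1} g" "inj_on g {0..1}" by (simp_all add: arc_def path_def)
    have "continuous_on {0..1} h" using continuous_on_cong[of "{0..1}" "{0..1}" g h] assms(2) g(1) by simp
    moreover have "inj_on h {0..1}" using inj_on_cong[of "{0..1}" g h] assms(2) g(2) by simp
    ultimately show ?thesis by (simp add: arc_def path_def)
  qed
  ultimately show ?thesis using assms(1) by (simp add: is_arm_def)
qed

context oriented_drawing begin

lemma curve_locally_in:
  assumes "e \<in> parcs G" "openin S W" "0 \<le> t" "t < 1" "c e t \<in> W"
  obtains b where "t < b" "b < 1" "c e ` {t..b} \<subseteq> W"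
proof -
  have "continuous_map (top_of_set {0..1}) S (c e)" using curve(1)[OF assms(1)] by (simp add: pathin_def)
  then have "openin (top_of_set {0..1}) {s \<in> {0..1}. c e s \<in> W}"
    using openin_continuous_map_preimage[OF _ assms(2), of "top_of_set {0..1}" "c e"] by simp
  moreover have "t \<in> {s \<in> {0..1}. c e s \<in> W}" using assms by auto
  ultimately obtain \<delta> where d: "0 < \<delta>" "\<And>s. s \<in> {0..1} \<Longrightarrow> dist s t < \<delta> \<Longrightarrow> s \<in> {s \<in> {0..1}. c e s \<in> W}"
    unfolding openin_euclidean_subtopology_iff by blast
  define b where "b = min (t + \<delta>/2) ((t+1)/2)"
  have b: "t < b" "b < 1" "b \<le> t + \<delta>/2" using assms(4) d(1) by (auto simp: b_def min_def)
  have "c e s \<in> W" if "s \<in> {t..b}" for s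
  proof -
    have "s \<in> {0..1}" "dist s t < \<delta>" using that b assms(3) d(1) by (auto simp: dist_real_def)
    then show ?thesis using d(2) by blast
  qed
  then show thesis using b that by blast
qed

lemma forward_arm:
  assumes e: "e \<in> parcs G" and U: "(U,\<phi>) \<in> \<A>" and t: "0 \<le> t" "t < 1" "c e t \<in> U"
  obtains R where "0 < R" "\<And>r. 0 < r \<Longrightarrow> r < R \<Longrightarrow> \<exists>b. t < b \<and> b < 1 \<and> c e ` {t..b} \<subseteq> U \<and>
     is_arm (\<phi> (c e t)) r (subpath t b (\<phi> \<circ> c e))"
proof -
  obtain b0 where b0: "t < b0" "b0 < 1" "c e ` {t..b0} \<subseteq> U"
    using curve_locally_in[OF e chart(1)[OF U] t] by blast
  let ?F = "\<phi> \<circ> c e"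
  have F: "continuous_on {t..b0} ?F" "inj_on ?F {t..b0}"
    using chart_curve_continuous[OF U e t(1) _ b0(3)] chart_curve_inj[OF U e t(1) _ b0(3)] b0 by auto
  define f where "f = subpath t b0 ?F"
  have arc: "arc f" unfolding f_def using subpath_arc_on[OF F] b0 by simp
  have ends: "pathstart f = ?F t" "pathfinish f = ?F b0" by (auto simp: f_def)
  define R where "R = dist (?F t) (?F b0)"
  have "?F t \<noteq> ?F b0" using inj_onD[OF F(2), of t b0] b0 by auto
  then have R: "0 < R" by (simp add: R_def)
  show thesis
  proof (rule that[OF R])
    fix r assume r: "0 < r" "r < R"
    then obtain s where s: "0 < s" "s \<le> 1" "is_arm (?F t) r (subpath 0 s f)"
      using first_exit_arm[OF arc ends(1) r(1)] ends(2) by (auto simp: R_def)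
    define b where "b = t + s * (b0 - t)"
    have eq: "subpath 0 s f = subpath t b ?F"
    proof
      fix x
      have "(b0 - t) * ((s - 0) * x + 0) + t = (b - t) * x + t" by (simp add: b_def algebra_simps)
      then show "subpath 0 s f x = subpath t b ?F x" by (simp only: f_def subpath_def)
    qed
    have "s * (b0 - t) \<le> 1 * (b0 - t)" using s b0 by (intro mult_right_mono) simp_all
    moreover have "0 < s * (b0 - t)" using s b0 by simp
    ultimately have "t < b" "b \<le> b0" by (auto simp: b_def)
    then show "\<exists>b. t < b \<and> b < 1 \<and> c e ` {t..b} \<subseteq> U \<and> is_arm (\<phi> (c e t)) r (subpath t b (\<phi> \<circ> c e))"
      using s(3) eq b0 by (intro exI[of _ b]) auto
  qed
qed

text \<open>A positively oriented Jordan curve that runs through a piece of the edge has its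
interior on the left of that piece: the rest of the curve stays away from the point and contributes
the continuous correction.\<close>
lemma side_inI:
  assumes U: "(U,\<phi>) \<in> \<A>" and e: "e \<in> parcs G" and ab: "0 \<le> a" "a < t" "t < b" "b \<le> 1" "c e ` {a..b} \<subseteq> U"
    and k: "simple_path k" "pathfinish k = pathstart k" "\<And>z. z \<notin> path_image k \<Longrightarrow> winding_number k z \<in> {0,1}"
    and l: "isCont l (\<phi> (c e t))"
      "\<And>z. z \<notin> path_image k \<Longrightarrow> winding_number k z = winding_number (subpath a b (\<phi> \<circ> c e)) z + l z"
    and O': "openin S O'" "c e t \<in> O'" "O' \<subseteq> U" "\<And>x. x \<in> O' \<Longrightarrow> \<phi> x \<in> path_image k \<longleftrightarrow> x \<in> \<Gamma>"
    and P: "\<And>x. x \<in> O' - \<Gamma> \<Longrightarrow> x \<in> P \<longleftrightarrow> winding_number k (\<phi> x) = 1"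
  shows "side_in U \<phi> e t P"
proof -
  have q: "c e t \<in> \<Gamma>" using curve_in_\<Gamma>[OF e] ab by auto
  have ex: "\<exists>x \<in> O'' - \<Gamma>. x \<in> O' \<and> winding_number k (\<phi> x) = i" if "openin S O''" "c e t \<in> O''" "i \<in> {0,1}" for O'' i
  proof -
    have "open (\<phi> ` (O' \<inter> O''))" by (rule chart_open_image[OF U]) (use that O' in auto)
    moreover have "\<phi> (c e t) \<in> \<phi> ` (O' \<inter> O'')" using that O' by auto
    moreover have "\<phi> (c e t) \<in> path_image k" using O'(2,4) q by auto
    ultimately have "\<exists>z \<in> \<phi> ` (O' \<inter> O'') - path_image k. winding_number k z = i"
      using simple_loop_both_sides[OF k, of "\<phi> (c e t)" "\<phi> ` (O' \<inter> O'')"] that(3) by blast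
    then show ?thesis using O'(4) by blast
  qed
  have "both_sides (c e t) P"
    unfolding both_sides_def near_def
  proof safe
    fix O'' assume O2: "openin S O''" "c e t \<in> O''" "\<forall>x\<in>O'' - \<Gamma>. x \<in> P"
    obtain x where "x \<in> O'' - \<Gamma>" "x \<in> O'" "winding_number k (\<phi> x) = 0" using ex[OF O2(1,2), of 0] by auto
    then show False using O2(3) P[of x] by auto
  next
    fix O'' assume O2: "openin S O''" "c e t \<in> O''" "\<forall>x\<in>O'' - \<Gamma>. x \<notin> P"
    obtain x where "x \<in> O'' - \<Gamma>" "x \<in> O'" "winding_number k (\<phi> x) = 1" using ex[OF O2(1,2), of 1] by auto
    then show False using O2(3) P[of x] by auto
  qed
  moreover have "near (c e t) (\<lambda>x. winding_number (subpath a b (\<phi> \<circ> c e)) (\<phi> x) + l (\<phi> x) = of_bool (x \<in> P))"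
    unfolding near_def
  proof (intro exI[of _ O'] conjI ballI)
    fix x assume x: "x \<in> O' - \<Gamma>"
    then have "\<phi> x \<notin> path_image k" using O'(4) by auto
    then have "winding_number k (\<phi> x) = winding_number (subpath a b (\<phi> \<circ> c e)) (\<phi> x) + l (\<phi> x)"
      "winding_number k (\<phi> x) \<in> {0,1}" using l(2) k(3) by auto
    then show "winding_number (subpath a b (\<phi> \<circ> c e)) (\<phi> x) + l (\<phi> x) = of_bool (x \<in> P)"
      using P[OF x] by (cases "x \<in> P") auto
  qed (use O' in auto)
  ultimately show ?thesis unfolding side_in_def using ab l(1) by blast
qed

lemma backward_arm:
  assumes e: "e \<in> parcs G" and U: "(U,\<phi>) \<in> \<A>" and t: "0 < t" "t \<le> 1" "c e t \<in> U"
  obtains R where "0 < R" "\<And>r. 0 < r \<Longrightarrow> r < R \<Longrightarrow> \<exists>a. 0 < a \<and> a < t \<and> c e ` {a..t} \<subseteq> U \<and>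
     is_arm (\<phi> (c e t)) r (subpath t a (\<phi> \<circ> c e))"
proof -
  have sw: "c (prod.swap e) (1 - t) = c e t" using curve(6)[OF e, of "1-t"] t by auto
  obtain R where R: "0 < R" "\<And>r. 0 < r \<Longrightarrow> r < R \<Longrightarrow> \<exists>b. 1 - t < b \<and> b < 1 \<and> c (prod.swap e) ` {1-t..b} \<subseteq> U \<and>
     is_arm (\<phi> (c e t)) r (subpath (1-t) b (\<phi> \<circ> c (prod.swap e)))"
    using forward_arm[OF swap_arc[OF e] U, of "1-t"] t sw by auto
  show thesis
  proof (rule that[OF R(1)])
    fix r assume "0 < r" "r < R"
    then obtain b where b: "1 - t < b" "b < 1" "c (prod.swap e) ` {1-t..b} \<subseteq> U"
       "is_arm (\<phi> (c e t)) r (subpath (1-t) b (\<phi> \<circ> c (prod.swap e)))" using R(2) by blast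
    have "c e ` {1-b..t} \<subseteq> U"
    proof safe
      fix s assume "s \<in> {1-b..t}"
      then have "c e s = c (prod.swap e) (1 - s)" "1 - s \<in> {1-t..b}" using curve(6)[OF e, of "1-s"] t b by auto
      then show "c e s \<in> U" using b(3) by auto
    qed
    moreover have "is_arm (\<phi> (c e t)) r (subpath t (1-b) (\<phi> \<circ> c e))"
    proof (rule is_arm_cong[OF b(4)])
      fix x :: real assume x: "x \<in> {0..1}"
      let ?y = "(b - (1-t)) * x + (1-t)"
      define D where "D = (b - (1-t)) * x"
      have "0 \<le> D" unfolding D_def using x b by (intro mult_nonneg_nonneg) simp_all
      moreover have "D \<le> (b - (1-t)) * 1" unfolding D_def using x b by (intro mult_left_mono) simp_all
      ultimately have "D + (1-t) \<in> {0..1}" using b t by simp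
      then have "?y \<in> {0..1}" by (simp only: D_def)
      then have "c (prod.swap e) ?y = c e (1 - ?y)" using curve(6)[OF e] by blast
      moreover have "1 - ?y = ((1-b) - t) * x + t" by (simp add: algebra_simps)
      ultimately show "subpath (1-t) b (\<phi> \<circ> c (prod.swap e)) x = subpath t (1-b) (\<phi> \<circ> c e) x"
        by (simp add: subpath_def)
    qed
    ultimately show "\<exists>a. 0 < a \<and> a < t \<and> c e ` {a..t} \<subseteq> U \<and> is_arm (\<phi> (c e t)) r (subpath t a (\<phi> \<circ> c e))"
      using b by (intro exI[of _ "1-b"]) auto
  qed
qed

text \<open>The two halves of an edge at an interior point are arms of every small disc.\<close>
lemma edge_loop:
  assumes e: "e \<in> parcs G" and U: "(U,\<phi>) \<in> \<A>" and t: "0 < t" "t < 1" "c e t \<in> U" and R: "0 < R"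
  obtains r a b C s where "0 < r" "r < R" "0 < a" "a < t" "t < b" "b < 1" "c e ` {a..b} \<subseteq> U"
    "is_arm (\<phi> (c e t)) r (subpath t b (\<phi> \<circ> c e))" "is_arm (\<phi> (c e t)) r (subpath t a (\<phi> \<circ> c e))"
    "path_image (subpath t b (\<phi> \<circ> c e)) \<inter> path_image (subpath t a (\<phi> \<circ> c e)) = {\<phi> (c e t)}"
    "simple_path C" "pathfinish C = pathstart C" "path_image C = sphere (\<phi> (c e t)) r"
    "\<forall>x \<in> ball (\<phi> (c e t)) r. winding_number C x = 1"
    "0 < s" "s \<le> 1" "pathfinish (subpath t b (\<phi> \<circ> c e)) = C 0" "pathfinish (subpath t a (\<phi> \<circ> c e)) = C s"
proof -
  let ?F = "\<phi> \<circ> c e" let ?z = "\<phi> (c e t)"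
  obtain R1 where R1: "0 < R1" "\<And>r. 0 < r \<Longrightarrow> r < R1 \<Longrightarrow> \<exists>b. t < b \<and> b < 1 \<and> c e ` {t..b} \<subseteq> U \<and>
     is_arm ?z r (subpath t b ?F)" using forward_arm[OF e U, of t] t by auto
  obtain R2 where R2: "0 < R2" "\<And>r. 0 < r \<Longrightarrow> r < R2 \<Longrightarrow> \<exists>a. 0 < a \<and> a < t \<and> c e ` {a..t} \<subseteq> U \<and>
     is_arm ?z r (subpath t a ?F)" using backward_arm[OF e U, of t] t by auto
  define r where "r = min R (min R1 R2) / 2"
  have r: "0 < r" "r < R" "r < R1" "r < R2" using R R1(1) R2(1) by (auto simp: r_def min_def)
  obtain b where b: "t < b" "b < 1" "c e ` {t..b} \<subseteq> U" "is_arm ?z r (subpath t b ?F)"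
    using R1(2)[OF r(1,3)] by blast
  obtain a where a: "0 < a" "a < t" "c e ` {a..t} \<subseteq> U" "is_arm ?z r (subpath t a ?F)"
    using R2(2)[OF r(1,4)] by blast
  have "{a..b} = {a..t} \<union> {t..b}" using a b by auto
  then have ab: "c e ` {a..b} \<subseteq> U" using a b by auto
  have inj: "inj_on ?F {a..b}" using chart_curve_inj[OF U e _ _ ab] a b by auto
  have int: "path_image (subpath t b ?F) \<inter> path_image (subpath t a ?F) = {?z}"
  proof -
    have "?F ` {t..b} \<inter> ?F ` {a..t} = ?F ` ({t..b} \<inter> {a..t})"
      by (rule inj_on_image_Int[OF inj, symmetric]) (use a b in auto)
    also have "{t..b} \<inter> {a..t} = {t}" using a b by auto
    finally show ?thesis using a b by (simp add: path_image_subpath)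
  qed
  have "?F b \<in> sphere ?z r" using b(4) by (simp add: is_arm_def)
  then obtain C where C: "simple_path C" "pathfinish C = pathstart C" "path_image C = sphere ?z r"
      "\<And>x. x \<in> ball ?z r \<Longrightarrow> winding_number C x = 1" "C 0 = ?F b" "C 1 = ?F b"
    using based_circle[OF r(1)] by blast
  have "?F a \<in> path_image C" using a(4) C(3) by (simp add: is_arm_def)
  then obtain s where s: "0 \<le> s" "s \<le> 1" "C s = ?F a" unfolding path_image_def by auto
  have "?F a \<noteq> ?F b" using inj_onD[OF inj, of a b] a b by auto
  then have "s \<noteq> 0" using s C by auto
  then show thesis
    using that[OF r(1,2) a(1,2) b(1,2) ab b(4) a(4) int C(1-3), of s] s C by auto
qed

text \<open>The corner loop over the two halves of the edge encloses the left side of the edge near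
the point. The curves are recorded in detail because the same loop is transported to another chart
afterwards.\<close>
lemma edge_corner:
  assumes e: "e \<in> parcs G" and U: "(U,\<phi>) \<in> \<A>" and W: "openin S W" "W \<subseteq> U" and t: "0 < t" "t < 1" "c e t \<in> W"
  obtains R r a b g q h O' P where
    "0 < r" "r < R" "ball (\<phi> (c e t)) R \<subseteq> \<phi> ` W" "0 < a" "a < t" "t < b" "b < 1" "c e ` {a..b} \<subseteq> W"
    "path g" "path q" "path h" "pathfinish g = pathstart q" "pathfinish q = pathfinish h" "pathstart g = pathstart h"
    "path_image g \<subseteq> (\<phi> \<circ> c e) ` {a..b}" "path_image h \<subseteq> (\<phi> \<circ> c e) ` {a..b}" "path_image q \<subseteq> sphere (\<phi> (c e t)) r"
    "path_image g \<union> path_image h \<subseteq> cball (\<phi> (c e t)) r"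
    "g = subpath t b (\<phi> \<circ> c e)" "h = subpath t a (\<phi> \<circ> c e)"
    "\<And>z. z \<notin> path_image (corner_loop g q h) \<Longrightarrow> winding_number (corner_loop g q h) z \<in> {0,1}"
    "openin S O'" "c e t \<in> O'" "O' = {x\<in>U. \<phi> x \<in> ball (\<phi> (c e t)) r \<and> (x \<in> \<Gamma> \<longrightarrow> x \<in> c e ` {a<..<b})}"
    "\<And>x. x \<in> O' - \<Gamma> \<Longrightarrow> \<phi> x \<notin> path_image (corner_loop g q h)"
    "P = {x\<in>U. winding_number (corner_loop g q h) (\<phi> x) = 1}"
    "\<And>t'. c e t' \<in> O' \<Longrightarrow> t' \<in> {a<..<b} \<Longrightarrow> side_in U \<phi> e t' P"
    "openin S ((O' - \<Gamma>) \<inter> P)" "openin S (O' - \<Gamma> - P)"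
proof -
  let ?F = "\<phi> \<circ> c e" let ?z = "\<phi> (c e t)"
  have "open (\<phi> ` W)" using chart_open_image[OF U W] .
  then obtain R where R: "0 < R" "cball ?z R \<subseteq> \<phi> ` W" using t(3) open_contains_cball by (metis image_eqI)
  have tU: "c e t \<in> U" using t(3) W(2) by blast
  obtain r a b C s where L: "0 < r" "r < R" "0 < a" "a < t" "t < b" "b < 1" "c e ` {a..b} \<subseteq> U"
    "is_arm ?z r (subpath t b ?F)" "is_arm ?z r (subpath t a ?F)"
    "path_image (subpath t b ?F) \<inter> path_image (subpath t a ?F) = {?z}"
    "simple_path C" "pathfinish C = pathstart C" "path_image C = sphere ?z r"
    "\<forall>x \<in> ball ?z r. winding_number C x = 1"
    "0 < s" "s \<le> 1" "pathfinish (subpath t b ?F) = C 0" "pathfinish (subpath t a ?F) = C s"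
    by (rule edge_loop[OF e U t(1,2) tU R(1)])
  define g where "g = subpath t b ?F"
  define h where "h = subpath t a ?F"
  define q where "q = subpath 0 s C"
  let ?k = "corner_loop g q h"
  note K = corner_loop[OF L(11-14) L(1) L(8,9) L(10) order_refl L(15,16,17,18), folded g_def h_def q_def]
  have cbW: "cball ?z r \<subseteq> \<phi> ` W" using R(2) L(2) by (meson cball_subset_cball_iff order.trans subset_cball less_imp_le)
  have RW: "ball ?z R \<subseteq> \<phi> ` W" using R(2) ball_subset_cball by blast
  have gim: "path_image g = ?F ` {t..b}" and him: "path_image h = ?F ` {a..t}"
    using L by (auto simp: g_def h_def path_image_subpath)
  have ghcb: "path_image g \<subseteq> cball ?z r" "path_image h \<subseteq> cball ?z r"
    using L(8,9) ball_subset_cball[of ?z r] sphere_cball[of ?z r] unfolding is_arm_def g_def h_def by blast+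
  have abim: "{a..b} = {t..b} \<union> {a..t}" using L(4,5) by auto
  have abW: "c e ` {a..b} \<subseteq> W"
  proof
    fix x assume x: "x \<in> c e ` {a..b}"
    then have "\<phi> x \<in> path_image g \<union> path_image h" unfolding gim him abim by auto
    then obtain y where "y \<in> W" "\<phi> x = \<phi> y" using ghcb cbW by blast
    moreover have "x \<in> U" using x L(7) by auto
    ultimately show "x \<in> W" using W(2) inj_onD[OF chart(4)[OF U], of x y] by blast
  qed
  define K0 where "K0 = p ` pverts G \<union> (\<Union>e' \<in> parcs G - {e, prod.swap e}. c e' ` {0..1}) \<union> c e ` {0..a} \<union> c e ` {b..1}"
  have "closedin S K0" unfolding K0_def
    using finites finite_closed[of "p ` pverts G"] p_in curve_closed[of _ 0 1] curve_closed[OF e, of 0 a] curve_closed[OF e, of b 1] L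
    by (intro closedin_Un closedin_Union) auto
  define O' where "O' = {x\<in>U. \<phi> x \<in> ball ?z r \<and> (x \<in> \<Gamma> \<longrightarrow> x \<in> c e ` {a<..<b})}"
  have K0\<Gamma>: "x \<in> K0 \<longleftrightarrow> x \<in> \<Gamma> \<and> x \<notin> c e ` {a<..<b}" for x
  proof
    assume x: "x \<in> K0"
    have "x \<in> \<Gamma>" using x curve_in_\<Gamma> L e unfolding K0_def by (fastforce simp: drawing_image_def)
    moreover have "x \<notin> c e ` {a<..<b}"
    proof
      assume "x \<in> c e ` {a<..<b}"
      then obtain t' where t': "t' \<in> {a<..<b}" "x = c e t'" by blast
      have t'01: "0 < t'" "t' < 1" using t' L by auto
      from x consider v where "v \<in> pverts G" "x = p v" | e' s' where "e' \<in> parcs G" "e' \<noteq> e" "e' \<noteq> prod.swap e" "s' \<in> {0..1}" "x = c e' s'"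
        | s' where "s' \<in> {0..a} \<union> {b..1}" "x = c e s'" unfolding K0_def by blast
      then show False
      proof cases
        case 1 then show False using curve_interior_not_vertex[OF e t'01] t' by metis
      next
        case 2 then show False using curve_eq_cases[OF e 2(1) t'01, of s'] t' by auto
      next
        case 3
        have "s' \<in> {0..1}" using 3 L by auto
        then have "s' = t'" using 3 t' t'01 curve(2)[OF e] unfolding inj_on_def by auto
        then show False using 3 t' by auto
      qed
    qed
    ultimately show "x \<in> \<Gamma> \<and> x \<notin> c e ` {a<..<b}" by blast
  next
    assume x: "x \<in> \<Gamma> \<and> x \<notin> c e ` {a<..<b}"
    then have "x \<in> \<Gamma>" by blast
    then show "x \<in> K0"
    proof (cases rule: in_\<Gamma>_cases)
      case (1 v) then show ?thesis by (auto simp: K0_def)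
    next
      case (2 e' s')
      show ?thesis
      proof (cases "e' \<in> {e, prod.swap e}")
        case False then show ?thesis using 2 by (force simp: K0_def)
      next
        case True
        then obtain s2 where s2: "x = c e s2" "0 < s2" "s2 < 1"
          using 2 curve(6)[OF e, of s'] by (cases "e' = e") (auto intro: that[of "1-s'"] that[of s'])
        then have "s2 \<in> {0..a} \<union> {b..1}" using x by force
        then show ?thesis using s2 by (auto simp: K0_def)
      qed
    qed
  qed
  have O'eq: "O' = {x\<in>U. \<phi> x \<in> ball ?z r} - K0" unfolding O'_def using K0\<Gamma> by blast
  have O'open: "openin S O'" unfolding O'eq
    using chart_open_preimage[OF U, of "ball ?z r"] \<open>closedin S K0\<close> by (simp add: openin_diff)
  have O't: "c e t \<in> O'" unfolding O'_def using t W L by auto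
  have offk: "\<phi> x \<in> path_image ?k \<longleftrightarrow> x \<in> \<Gamma>" if x: "x \<in> O'" for x
  proof
    assume "\<phi> x \<in> path_image ?k"
    moreover have "\<phi> x \<notin> path_image q" using K(6) x unfolding O'_def by auto
    ultimately have "\<phi> x \<in> ?F ` {a..b}" using K(3) gim him abim by (auto simp: image_Un)
    then obtain s where s: "s \<in> {a..b}" "\<phi> x = \<phi> (c e s)" by auto
    then have "x = c e s" using inj_onD[OF chart(4)[OF U] s(2)] x L(7) unfolding O'_def by blast
    then show "x \<in> \<Gamma>" using curve_in_\<Gamma>[OF e, of s] s L by auto
  next
    assume "x \<in> \<Gamma>"
    then obtain s where s: "s \<in> {a<..<b}" "x = c e s" using x unfolding O'_def by blast
    then have "s \<in> {t..b} \<or> s \<in> {a..t}" by auto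
    then have "\<phi> x \<in> path_image g \<union> path_image h" unfolding gim him s(2) by auto
    then show "\<phi> x \<in> path_image ?k" using K(3) by blast
  qed
  define P where "P = {x\<in>U. winding_number ?k (\<phi> x) = 1}"
  have cF: "continuous_on {a..b} ?F" using chart_curve_continuous[OF U e _ _ L(7)] L by auto
  have wnk: "winding_number ?k z = winding_number (subpath a b ?F) z + winding_number q z" if "z \<notin> path_image ?k" for z
  proof -
    have nF: "z \<notin> ?F ` {a..b}" using that K(3) gim him abim by blast
    have "winding_number (subpath a t ?F) z = - winding_number h z"
      using winding_number_reversepath[of h z] K(3) that subpath_path_on[OF cF, of t a] L
      by (simp add: h_def reversepath_subpath)
    then show ?thesis using K(4)[OF that] winding_number_subpath_combine_on[OF cF nF, of a t b] L
      by (simp add: g_def)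
  qed
  have pths: "path g" "path q" "path h"
    using L(8,9) simple_path_imp_path[OF L(11)] L(15,16) path_subpath[of C 0 s]
    unfolding is_arm_def g_def h_def q_def by (simp_all add: arc_imp_path)
  have ends: "pathfinish g = pathstart q" "pathfinish q = pathfinish h" "pathstart g = pathstart h"
    using L(17,18) by (simp_all add: g_def h_def q_def)
  have kp: "path ?k" using K(1) by (rule simple_path_imp_path)
  have openP: "openin S ((O' - \<Gamma>) \<inter> {x\<in>U. winding_number ?k (\<phi> x) = i})" for i
  proof -
    have eq: "(O' - \<Gamma>) \<inter> {x\<in>U. winding_number ?k (\<phi> x) = i} =
       (O' - \<Gamma>) \<inter> {x\<in>U. \<phi> x \<in> {z. z \<notin> path_image ?k \<and> winding_number ?k z = i}}"
      using offk by blast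
    show ?thesis unfolding eq
      by (rule openin_Int[OF openin_diff[OF O'open \<Gamma>_closed]
          chart_open_preimage[OF U open_winding_number_levelsets[OF kp K(2)]]])
  qed
  show thesis
  proof (rule that[OF L(1,2) RW L(3-6) abW pths ends])
    show "path_image g \<subseteq> ?F ` {a..b}" "path_image h \<subseteq> ?F ` {a..b}" unfolding gim him abim by auto
    show "path_image q \<subseteq> sphere ?z r" by (rule K(6))
    show "path_image g \<union> path_image h \<subseteq> cball ?z r" using ghcb by blast
    show "g = subpath t b ?F" "h = subpath t a ?F" by (fact g_def h_def)+
    show "winding_number ?k z \<in> {0,1}" if "z \<notin> path_image ?k" for z using K(5) that .
    show "openin S O'" "c e t \<in> O'" by (fact O'open O't)+
    show "O' = {x\<in>U. \<phi> x \<in> ball (\<phi> (c e t)) r \<and> (x \<in> \<Gamma> \<longrightarrow> x \<in> c e ` {a<..<b})}" by (fact O'_def)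
    show "\<phi> x \<notin> path_image ?k" if "x \<in> O' - \<Gamma>" for x using offk that by blast
    show "P = {x\<in>U. winding_number ?k (\<phi> x) = 1}" by (fact P_def)
    show "side_in U \<phi> e t' P" if t': "c e t' \<in> O'" "t' \<in> {a<..<b}" for t'
    proof (rule side_inI[OF U e _ _ _ _ L(7) K(1,2,5) _ wnk O'open t'(1) _ offk])
      have "\<phi> (c e t') \<in> ball ?z r" using t'(1) unfolding O'_def by blast
      then have "\<phi> (c e t') \<notin> path_image q" using K(6) by auto
      then show "isCont (winding_number q) (\<phi> (c e t'))" using continuous_at_winding_number pths(2) by blast
      show "O' \<subseteq> U" unfolding O'_def by blast
      show "x \<in> P \<longleftrightarrow> winding_number ?k (\<phi> x) = 1" if "x \<in> O' - \<Gamma>" for x using that unfolding P_def O'_def by blast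
    qed (use t' L in auto)
    show "openin S ((O' - \<Gamma>) \<inter> P)" unfolding P_def by (rule openP)
    have "O' - \<Gamma> - P = (O' - \<Gamma>) \<inter> {x\<in>U. winding_number ?k (\<phi> x) = 0}"
    proof -
      have "winding_number ?k (\<phi> x) \<in> {0,1}" if "x \<in> O' - \<Gamma>" for x using K(5) offk that by blast
      moreover have "O' \<subseteq> U" unfolding O'_def by blast
      ultimately show ?thesis unfolding P_def by force
    qed
    then show "openin S (O' - \<Gamma> - P)" using openP by simp
  qed
qed

end

section \<open>Sides do not depend on the chart\<close>

context oriented_drawing begin

lemma transition:
  assumes U: "(U,\<phi>) \<in> \<A>" and V: "(V,\<psi>) \<in> \<A>"
  defines "f \<equiv> \<psi> \<circ> inv_into U \<phi>"
  shows "\<And>x. x \<in> U \<Longrightarrow> f (\<phi> x) = \<psi> x" "continuous_on (\<phi> ` (U \<inter> V)) f" "inj_on f (\<phi> ` (U \<inter> V))"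
    "orientation_preserving_on (\<phi> ` (U \<inter> V)) f"
proof -
  show f: "f (\<phi> x) = \<psi> x" if "x \<in> U" for x using that chart(4)[OF U] by (simp add: f_def)
  have UV: "openin S (U \<inter> V)" using chart(1)[OF U] chart(1)[OF V] by (rule openin_Int)
  have o: "open (\<phi> ` (U \<inter> V))" using chart_open_image[OF U UV] by blast
  show "continuous_on (\<phi> ` (U \<inter> V)) f"
    unfolding continuous_on_open_vimage[OF o]
  proof (intro allI impI)
    fix B :: "complex set" assume B: "open B"
    have "f -` B \<inter> \<phi> ` (U \<inter> V) = \<phi> ` (U \<inter> {x\<in>V. \<psi> x \<in> B})" using f by auto
    then show "open (f -` B \<inter> \<phi> ` (U \<inter> V))"
      using chart_open_image[OF U openin_Int[OF chart(1)[OF U] chart_open_preimage[OF V B]]] by simp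
  qed
  show "inj_on f (\<phi> ` (U \<inter> V))"
    unfolding inj_on_def using f inj_onD[OF chart(4)[OF V]] by auto
  show "orientation_preserving_on (\<phi> ` (U \<inter> V)) f"
  proof -
    have "\<forall>(U, \<phi>) \<in> \<A>. \<forall>(V, \<psi>) \<in> \<A>. orientation_preserving_on (\<phi> ` (U \<inter> V)) (\<psi> \<circ> inv_into U \<phi>)"
      using atlas unfolding oriented_atlas_def by (elim conjE)
    from bspec[OF this U] have "\<forall>(V, \<psi>) \<in> \<A>. orientation_preserving_on (\<phi> ` (U \<inter> V)) (\<psi> \<circ> inv_into U \<phi>)" by simp
    from bspec[OF this V] show ?thesis unfolding f_def by simp
  qed
qed

text \<open>The change of charts maps the corner loop of the edge to a loop with the same winding
numbers, because it preserves the orientation. One and the same set is therefore the left side in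
both charts.\<close>
lemma side_common:
  assumes U: "(U,\<phi>) \<in> \<A>" and V: "(V,\<psi>) \<in> \<A>" and e: "e \<in> parcs G" and t: "0 < t" "t < 1" "c e t \<in> U" "c e t \<in> V"
  shows "\<exists>P. side_in U \<phi> e t P \<and> side_in V \<psi> e t P"
proof -
  let ?z = "\<phi> (c e t)"
  have W: "openin S (U \<inter> V)" "U \<inter> V \<subseteq> U" "c e t \<in> U \<inter> V" using chart(1)[OF U] chart(1)[OF V] t by auto
  obtain R r a b g q h O' P where L:
    "0 < r" "r < R" "ball ?z R \<subseteq> \<phi> ` (U \<inter> V)" "0 < a" "a < t" "t < b" "b < 1" "c e ` {a..b} \<subseteq> U \<inter> V"
    "path g" "path q" "path h" "pathfinish g = pathstart q" "pathfinish q = pathfinish h" "pathstart g = pathstart h"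
    "path_image g \<subseteq> (\<phi> \<circ> c e) ` {a..b}" "path_image h \<subseteq> (\<phi> \<circ> c e) ` {a..b}" "path_image q \<subseteq> sphere ?z r"
    "path_image g \<union> path_image h \<subseteq> cball ?z r"
    "g = subpath t b (\<phi> \<circ> c e)" "h = subpath t a (\<phi> \<circ> c e)"
    and k01: "\<And>z. z \<notin> path_image (corner_loop g q h) \<Longrightarrow> winding_number (corner_loop g q h) z \<in> {0,1}"
    and O': "openin S O'" "c e t \<in> O'" "O' = {x\<in>U. \<phi> x \<in> ball ?z r \<and> (x \<in> \<Gamma> \<longrightarrow> x \<in> c e ` {a<..<b})}"
    and offk: "\<And>x. x \<in> O' - \<Gamma> \<Longrightarrow> \<phi> x \<notin> path_image (corner_loop g q h)"
    and P: "P = {x\<in>U. winding_number (corner_loop g q h) (\<phi> x) = 1}"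
    and side: "\<And>t'. c e t' \<in> O' \<Longrightarrow> t' \<in> {a<..<b} \<Longrightarrow> side_in U \<phi> e t' P"
    by (rule edge_corner[OF e U W(1,2) t(1,2) W(3)]) blast
  let ?k = "corner_loop g q h"
  define f where "f = \<psi> \<circ> inv_into U \<phi>"
  note F = transition[OF U V, folded f_def]
  have fc: "continuous_on (ball ?z R) f" "inj_on f (ball ?z R)" "orientation_preserving_on (ball ?z R) f"
    using continuous_on_subset[OF F(2) L(3)] inj_on_subset[OF F(3) L(3)] F(4) L(3)
    by (auto simp: orientation_preserving_on_def)
  have cbR: "cball ?z r \<subseteq> ball ?z R" using L(2) by auto
  have imR: "path_image g \<subseteq> ball ?z R" "path_image q \<subseteq> ball ?z R" "path_image h \<subseteq> ball ?z R"
    using L(17,18) cbR sphere_cball[of ?z r] by blast+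
  have kim: "path_image ?k = path_image g \<union> path_image q \<union> path_image h"
    using L(12,13) by (simp add: corner_loop_def path_image_join Un_assoc)
  have kp: "path ?k" "pathfinish ?k = pathstart ?k" using L(9-14) by (simp_all add: corner_loop_def)
  have fpaths: "path (f \<circ> g)" "path (f \<circ> q)" "path (f \<circ> h)"
    using L(9-11) imR fc(1) by (auto intro!: path_continuous_image intro: continuous_on_subset)
  have cU: "\<phi> (c e s) \<in> ball ?z R" "f (\<phi> (c e s)) = \<psi> (c e s)" if "s \<in> {a..b}" for s
  proof -
    show "f (\<phi> (c e s)) = \<psi> (c e s)" using F(1) L(8) that by blast
    have "(\<phi> \<circ> c e) ` {a..b} = path_image g \<union> path_image h"
    proof -
      have "{a..b} = {t..b} \<union> {a..t}" using L(5,6) by auto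
      then show ?thesis using L(5,6) by (simp add: L(19,20) path_image_subpath image_Un)
    qed
    moreover have "(\<phi> \<circ> c e) s \<in> (\<phi> \<circ> c e) ` {a..b}" using that by (rule imageI)
    ultimately have "(\<phi> \<circ> c e) s \<in> path_image g \<union> path_image h" by (simp only:)
    then show "\<phi> (c e s) \<in> ball ?z R" using imR by auto
  qed
  have cont: "continuous_on {a..b} (\<psi> \<circ> c e)"
    using chart_curve_continuous[OF V e] L by auto
  have eqw: "winding_number (f \<circ> subpath t s (\<phi> \<circ> c e)) y = winding_number (subpath t s (\<psi> \<circ> c e)) y"
    if "s \<in> {a,b}" for s y
  proof (rule winding_number_cong)
    fix x :: real assume "0 \<le> x" "x \<le> 1"
    then have "(s - t) * x + t \<in> closed_segment t s" unfolding closed_segment_real_eq by auto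
    then have "(s - t) * x + t \<in> {a..b}"
      using that L(5,6) by (auto simp: closed_segment_eq_real_ivl split: if_splits)
    then show "(f \<circ> subpath t s (\<phi> \<circ> c e)) x = subpath t s (\<psi> \<circ> c e) x"
      using cU(2) by (simp add: subpath_def)
  qed
  have "near (c e t) (\<lambda>x. winding_number (subpath a b (\<psi> \<circ> c e)) (\<psi> x) + winding_number (f \<circ> q) (\<psi> x) = of_bool (x \<in> P))"
    unfolding near_def
  proof (intro exI[of _ O'] conjI ballI O'(1,2))
    fix x assume x: "x \<in> O' - \<Gamma>"
    have xU: "x \<in> U" "\<phi> x \<in> ball ?z r" using x O'(3) by auto
    then have xR: "\<phi> x \<in> ball ?z R" using L(2) by auto
    then have xV: "x \<in> V" using L(3) xU(1) inj_onD[OF chart(4)[OF U]] by blast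
    have fx: "f (\<phi> x) = \<psi> x" using F(1) xU by blast
    have off: "\<phi> x \<notin> path_image g" "\<phi> x \<notin> path_image q" "\<phi> x \<notin> path_image h" using offk[OF x] kim by auto
    have foff: "\<psi> x \<notin> path_image (f \<circ> g)" "\<psi> x \<notin> path_image (f \<circ> q)" "\<psi> x \<notin> path_image (f \<circ> h)"
      using off imR xR fc(2) fx unfolding path_image_compose inj_on_def by (metis (no_types, lifting) imageE subsetD)+
    have nF: "\<psi> x \<notin> (\<psi> \<circ> c e) ` {a..b}"
    proof
      assume "\<psi> x \<in> (\<psi> \<circ> c e) ` {a..b}"
      then obtain s where s: "s \<in> {a..b}" "\<psi> x = \<psi> (c e s)" by auto
      then have "x = c e s" using inj_onD[OF chart(4)[OF V] s(2) xV] L(8) by blast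
      then show False using x s curve_in_\<Gamma>[OF e, of s] L by auto
    qed
    have ends: "pathfinish (f \<circ> g) = pathstart (f \<circ> q)" "pathfinish (f \<circ> q) = pathfinish (f \<circ> h)"
      using L(12,13) by (simp_all add: pathfinish_compose pathstart_compose)
    have "winding_number ?k (\<phi> x) = winding_number (f \<circ> ?k) (f (\<phi> x))"
      using winding_number_orientation_preserving[OF fc kp _ xR offk[OF x] k01[OF offk[OF x]]] kim imR by auto
    also have "f \<circ> ?k = corner_loop (f \<circ> g) (f \<circ> q) (f \<circ> h)"
      by (simp add: corner_loop_def path_compose_join path_compose_reversepath)
    also have "winding_number \<dots> (f (\<phi> x)) = winding_number (f \<circ> g) (\<psi> x) + winding_number (f \<circ> q) (\<psi> x) - winding_number (f \<circ> h) (\<psi> x)"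
      unfolding fx by (rule corner_loop_winding[OF fpaths ends foff])
    also have "winding_number (f \<circ> g) (\<psi> x) = winding_number (subpath t b (\<psi> \<circ> c e)) (\<psi> x)"
      unfolding L(19) by (rule eqw) simp
    also have "winding_number (f \<circ> h) (\<psi> x) = winding_number (subpath t a (\<psi> \<circ> c e)) (\<psi> x)"
      unfolding L(20) by (rule eqw) simp
    also have "\<dots> = - winding_number (subpath a t (\<psi> \<circ> c e)) (\<psi> x)"
    proof -
      have "path (subpath a t (\<psi> \<circ> c e))" using subpath_path_on[OF cont, of a t] L by auto
      moreover have "\<psi> x \<notin> path_image (subpath a t (\<psi> \<circ> c e))" using nF L(5,6) by (auto simp: path_image_subpath)
      ultimately show ?thesis using winding_number_reversepath[of "subpath a t (\<psi> \<circ> c e)" "\<psi> x"]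
        by (simp add: reversepath_subpath)
    qed
    also have "winding_number (subpath t b (\<psi> \<circ> c e)) (\<psi> x) + winding_number (f \<circ> q) (\<psi> x)
        - (- winding_number (subpath a t (\<psi> \<circ> c e)) (\<psi> x)) =
        winding_number (subpath a b (\<psi> \<circ> c e)) (\<psi> x) + winding_number (f \<circ> q) (\<psi> x)"
    proof -
      have "a \<in> {a..b}" "t \<in> {a..b}" "b \<in> {a..b}" using L(5,6) by auto
      from winding_number_subpath_combine_on[OF cont nF this] show ?thesis
        by (simp only: diff_minus_eq_add add.assoc add.commute add.left_commute)
    qed
    finally have "winding_number ?k (\<phi> x) = winding_number (subpath a b (\<psi> \<circ> c e)) (\<psi> x) + winding_number (f \<circ> q) (\<psi> x)" .
    moreover have "winding_number ?k (\<phi> x) = of_bool (x \<in> P)"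
      using k01[OF offk[OF x]] xU unfolding P by auto
    ultimately show "winding_number (subpath a b (\<psi> \<circ> c e)) (\<psi> x) + winding_number (f \<circ> q) (\<psi> x) = of_bool (x \<in> P)" by simp
  qed
  moreover have "isCont (winding_number (f \<circ> q)) (\<psi> (c e t))"
  proof (rule continuous_at_winding_number[OF fpaths(2)])
    have "f ?z = \<psi> (c e t)" using F(1) t by blast
    moreover have "?z \<in> ball ?z R" "?z \<notin> path_image q" using L(1,2,17) by auto
    ultimately show "\<psi> (c e t) \<notin> path_image (f \<circ> q)"
      using imR(2) fc(2) unfolding path_image_compose inj_on_def by (metis (no_types, lifting) imageE subsetD)
  qed
  moreover have su: "side_in U \<phi> e t P" using side[OF O'(2)] L(5,6) by simp
  moreover have "both_sides (c e t) P" using su unfolding side_in_def by blast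
  moreover have "0 \<le> a" "a < t" "t < b" "b \<le> 1" "c e ` {a..b} \<subseteq> V" using L by auto
  ultimately show ?thesis unfolding side_in_def[of V] by blast
qed

lemma side_unique:
  assumes e: "e \<in> parcs G" "0 < t" "t < 1" and P: "side e t P" "side e t P'"
  shows "near (c e t) (\<lambda>x. x \<in> P \<longleftrightarrow> x \<in> P')"
proof -
  obtain U \<phi> V \<psi> where U: "(U,\<phi>) \<in> \<A>" "side_in U \<phi> e t P" and V: "(V,\<psi>) \<in> \<A>" "side_in V \<psi> e t P'"
    using P unfolding side_def by blast
  have "c e t \<in> U" "c e t \<in> V" using U V unfolding side_in_def by auto
  then obtain P0 where P0: "side_in U \<phi> e t P0" "side_in V \<psi> e t P0"
    using side_common[OF U(1) V(1) e] by blast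
  show ?thesis
    by (rule near_mono[OF near_conj[OF side_in_unique[OF U(1) e(1) U(2) P0(1)]
          side_in_unique[OF V(1) e(1) V(2) P0(2)]]]) simp
qed

text \<open>Reversing an edge changes the sign of the winding number, so that left and right are
exchanged.\<close>
lemma side_swap:
  assumes e: "e \<in> parcs G" and P: "side e t P"
  shows "side (prod.swap e) (1 - t) (- P)"
proof -
  obtain U \<phi> where U: "(U,\<phi>) \<in> \<A>" "side_in U \<phi> e t P" using P unfolding side_def by blast
  obtain a b l where L: "0 \<le> a" "a < t" "t < b" "b \<le> 1" "c e ` {a..b} \<subseteq> U" "isCont l (\<phi> (c e t))"
    "near (c e t) (\<lambda>x. winding_number (subpath a b (\<phi> \<circ> c e)) (\<phi> x) + l (\<phi> x) = of_bool (x \<in> P))"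
    "both_sides (c e t) P"
    using U(2) unfolding side_in_def by blast
  have sw: "c (prod.swap e) s = c e (1 - s)" if "s \<in> {0..1}" for s using curve(6)[OF e that] .
  have q: "c (prod.swap e) (1 - t) = c e t" using sw[of "1-t"] L by auto
  have "c (prod.swap e) ` {1-b..1-a} \<subseteq> U"
  proof safe
    fix s assume "s \<in> {1-b..1-a}"
    then have "c (prod.swap e) s = c e (1-s)" "1 - s \<in> {a..b}" using sw[of s] L by auto
    then show "c (prod.swap e) s \<in> U" using L(5) by auto
  qed
  moreover have "near (c e t) (\<lambda>x. winding_number (subpath (1-b) (1-a) (\<phi> \<circ> c (prod.swap e))) (\<phi> x)
      + (1 - l (\<phi> x)) = of_bool (x \<in> - P))"
  proof (rule near_mono[OF near_conj[OF L(7) near_openin[OF chart(1)[OF U(1)]]]])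
    show "c e t \<in> U" using L by auto
    fix x assume x: "x \<notin> \<Gamma>" "winding_number (subpath a b (\<phi> \<circ> c e)) (\<phi> x) + l (\<phi> x) = of_bool (x \<in> P) \<and> x \<in> U"
    have "winding_number (subpath (1-b) (1-a) (\<phi> \<circ> c (prod.swap e))) (\<phi> x) = winding_number (subpath b a (\<phi> \<circ> c e)) (\<phi> x)"
    proof (rule winding_number_cong)
      fix y :: real assume y: "0 \<le> y" "y \<le> 1"
      define D where "D = (b - a) * y"
      have "0 \<le> D" "D \<le> (b - a) * 1" unfolding D_def using y L by (intro mult_nonneg_nonneg mult_left_mono; simp)+
      then have "1 - b + D \<in> {0..1}" using L by simp
      then have 1: "c (prod.swap e) (1 - b + D) = c e (b - D)" using sw[of "1-b+D"] by simp
      have 2: "((1-a) - (1-b)) * y + (1-b) = 1 - b + D" "(a - b) * y + b = b - D" by (simp_all add: D_def algebra_simps)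
      show "subpath (1-b) (1-a) (\<phi> \<circ> c (prod.swap e)) y = subpath b a (\<phi> \<circ> c e) y"
        by (simp only: subpath_def o_apply 1 2)
    qed
    also have "\<dots> = - winding_number (subpath a b (\<phi> \<circ> c e)) (\<phi> x)"
    proof -
      have nF: "\<phi> x \<notin> (\<phi> \<circ> c e) ` {a..b}"
      proof
        assume "\<phi> x \<in> (\<phi> \<circ> c e) ` {a..b}"
        then obtain s where s: "s \<in> {a..b}" "\<phi> x = \<phi> (c e s)" by auto
        then have "x = c e s" using inj_onD[OF chart(4)[OF U(1)] s(2)] L(5) x by blast
        then show False using x s curve_in_\<Gamma>[OF e, of s] L by auto
      qed
      have "path (subpath a b (\<phi> \<circ> c e))"
        using subpath_path_on[OF chart_curve_continuous[OF U(1) e L(1,4,5)], of a b] L by auto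
      moreover have "\<phi> x \<notin> path_image (subpath a b (\<phi> \<circ> c e))" using nF L by (auto simp: path_image_subpath)
      ultimately show ?thesis using winding_number_reversepath[of "subpath a b (\<phi> \<circ> c e)" "\<phi> x"]
        by (simp add: reversepath_subpath)
    qed
    finally have "winding_number (subpath (1-b) (1-a) (\<phi> \<circ> c (prod.swap e))) (\<phi> x) = l (\<phi> x) - of_bool (x \<in> P)"
      using x(2) by (simp add: algebra_simps)
    then show "winding_number (subpath (1-b) (1-a) (\<phi> \<circ> c (prod.swap e))) (\<phi> x) + (1 - l (\<phi> x)) = of_bool (x \<in> - P)"
      by simp
  qed
  moreover have "both_sides (c e t) (- P)" using L(8) unfolding both_sides_def by simp
  moreover have "isCont (\<lambda>z. 1 - l z) (\<phi> (c e t))" using L(6) by (intro continuous_intros)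
  moreover have "0 \<le> 1 - b" "1 - b < 1 - t" "1 - t < 1 - a" "1 - a \<le> 1" using L by auto
  ultimately have "side_in U \<phi> (prod.swap e) (1-t) (- P)" unfolding side_in_def q by blast
  then show ?thesis unfolding side_def using U(1) by blast
qed

text \<open>A neighbourhood of an interior point of an edge is divided by the edge into two open
parts, which are the left sides of the two directions at every edge point of the neighbourhood, not
only at the centre.\<close>
lemma edge_germ:
  assumes e: "e \<in> parcs G" and t: "0 < t" "t < 1"
  obtains O' P where "openin S O'" "c e t \<in> O'" "openin S ((O' - \<Gamma>) \<inter> P)" "openin S (O' - \<Gamma> - P)"
    "\<forall>v \<in> pverts G. p v \<notin> O'"
    "\<forall>e' \<in> parcs G. \<forall>t'. 0 < t' \<and> t' < 1 \<and> c e' t' \<in> O' \<longrightarrow>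
       e' = e \<and> side e' t' P \<or> e' = prod.swap e \<and> side e' t' (- P)"
proof -
  have "c e t \<in> topspace S" using curve_in_\<Gamma>[OF e, of t] \<Gamma>_in t by auto
  then obtain U \<phi> where U: "(U,\<phi>) \<in> \<A>" "c e t \<in> U" using chart_cover by blast
  let ?z = "\<phi> (c e t)"
  obtain R r a b g q h O' P where L:
    "0 < r" "r < R" "ball ?z R \<subseteq> \<phi> ` U" "0 < a" "a < t" "t < b" "b < 1" "c e ` {a..b} \<subseteq> U"
    "path g" "path q" "path h" "pathfinish g = pathstart q" "pathfinish q = pathfinish h" "pathstart g = pathstart h"
    "path_image g \<subseteq> (\<phi> \<circ> c e) ` {a..b}" "path_image h \<subseteq> (\<phi> \<circ> c e) ` {a..b}" "path_image q \<subseteq> sphere ?z r"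
    "path_image g \<union> path_image h \<subseteq> cball ?z r"
    "g = subpath t b (\<phi> \<circ> c e)" "h = subpath t a (\<phi> \<circ> c e)"
    and k01: "\<And>z. z \<notin> path_image (corner_loop g q h) \<Longrightarrow> winding_number (corner_loop g q h) z \<in> {0,1}"
    and O': "openin S O'" "c e t \<in> O'" "O' = {x\<in>U. \<phi> x \<in> ball ?z r \<and> (x \<in> \<Gamma> \<longrightarrow> x \<in> c e ` {a<..<b})}"
    and offk: "\<And>x. x \<in> O' - \<Gamma> \<Longrightarrow> \<phi> x \<notin> path_image (corner_loop g q h)"
    and P: "P = {x\<in>U. winding_number (corner_loop g q h) (\<phi> x) = 1}"
    and side: "\<And>t'. c e t' \<in> O' \<Longrightarrow> t' \<in> {a<..<b} \<Longrightarrow> side_in U \<phi> e t' P"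
    and op: "openin S ((O' - \<Gamma>) \<inter> P)" "openin S (O' - \<Gamma> - P)"
    by (rule edge_corner[OF e U(1) chart(1)[OF U(1)] order_refl t U(2)]) blast
  have O\<Gamma>: "\<exists>s\<in>{a<..<b}. x = c e s" if "x \<in> O'" "x \<in> \<Gamma>" for x using that O'(3) by blast
  show thesis
  proof (rule that[OF O'(1,2) op])
    show "\<forall>v \<in> pverts G. p v \<notin> O'"
    proof
      fix v assume v: "v \<in> pverts G"
      show "p v \<notin> O'"
      proof
        assume "p v \<in> O'"
        moreover have "p v \<in> \<Gamma>" using v by (auto simp: drawing_image_def)
        ultimately obtain s where "s \<in> {a<..<b}" "p v = c e s" using O\<Gamma> by blast
        then show False using curve_interior_not_vertex[OF e _ _ v, of s] L(4,7) by auto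
      qed
    qed
    show "\<forall>e' \<in> parcs G. \<forall>t'. 0 < t' \<and> t' < 1 \<and> c e' t' \<in> O' \<longrightarrow>
       e' = e \<and> side e' t' P \<or> e' = prod.swap e \<and> side e' t' (- P)"
    proof (intro ballI allI impI)
      fix e' t' assume e': "e' \<in> parcs G" "0 < t' \<and> t' < 1 \<and> c e' t' \<in> O'"
      then obtain s where s: "s \<in> {a<..<b}" "c e' t' = c e s" using O\<Gamma>[of "c e' t'"] curve_in_\<Gamma>[OF e'(1), of t'] by auto
      have s01: "0 < s" "s < 1" using s L by auto
      have sd: "side e s P" using side[of s] s e' U(1) unfolding side_def by auto
      consider "e' = e" "t' = s" | "e' = prod.swap e" "t' = 1 - s"
        using curve_eq_cases[OF e e'(1) s01, of t'] s e' by auto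
      then show "e' = e \<and> side e' t' P \<or> e' = prod.swap e \<and> side e' t' (- P)"
        using sd side_swap[OF e sd] by cases auto
    qed
  qed
qed

end

section \<open>Small neighbourhoods of vertices\<close>

context oriented_drawing begin

definition out :: "'v \<Rightarrow> ('v \<times> 'v) set" where "out v = {e \<in> parcs G. fst e = v}"

lemma outD: "e \<in> out v \<Longrightarrow> e \<in> parcs G" "e \<in> out v \<Longrightarrow> fst e = v" "e \<in> out v \<Longrightarrow> c e 0 = p v"
  using curve(3) by (auto simp: out_def)

lemma arms_meet:
  assumes e: "e \<in> out v" "e' \<in> out v" "e \<noteq> e'" and s: "0 \<le> s" "s < 1" "0 \<le> s'" "s' \<le> 1" and eq: "c e s = c e' s'"
  shows "s = 0 \<and> s' = 0"
proof -
  have e': "e' \<noteq> prod.swap e" using e no_loop[OF outD(1)[OF e(1)]] by (auto simp: out_def)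
  have s0: "s = 0" using curve_eq_cases[OF outD(1)[OF e(1)] outD(1)[OF e(2)] _ s(2-4) eq] e e' s(1) by force
  then have "c e' s' = c e' 0" using eq outD(3)[OF e(1)] outD(3)[OF e(2)] by simp
  then have "s' = 0" using inj_onD[OF curve(2)[OF outD(1)[OF e(2)]]] s by auto
  with s0 show ?thesis by simp
qed

text \<open>Only the edges that leave a vertex come close to it, as the other edges are
compact.\<close>
lemma star_neighbourhood:
  assumes v: "v \<in> pverts G" and U: "openin S W" "p v \<in> W" and ne: "out v \<noteq> {}"
    and b: "\<And>e. e \<in> out v \<Longrightarrow> 0 < b e \<and> b e < 1"
  obtains O' where "openin S O'" "p v \<in> O'" "O' \<subseteq> W" "\<forall>u \<in> pverts G. p u \<in> O' \<longrightarrow> u = v"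
    "\<And>x. x \<in> O' \<Longrightarrow> x \<in> \<Gamma> \<Longrightarrow> \<exists>e \<in> out v. \<exists>s \<in> {0..<b e}. x = c e s"
    "\<And>e t. e \<in> out v \<Longrightarrow> t \<le> 1 \<Longrightarrow> c e t \<in> O' \<Longrightarrow> t < b e"
proof -
  define K0 where "K0 = p ` (pverts G - {v}) \<union> (\<Union>e' \<in> {e' \<in> parcs G. e' \<notin> out v \<and> prod.swap e' \<notin> out v}. c e' ` {0..1})
     \<union> (\<Union>e \<in> out v. c e ` {b e..1})"
  have fin: "finite (out v)" using finites(2) by (auto simp: out_def)
  have "closedin S (p ` (pverts G - {v}))"
    using finites p_in by (intro finite_closed) auto
  moreover have "closedin S (\<Union>e' \<in> {e' \<in> parcs G. e' \<notin> out v \<and> prod.swap e' \<notin> out v}. c e' ` {0..1})"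
    using finites curve_closed[of _ 0 1] by (intro closedin_Union) auto
  moreover have "closedin S (\<Union>e \<in> out v. c e ` {b e..1})"
  proof (rule closedin_Union)
    show "closedin S T" if "T \<in> (\<lambda>e. c e ` {b e..1}) ` out v" for T
      using that b curve_closed outD(1) by (force simp: less_imp_le)
  qed (use fin in auto)
  ultimately have K0c: "closedin S K0" unfolding K0_def by (intro closedin_Un)
  have pv: "p v \<notin> K0"
  proof
    assume "p v \<in> K0"
    then consider u where "u \<in> pverts G" "u \<noteq> v" "p v = p u"
      | e s where "e \<in> parcs G" "e \<notin> out v" "prod.swap e \<notin> out v" "s \<in> {0..1}" "p v = c e s"
      | e s where "e \<in> out v" "s \<in> {b e..1}" "p v = c e s" unfolding K0_def by blast
    then show False
    proof cases
      case 1 then show False using inj_onD[OF p_inj 1(3) v] by simp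
    next
      case 2
      have "s = 0 \<or> s = 1"
      proof (rule ccontr)
        assume "\<not> (s = 0 \<or> s = 1)"
        then have "0 < s" "s < 1" using 2(4) by auto
        then show False using curve_interior_not_vertex[OF 2(1) _ _ v, of s] 2(5) by simp
      qed
      then have "p v = p (fst e) \<or> p v = p (snd e)" using 2 curve(3,4)[OF 2(1)] by auto
      then have "v = fst e \<or> v = snd e" using inj_onD[OF p_inj _ v] arc_ends[OF 2(1)] by blast
      then show False using 2 swap_arc[OF 2(1)] by (auto simp: out_def)
    next
      case 3
      have e: "e \<in> parcs G" "fst e = v" using outD[OF 3(1)] by auto
      have "s \<noteq> 1" using 3 curve(4)[OF e(1)] inj_onD[OF p_inj _ v] arc_ends[OF e(1)] no_loop[OF e(1)] e by metis
      moreover have "0 < s" using 3 b[OF 3(1)] by auto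
      ultimately show False using curve_interior_not_vertex[OF e(1) _ _ v, of s] 3 by auto
    qed
  qed
  show thesis
  proof (rule that[of "W - K0"])
    show "openin S (W - K0)" using U(1) K0c by (rule openin_diff)
    show "p v \<in> W - K0" using U pv by blast
    show "\<forall>u \<in> pverts G. p u \<in> W - K0 \<longrightarrow> u = v" unfolding K0_def by blast
    show "t < b e" if "e \<in> out v" "t \<le> 1" "c e t \<in> W - K0" for e t
    proof (rule ccontr)
      assume "\<not> t < b e"
      then have "t \<in> {b e..1}" using that by simp
      then have "c e t \<in> K0" unfolding K0_def using that by blast
      then show False using that by blast
    qed
    show "\<exists>e \<in> out v. \<exists>s \<in> {0..<b e}. x = c e s" if x: "x \<in> W - K0" "x \<in> \<Gamma>" for x
      using x(2)
    proof (cases rule: in_\<Gamma>_cases)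
      case (1 u)
      then have "u = v" using x unfolding K0_def by blast
      moreover obtain e where "e \<in> out v" using ne by blast
      ultimately show ?thesis using 1 outD(3)[of e v] b[of e] by (intro bexI[of _ e] bexI[of _ 0]) auto
    next
      case (2 e' t)
      consider "e' \<in> out v" | "prod.swap e' \<in> out v" | "e' \<notin> out v" "prod.swap e' \<notin> out v" by blast
      then show ?thesis
      proof cases
        case 1
        have "t \<notin> {b e'..1}" using 1 x 2 unfolding K0_def by blast
        then show ?thesis using 1 2 by (intro bexI[of _ e'] bexI[of _ t]) auto
      next
        case sw: 2
        have eq: "x = c (prod.swap e') (1 - t)" using curve(6)[OF 2(1), of "1-t"] 2 by simp
        have "1 - t \<notin> {b (prod.swap e')..1}" using sw x eq unfolding K0_def by blast
        then show ?thesis using sw eq 2 by (intro bexI[of _ "prod.swap e'"] bexI[of _ "1-t"]) auto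
      next
        case 3
        moreover have "x \<in> c e' ` {0..1}" unfolding 2(4) using 2(2,3) by (intro imageI) simp
        ultimately have "x \<in> K0" unfolding K0_def using 2(1) by blast
        then show ?thesis using x by blast
      qed
    qed
  qed blast
qed

text \<open>A Jordan curve whose image near the vertex consists of arms and contains the arm of
\<open>e\<close> borders this arm on one side. Whether the interior or the exterior is the left side
depends only on the direction in which the curve runs along \<open>e\<close>.\<close>
lemma arm_corner:
  assumes U: "(U,\<phi>) \<in> \<A>" and e: "e \<in> out v"
    and O': "openin S O'" "O' \<subseteq> U"
      "\<And>x. x \<in> O' \<Longrightarrow> x \<in> \<Gamma> \<Longrightarrow> \<exists>e \<in> out v. \<exists>s \<in> {0..<b e}. x = c e s"
      "\<And>e t. e \<in> out v \<Longrightarrow> t \<le> 1 \<Longrightarrow> c e t \<in> O' \<Longrightarrow> t < b e"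
      "\<And>x. x \<in> O' \<Longrightarrow> \<phi> x \<notin> Q0"
    and b: "\<And>e. e \<in> out v \<Longrightarrow> 0 < b e \<and> b e < 1 \<and> c e ` {0..b e} \<subseteq> U"
    and t: "0 < t" "t < 1" "c e t \<in> O'"
    and k: "simple_path k" "pathfinish k = pathstart k" "\<And>z. z \<notin> path_image k \<Longrightarrow> winding_number k z \<in> {0,1}"
      "(\<phi> \<circ> c e) ` {0..b e} \<subseteq> path_image k" "path_image k \<subseteq> Q0 \<union> (\<Union>e \<in> out v. (\<phi> \<circ> c e) ` {0..b e})"
      "\<And>z. z \<notin> path_image k \<Longrightarrow> winding_number k z = winding_number (subpath 0 (b e) (\<phi> \<circ> c e)) z + l z"
    and l: "isCont l (\<phi> (c e t))"
    and P: "P = {x \<in> O' - \<Gamma>. winding_number k (\<phi> x) = 1}"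
    and m: "path m" "pathfinish m = pathstart m" "\<phi> (c e t) \<notin> path_image m"
    and N: "N = {x \<in> O' - \<Gamma>. winding_number m (\<phi> x) = 1}" "O' - \<Gamma> = P \<union> Q \<union> N" "P \<inter> N = {}"
  shows "side e t P" "near (c e t) (\<lambda>x. x \<in> P \<union> Q)"
proof -
  have eA: "e \<in> parcs G" using outD(1)[OF e] .
  define K1 where "K1 = (\<Union>e' \<in> out v - {e}. c e' ` {0..b e'})"
  have "closedin S K1" unfolding K1_def
  proof (rule closedin_Union)
    show "closedin S T" if "T \<in> (\<lambda>e. c e ` {0..b e}) ` (out v - {e})" for T
      using that b curve_closed outD(1) by (force simp: less_imp_le)
    show "finite ((\<lambda>e. c e ` {0..b e}) ` (out v - {e}))" using finites(2) by (auto simp: out_def)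
  qed
  then have O2: "openin S (O' - K1)" using O'(1) by (intro openin_diff)
  have tb: "t < b e" using O'(4)[OF e _ t(3)] t by simp
  have cK: "c e t \<notin> K1"
  proof
    assume "c e t \<in> K1"
    then obtain e' s where "e' \<in> out v" "e' \<noteq> e" "s \<in> {0..b e'}" "c e t = c e' s" unfolding K1_def by blast
    then show False using arms_meet[OF e, of e' t s] t b[of e'] by auto
  qed
  have offk: "\<phi> x \<in> path_image k \<longleftrightarrow> x \<in> \<Gamma>" if x: "x \<in> O' - K1" for x
  proof
    assume "\<phi> x \<in> path_image k"
    then obtain e' s where s: "e' \<in> out v" "s \<in> {0..b e'}" "\<phi> x = \<phi> (c e' s)" using k(5) O'(5) x by fastforce
    have "x = c e' s" using inj_onD[OF chart(4)[OF U] s(3)] b[OF s(1)] s(2) x O'(2) by blast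
    then show "x \<in> \<Gamma>" using curve_in_\<Gamma>[OF outD(1)[OF s(1)], of s] s b[OF s(1)] by auto
  next
    assume "x \<in> \<Gamma>"
    then obtain e' s where s: "e' \<in> out v" "s \<in> {0..<b e'}" "x = c e' s" using O'(3) x by blast
    have "e' = e"
    proof (rule ccontr)
      assume "e' \<noteq> e"
      then have "x \<in> K1" unfolding K1_def s(3) using s(1,2) by (intro UN_I[of e'] imageI) auto
      then show False using x by blast
    qed
    then have "\<phi> x \<in> (\<phi> \<circ> c e) ` {0..b e}" using s by auto
    then show "\<phi> x \<in> path_image k" using k(4) by blast
  qed
  have sd: "side_in U \<phi> e t P"
  proof (rule side_inI[OF U eA order_refl t(1) tb _ _ k(1,2,3) l k(6) O2 _ _ offk])
    show "b e \<le> 1" "c e ` {0..b e} \<subseteq> U" using b[OF e] by auto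
    show "x \<in> P \<longleftrightarrow> winding_number k (\<phi> x) = 1" if "x \<in> O' - K1 - \<Gamma>" for x using that unfolding P by blast
  qed (use t cK O'(2) in auto)
  then show "side e t P" using U unfolding side_def by blast
  have cU: "c e t \<in> U" using t(3) O'(2) by blast
  have "open (- path_image m)" using m(1) closed_path_image by auto
  then obtain \<delta> where d: "0 < \<delta>" "ball (\<phi> (c e t)) \<delta> \<subseteq> - path_image m"
    using m(3) open_contains_ball by (metis Compl_iff)
  define O3 where "O3 = O' \<inter> {x\<in>U. \<phi> x \<in> ball (\<phi> (c e t)) \<delta>}"
  have O3: "openin S O3" "c e t \<in> O3" unfolding O3_def
    using openin_Int[OF O'(1) chart_open_preimage[OF U open_ball]] t(3) cU d(1) by auto
  have const: "winding_number m (\<phi> x) = winding_number m (\<phi> y)" if "x \<in> O3" "y \<in> O3" for x y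
    by (rule winding_number_eq[OF m(1,2), where S = "ball (\<phi> (c e t)) \<delta>"]) (use that d(2) in \<open>auto simp: O3_def\<close>)
  have "\<not> near (c e t) (\<lambda>x. x \<notin> P)" using sd unfolding side_in_def both_sides_def by blast
  then obtain x where x: "x \<in> O3 - \<Gamma>" "x \<in> P" using O3 unfolding near_def by blast
  then have "winding_number m (\<phi> x) \<noteq> 1" using N unfolding O3_def by blast
  then have "y \<notin> N" if "y \<in> O3" for y using const[OF that, of x] x N(1) by auto
  then have "y \<in> P \<union> Q" if "y \<in> O3 - \<Gamma>" for y using that N(2) unfolding O3_def by blast
  then show "near (c e t) (\<lambda>x. x \<in> P \<union> Q)" unfolding near_def using O3 by blast
qed

text \<open>Near a vertex of degree three the complement of the drawing falls into three sectors.
The sector \<open>C1\<close> lies to the left of \<open>e1\<close> and to the right of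
\<open>e2\<close>, and so on cyclically: this is the rotation of the embedding at the
vertex.\<close>
definition vertex_germ where
  "vertex_germ v e1 e2 e3 O' C1 C2 C3 \<longleftrightarrow>
     openin S O' \<and> p v \<in> O' \<and> (\<forall>u \<in> pverts G. p u \<in> O' \<longrightarrow> u = v) \<and>
     openin S C1 \<and> openin S C2 \<and> openin S C3 \<and> O' - \<Gamma> = C1 \<union> C2 \<union> C3 \<and>
     C1 \<inter> C2 = {} \<and> C2 \<inter> C3 = {} \<and> C1 \<inter> C3 = {} \<and>
     (\<forall>t. 0 < t \<and> t < 1 \<and> c e1 t \<in> O' \<longrightarrow> side e1 t C1 \<and> near (c e1 t) (\<lambda>x. x \<in> C1 \<union> C3)) \<and>
     (\<forall>t. 0 < t \<and> t < 1 \<and> c e2 t \<in> O' \<longrightarrow> side e2 t C2 \<and> near (c e2 t) (\<lambda>x. x \<in> C2 \<union> C1)) \<and>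
     (\<forall>t. 0 < t \<and> t < 1 \<and> c e3 t \<in> O' \<longrightarrow> side e3 t C3 \<and> near (c e3 t) (\<lambda>x. x \<in> C3 \<union> C2)) \<and>
     (\<forall>e \<in> parcs G. \<forall>t. 0 < t \<and> t < 1 \<and> c e t \<in> O' \<longrightarrow> e \<in> {e1,e2,e3} \<or> prod.swap e \<in> {e1,e2,e3})"

text \<open>If the three arms hit the circle in the order \<open>e1\<close>, \<open>e2\<close>,
\<open>e3\<close>, then the three sectors are the interiors of the three corner loops between
consecutive arms.\<close>
lemma vertex_germ_ordered:
  assumes v: "v \<in> pverts G" and U: "(U,\<phi>) \<in> \<A>" "p v \<in> U"
    and out: "out v = {e1,e2,e3}" "e1 \<noteq> e2" "e2 \<noteq> e3" "e1 \<noteq> e3"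
    and r: "0 < r"
    and b: "\<And>e. e \<in> out v \<Longrightarrow> 0 < b e \<and> b e < 1 \<and> c e ` {0..b e} \<subseteq> U"
    and arm: "\<And>e. e \<in> out v \<Longrightarrow> is_arm (\<phi> (p v)) r (subpath 0 (b e) (\<phi> \<circ> c e))"
    and C: "simple_path C" "pathfinish C = pathstart C" "path_image C = sphere (\<phi> (p v)) r"
      "\<forall>x \<in> ball (\<phi> (p v)) r. winding_number C x = 1"
    and s: "C 0 = \<phi> (c e1 (b e1))" "C 1 = \<phi> (c e1 (b e1))" "C s2 = \<phi> (c e2 (b e2))" "C s3 = \<phi> (c e3 (b e3))"
      "0 < s2" "s2 < s3" "s3 < 1"
  shows "\<exists>O' C1 C2 C3. vertex_germ v e1 e2 e3 O' C1 C2 C3"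
proof -
  let ?z = "\<phi> (p v)"
  define g where "g e = subpath 0 (b e) (\<phi> \<circ> c e)" for e
  have arms: "is_arm ?z r (g e)" if "e \<in> out v" for e using arm[OF that] by (simp add: g_def)
  have gim: "path_image (g e) = (\<phi> \<circ> c e) ` {0..b e}" if "e \<in> out v" for e
    using b[OF that] by (simp add: g_def path_image_subpath)
  have gfin: "pathfinish (g e) = \<phi> (c e (b e))" for e by (simp add: g_def)
  have gp: "path (g e)" if "e \<in> out v" for e using arms[OF that] by (simp add: is_arm_def arc_imp_path)
  have meet: "path_image (g e) \<inter> path_image (g e') = {?z}" if e: "e \<in> out v" "e' \<in> out v" "e \<noteq> e'" for e e'
  proof
    show "{?z} \<subseteq> path_image (g e) \<inter> path_image (g e')"
      using arms[OF e(1)] arms[OF e(2)] pathstart_in_path_image[of "g e"] pathstart_in_path_image[of "g e'"]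
      by (simp add: is_arm_def)
    show "path_image (g e) \<inter> path_image (g e') \<subseteq> {?z}"
    proof
      fix y assume "y \<in> path_image (g e) \<inter> path_image (g e')"
      then obtain s s' where s: "s \<in> {0..b e}" "y = \<phi> (c e s)" "s' \<in> {0..b e'}" "y = \<phi> (c e' s')"
        unfolding gim[OF e(1)] gim[OF e(2)] by auto
      have "c e s \<in> U" "c e' s' \<in> U" using b[OF e(1)] b[OF e(2)] s(1,3) by blast+
      then have "c e s = c e' s'" using inj_onD[OF chart(4)[OF U(1)], of "c e s" "c e' s'"] s by simp
      then have "s = 0" using arms_meet[OF e, of s s'] b[OF e(1)] b[OF e(2)] s by auto
      then show "y \<in> {?z}" using s outD(3)[OF e(1)] by simp
    qed
  qed
  have eo: "e1 \<in> out v" "e2 \<in> out v" "e3 \<in> out v" using out by auto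
  define q1 where "q1 = subpath 0 s2 C"
  define q2 where "q2 = subpath s2 s3 C"
  define q3 where "q3 = subpath s3 1 C"
  define k1 where "k1 = corner_loop (g e1) q1 (g e2)"
  define k2 where "k2 = corner_loop (g e2) q2 (g e3)"
  define k3 where "k3 = corner_loop (g e3) q3 (g e1)"
  have s': "0 \<le> s2" "s3 \<le> 1" "s2 \<le> 1" "0 \<le> s3" using s by auto
  have K1: "simple_path k1" "pathfinish k1 = pathstart k1"
    "path_image k1 = path_image (g e1) \<union> path_image q1 \<union> path_image (g e2)"
    "\<And>x. x \<notin> path_image k1 \<Longrightarrow> winding_number k1 x = winding_number (g e1) x + winding_number q1 x - winding_number (g e2) x"
    "\<And>x. x \<notin> path_image k1 \<Longrightarrow> winding_number k1 x \<in> {0,1}" "path_image q1 \<subseteq> sphere ?z r"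
    unfolding k1_def q1_def
    using corner_loop[OF C r arms[OF eo(1)] arms[OF eo(2)] meet[OF eo(1,2) out(2)] order_refl s(5) s'(3)] s
    by (simp_all add: gfin)
  have K2: "simple_path k2" "pathfinish k2 = pathstart k2"
    "path_image k2 = path_image (g e2) \<union> path_image q2 \<union> path_image (g e3)"
    "\<And>x. x \<notin> path_image k2 \<Longrightarrow> winding_number k2 x = winding_number (g e2) x + winding_number q2 x - winding_number (g e3) x"
    "\<And>x. x \<notin> path_image k2 \<Longrightarrow> winding_number k2 x \<in> {0,1}" "path_image q2 \<subseteq> sphere ?z r"
    unfolding k2_def q2_def
    using corner_loop[OF C r arms[OF eo(2)] arms[OF eo(3)] meet[OF eo(2,3) out(3)] s'(1) s(6) s'(2)] s
    by (simp_all add: gfin)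
  have K3: "simple_path k3" "pathfinish k3 = pathstart k3"
    "path_image k3 = path_image (g e3) \<union> path_image q3 \<union> path_image (g e1)"
    "\<And>x. x \<notin> path_image k3 \<Longrightarrow> winding_number k3 x = winding_number (g e3) x + winding_number q3 x - winding_number (g e1) x"
    "\<And>x. x \<notin> path_image k3 \<Longrightarrow> winding_number k3 x \<in> {0,1}" "path_image q3 \<subseteq> sphere ?z r"
    unfolding k3_def q3_def
    using corner_loop[OF C r arms[OF eo(3)] arms[OF eo(1)] meet[OF eo(3,1) out(4)[symmetric]] s'(4) s(7) order_refl] s
    by (simp_all add: gfin)
  define W where "W = {x\<in>U. \<phi> x \<in> ball ?z r}"
  have W: "openin S W" "p v \<in> W" unfolding W_def using chart_open_preimage[OF U(1), of "ball ?z r"] U r by auto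
  have ne: "out v \<noteq> {}" using out by simp
  have b01: "0 < b e \<and> b e < 1" if "e \<in> out v" for e using b[OF that] by blast
  obtain O' where O': "openin S O'" "p v \<in> O'" "O' \<subseteq> W" "\<forall>u \<in> pverts G. p u \<in> O' \<longrightarrow> u = v"
    "\<And>x. x \<in> O' \<Longrightarrow> x \<in> \<Gamma> \<Longrightarrow> \<exists>e \<in> out v. \<exists>s \<in> {0..<b e}. x = c e s"
    "\<And>e t. e \<in> out v \<Longrightarrow> t \<le> 1 \<Longrightarrow> c e t \<in> O' \<Longrightarrow> t < b e"
    by (rule star_neighbourhood[OF v W ne b01]) blast+
  have OU: "O' \<subseteq> U" using O'(3) by (auto simp: W_def)
  have Osph: "\<phi> x \<notin> sphere ?z r" if "x \<in> O'" for x using that O'(3) by (auto simp: W_def)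
  have kpaths: "path k1" "path k2" "path k3" using K1(1) K2(1) K3(1) by (simp_all add: simple_path_imp_path)
  define Cn where "Cn k = {x \<in> O' - \<Gamma>. winding_number k (\<phi> x) = 1}" for k :: "real \<Rightarrow> complex"
  have offg: "\<phi> x \<notin> path_image (g e)" if x: "x \<in> O' - \<Gamma>" and e: "e \<in> out v" for x e
  proof
    assume "\<phi> x \<in> path_image (g e)"
    then obtain t where t: "t \<in> {0..b e}" "\<phi> x = \<phi> (c e t)" unfolding gim[OF e] by auto
    then have "x = c e t" using inj_onD[OF chart(4)[OF U(1)] t(2)] b[OF e] x OU by blast
    then show False using x t curve_in_\<Gamma>[OF outD(1)[OF e], of t] b[OF e] by auto
  qed
  have off: "\<phi> x \<notin> path_image k1" "\<phi> x \<notin> path_image k2" "\<phi> x \<notin> path_image k3" if x: "x \<in> O' - \<Gamma>" for x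
    using offg[OF x eo(1)] offg[OF x eo(2)] offg[OF x eo(3)] Osph[of x] x K1(3,6) K2(3,6) K3(3,6) by blast+
  have sum: "winding_number k1 (\<phi> x) + winding_number k2 (\<phi> x) + winding_number k3 (\<phi> x) = 1" if x: "x \<in> O' - \<Gamma>" for x
  proof -
    have pC: "path C" using C(1) by (rule simple_path_imp_path)
    have nC: "\<phi> x \<notin> path_image C" using Osph[of x] x unfolding C(3) by blast
    have "winding_number q1 (\<phi> x) + winding_number q2 (\<phi> x) + winding_number q3 (\<phi> x) = winding_number C (\<phi> x)"
      using winding_number_subpath_combine[OF pC nC, of 0 s2 s3] winding_number_subpath_combine[OF pC nC, of 0 s3 1] s
      by (simp add: q1_def q2_def q3_def)
    also have "\<dots> = 1" using C(4) x O'(3) by (auto simp: W_def)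
    finally show ?thesis unfolding K1(4)[OF off(1)[OF x]] K2(4)[OF off(2)[OF x]] K3(4)[OF off(3)[OF x]]
      by (simp add: algebra_simps)
  qed
  have cases: "winding_number k1 (\<phi> x) = 1 \<and> winding_number k2 (\<phi> x) \<noteq> 1 \<and> winding_number k3 (\<phi> x) \<noteq> 1 \<or>
      winding_number k1 (\<phi> x) \<noteq> 1 \<and> winding_number k2 (\<phi> x) = 1 \<and> winding_number k3 (\<phi> x) \<noteq> 1 \<or>
      winding_number k1 (\<phi> x) \<noteq> 1 \<and> winding_number k2 (\<phi> x) \<noteq> 1 \<and> winding_number k3 (\<phi> x) = 1" if x: "x \<in> O' - \<Gamma>" for x
    using sum[OF x] K1(5)[OF off(1)[OF x]] K2(5)[OF off(2)[OF x]] K3(5)[OF off(3)[OF x]] by auto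
  have part: "O' - \<Gamma> = Cn k1 \<union> Cn k2 \<union> Cn k3" "Cn k1 \<inter> Cn k2 = {}" "Cn k2 \<inter> Cn k3 = {}" "Cn k1 \<inter> Cn k3 = {}"
    unfolding Cn_def using cases by blast+
  have openC: "openin S (Cn k)" if "path k" "pathfinish k = pathstart k" "\<And>x. x \<in> O' - \<Gamma> \<Longrightarrow> \<phi> x \<notin> path_image k" for k
  proof -
    have eq: "Cn k = (O' - \<Gamma>) \<inter> {x\<in>U. \<phi> x \<in> {z. z \<notin> path_image k \<and> winding_number k z = 1}}"
      unfolding Cn_def using that(3) OU by blast
    show ?thesis unfolding eq
      by (rule openin_Int[OF openin_diff[OF O'(1) \<Gamma>_closed]
          chart_open_preimage[OF U(1) open_winding_number_levelsets[OF that(1,2)]]])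
  qed
  let ?all = "sphere ?z r \<union> (\<Union>e \<in> out v. (\<phi> \<circ> c e) ` {0..b e})"
  have kall: "path_image k1 \<subseteq> ?all" "path_image k2 \<subseteq> ?all" "path_image k3 \<subseteq> ?all"
  proof -
    have ga: "path_image (g e) \<subseteq> ?all" if "e \<in> out v" for e
      unfolding gim[OF that] by (rule le_supI2, rule UN_upper[OF that])
    show "path_image k1 \<subseteq> ?all" "path_image k2 \<subseteq> ?all" "path_image k3 \<subseteq> ?all"
      unfolding K1(3) K2(3) K3(3)
      by (intro Un_least ga eo le_supI1 K1(6) K2(6) K3(6))+
  qed
  have notg: "\<phi> (c e t) \<notin> path_image (g e')" if "e \<in> out v" "e' \<in> out v" "e \<noteq> e'" "0 < t" "t < 1" "c e t \<in> O'" for e e' t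
  proof
    assume "\<phi> (c e t) \<in> path_image (g e')"
    moreover have "t < b e" using O'(6)[OF that(1) _ that(6)] that(5) by simp
    then have "\<phi> (c e t) \<in> path_image (g e)" unfolding gim[OF that(1)] using that by auto
    ultimately have "\<phi> (c e t) = ?z" using meet[OF that(1-3)] by blast
    then have "c e t = p v" using inj_onD[OF chart(4)[OF U(1)]] that(6) OU U(2) by blast
    then show False using curve_interior_not_vertex[OF outD(1)[OF that(1)] that(4,5) v] by blast
  qed
  have cq: "isCont (\<lambda>z. winding_number q z - winding_number (g e') z) (\<phi> (c e t))"
    if "path q" "path_image q \<subseteq> sphere ?z r" "e \<in> out v" "e' \<in> out v" "e \<noteq> e'" "0 < t" "t < 1" "c e t \<in> O'" for q e e' t
    using that notg[OF that(3-8)] Osph[OF that(8)] gp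
    by (intro continuous_intros continuous_at_winding_number) auto
  have qp: "path q1" "path q2" "path q3"
    using simple_path_imp_path[OF C(1)] s s' by (simp_all add: q1_def q2_def q3_def)
  note ac = arm_corner[OF U(1) _ O'(1) OU O'(5,6) Osph b]
  have A1: "side e1 t (Cn k1)" "near (c e1 t) (\<lambda>x. x \<in> Cn k1 \<union> Cn k3)" if t: "0 < t" "t < 1" "c e1 t \<in> O'" for t
  proof -
    have m: "\<phi> (c e1 t) \<notin> path_image k2"
      using notg[OF eo(1,2) out(2) t] notg[OF eo(1,3) out(4) t] Osph[OF t(3)] K2(3,6) by blast
    have w: "winding_number k1 z = winding_number (subpath 0 (b e1) (\<phi> \<circ> c e1)) z + (winding_number q1 z - winding_number (g e2) z)"
      if "z \<notin> path_image k1" for z using K1(4)[OF that] by (simp add: g_def)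
    have sub: "(\<phi> \<circ> c e1) ` {0..b e1} \<subseteq> path_image k1" using K1(3) gim[OF eo(1)] by blast
    have u: "O' - \<Gamma> = Cn k1 \<union> Cn k3 \<union> Cn k2" using part(1) by blast
    show "side e1 t (Cn k1)" "near (c e1 t) (\<lambda>x. x \<in> Cn k1 \<union> Cn k3)"
      by (rule ac[OF eo(1) _ _ _ _ _ _ _ t K1(1,2,5) sub kall(1) w cq[OF qp(1) K1(6) eo(1,2) out(2) t] Cn_def kpaths(2) K2(2) m Cn_def u part(2)]; blast)+
  qed
  have A2: "side e2 t (Cn k2)" "near (c e2 t) (\<lambda>x. x \<in> Cn k2 \<union> Cn k1)" if t: "0 < t" "t < 1" "c e2 t \<in> O'" for t
  proof -
    have m: "\<phi> (c e2 t) \<notin> path_image k3"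
      using notg[OF eo(2,1) out(2)[symmetric] t] notg[OF eo(2,3) out(3) t] Osph[OF t(3)] K3(3,6) by blast
    have w: "winding_number k2 z = winding_number (subpath 0 (b e2) (\<phi> \<circ> c e2)) z + (winding_number q2 z - winding_number (g e3) z)"
      if "z \<notin> path_image k2" for z using K2(4)[OF that] by (simp add: g_def)
    have sub: "(\<phi> \<circ> c e2) ` {0..b e2} \<subseteq> path_image k2" using K2(3) gim[OF eo(2)] by blast
    have u: "O' - \<Gamma> = Cn k2 \<union> Cn k1 \<union> Cn k3" using part(1) by blast
    show "side e2 t (Cn k2)" "near (c e2 t) (\<lambda>x. x \<in> Cn k2 \<union> Cn k1)"
      by (rule ac[OF eo(2) _ _ _ _ _ _ _ t K2(1,2,5) sub kall(2) w cq[OF qp(2) K2(6) eo(2,3) out(3) t] Cn_def kpaths(3) K3(2) m Cn_def u part(3)]; blast)+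
  qed
  have A3: "side e3 t (Cn k3)" "near (c e3 t) (\<lambda>x. x \<in> Cn k3 \<union> Cn k2)" if t: "0 < t" "t < 1" "c e3 t \<in> O'" for t
  proof -
    have m: "\<phi> (c e3 t) \<notin> path_image k1"
      using notg[OF eo(3,1) out(4)[symmetric] t] notg[OF eo(3,2) out(3)[symmetric] t] Osph[OF t(3)] K1(3,6) by blast
    have w: "winding_number k3 z = winding_number (subpath 0 (b e3) (\<phi> \<circ> c e3)) z + (winding_number q3 z - winding_number (g e1) z)"
      if "z \<notin> path_image k3" for z using K3(4)[OF that] by (simp add: g_def)
    have sub: "(\<phi> \<circ> c e3) ` {0..b e3} \<subseteq> path_image k3" using K3(3) gim[OF eo(3)] by blast
    have u: "O' - \<Gamma> = Cn k3 \<union> Cn k2 \<union> Cn k1" using part(1) by blast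
    have d: "Cn k3 \<inter> Cn k1 = {}" using part(4) by blast
    show "side e3 t (Cn k3)" "near (c e3 t) (\<lambda>x. x \<in> Cn k3 \<union> Cn k2)"
      by (rule ac[OF eo(3) _ _ _ _ _ _ _ t K3(1,2,5) sub kall(3) w cq[OF qp(3) K3(6) eo(3,1) out(4)[symmetric] t] Cn_def kpaths(1) K1(2) m Cn_def u d]; blast)+
  qed
  have A4: "e \<in> {e1,e2,e3} \<or> prod.swap e \<in> {e1,e2,e3}" if e: "e \<in> parcs G" "0 < t" "t < 1" "c e t \<in> O'" for e t
  proof -
    obtain e' s where s: "e' \<in> out v" "s \<in> {0..<b e'}" "c e t = c e' s"
      using O'(5)[OF e(4) curve_in_\<Gamma>[OF e(1)]] e by auto
    then have "e' = e \<or> e' = prod.swap e" using curve_eq_cases[OF e(1) outD(1)[OF s(1)] e(2,3), of s] b[OF s(1)] by auto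
    then show ?thesis using s(1) out(1) by auto
  qed
  have oC: "openin S (Cn k1)" "openin S (Cn k2)" "openin S (Cn k3)"
    by (rule openC[OF kpaths(1) K1(2) off(1)] openC[OF kpaths(2) K2(2) off(2)] openC[OF kpaths(3) K3(2) off(3)]; assumption)+
  have "vertex_germ v e1 e2 e3 O' (Cn k1) (Cn k2) (Cn k3)"
    unfolding vertex_germ_def
    by (intro conjI O'(1,2,4) oC part allI impI ballI A1 A2 A3 A4; blast)
  then show ?thesis by blast
qed

end

section \<open>Face tracing: arc labels and faces\<close>

context oriented_drawing begin

text \<open>A circle around the vertex meets the three arms in some cyclic order; renaming two of
the edges reduces the other order to the one treated before.\<close>
lemma vertex_germ_exists:
  assumes v: "v \<in> pverts G" and card: "card (out v) = 3"
  shows "\<exists>e1 e2 e3 O' C1 C2 C3. out v = {e1,e2,e3} \<and> e1 \<noteq> e2 \<and> e2 \<noteq> e3 \<and> e1 \<noteq> e3 \<and>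
     vertex_germ v e1 e2 e3 O' C1 C2 C3"
proof -
  obtain x y w where out: "out v = {x,y,w}" "x \<noteq> y" "y \<noteq> w" "x \<noteq> w"
    using card by (auto simp: card_3_iff)
  have "p v \<in> topspace S" using p_in v by blast
  then obtain U \<phi> where U: "(U,\<phi>) \<in> \<A>" "p v \<in> U" using chart_cover by blast
  have R: "\<exists>R>0. \<forall>r. 0 < r \<and> r < R \<longrightarrow> (\<exists>b. 0 < b \<and> b < 1 \<and> c e ` {0..b} \<subseteq> U \<and>
     is_arm (\<phi> (p v)) r (subpath 0 b (\<phi> \<circ> c e)))" if "e \<in> out v" for e
  proof -
    have "c e 0 \<in> U" using outD(3)[OF that] U by simp
    from forward_arm[OF outD(1)[OF that] U(1) order_refl zero_less_one this]
    show ?thesis unfolding outD(3)[OF that] by metis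
  qed
  obtain R where R: "\<And>e. e \<in> out v \<Longrightarrow> 0 < R e \<and> (\<forall>r. 0 < r \<and> r < R e \<longrightarrow> (\<exists>b. 0 < b \<and> b < 1 \<and> c e ` {0..b} \<subseteq> U \<and>
     is_arm (\<phi> (p v)) r (subpath 0 b (\<phi> \<circ> c e))))" using R by metis
  define r where "r = min (R x) (min (R y) (R w)) / 2"
  have r0: "0 < r" and rR: "\<And>e. e \<in> out v \<Longrightarrow> r < R e"
    using R[of x] R[of y] R[of w] out(1) by (auto simp: r_def min_def)
  have "\<exists>b. 0 < b \<and> b < 1 \<and> c e ` {0..b} \<subseteq> U \<and> is_arm (\<phi> (p v)) r (subpath 0 b (\<phi> \<circ> c e))"
    if "e \<in> out v" for e using R[OF that] r0 rR[OF that] by blast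
  then obtain b where b: "\<And>e. e \<in> out v \<Longrightarrow> 0 < b e \<and> b e < 1 \<and> c e ` {0..b e} \<subseteq> U \<and>
      is_arm (\<phi> (p v)) r (subpath 0 (b e) (\<phi> \<circ> c e))" by metis
  have b1: "0 < b e \<and> b e < 1 \<and> c e ` {0..b e} \<subseteq> U" if "e \<in> out v" for e using b[OF that] by blast
  have b2: "is_arm (\<phi> (p v)) r (subpath 0 (b e) (\<phi> \<circ> c e))" if "e \<in> out v" for e using b[OF that] by blast
  have sph: "\<phi> (c e (b e)) \<in> sphere (\<phi> (p v)) r" if "e \<in> out v" for e using b2[OF that] by (simp add: is_arm_def)
  have eo: "x \<in> out v" "y \<in> out v" "w \<in> out v" using out by auto
  obtain C where C: "simple_path C" "pathfinish C = pathstart C" "path_image C = sphere (\<phi> (p v)) r"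
      "\<And>z. z \<in> ball (\<phi> (p v)) r \<Longrightarrow> winding_number C z = 1" "C 0 = \<phi> (c x (b x))" "C 1 = \<phi> (c x (b x))"
    using based_circle[OF r0 sph[OF eo(1)]] by blast
  have C4: "\<forall>z \<in> ball (\<phi> (p v)) r. winding_number C z = 1" using C(4) by blast
  have diff: "\<phi> (c e (b e)) \<noteq> \<phi> (c e' (b e'))" if e: "e \<in> out v" "e' \<in> out v" "e \<noteq> e'" for e e'
  proof
    assume eq: "\<phi> (c e (b e)) = \<phi> (c e' (b e'))"
    have "c e (b e) \<in> U" "c e' (b e') \<in> U" using b1[OF e(1)] b1[OF e(2)] by auto
    then have "c e (b e) = c e' (b e')" using inj_onD[OF chart(4)[OF U(1)] eq] by blast
    then show False using arms_meet[OF e, of "b e" "b e'"] b1[OF e(1)] b1[OF e(2)] by auto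
  qed
  have pos: "\<exists>s. 0 < s \<and> s < 1 \<and> C s = \<phi> (c e (b e))" if e: "e \<in> out v" "e \<noteq> x" for e
  proof -
    have "\<phi> (c e (b e)) \<in> path_image C" using sph[OF e(1)] C(3) by simp
    then obtain s where s: "s \<in> {0..1}" "C s = \<phi> (c e (b e))" unfolding path_image_def by auto
    have "s \<noteq> 0" "s \<noteq> 1" using s(2) C(5,6) diff[OF eo(1) e(1)] e(2) by auto
    then show ?thesis using s by (intro exI[of _ s]) auto
  qed
  obtain s2 where s2: "0 < s2" "s2 < 1" "C s2 = \<phi> (c y (b y))" using pos[OF eo(2)] out by auto
  obtain s3 where s3: "0 < s3" "s3 < 1" "C s3 = \<phi> (c w (b w))" using pos[OF eo(3)] out by auto
  have "s2 \<noteq> s3" using s2 s3 diff[OF eo(2,3) out(3)] by auto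
  then consider "s2 < s3" | "s3 < s2" by linarith
  then show ?thesis
  proof cases
    case 1
    have "\<exists>O' C1 C2 C3. vertex_germ v x y w O' C1 C2 C3"
      by (rule vertex_germ_ordered[OF v U out r0 b1 b2 C(1-3) C4 C(5,6) s2(3) s3(3) s2(1) 1 s3(2)]; blast)
    then show ?thesis using out by blast
  next
    case 2
    have out': "out v = {x,w,y}" "x \<noteq> w" "w \<noteq> y" "x \<noteq> y" using out by auto
    have "\<exists>O' C1 C2 C3. vertex_germ v x w y O' C1 C2 C3"
      by (rule vertex_germ_ordered[OF v U out' r0 b1 b2 C(1-3) C4 C(5,6) s3(3) s2(3) s3(1) 2 s2(2)]; blast)
    then show ?thesis using out' by blast
  qed
qed

text \<open>A locally constant function near \<open>q\<close> off the drawing that takes the value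
\<open>h e\<close> on the left of every directed edge \<open>e\<close>. It is the local form of a
function on faces that is induced by a function on arcs.\<close>
definition germ :: "('v \<times> 'v \<Rightarrow> 'b) \<Rightarrow> 's \<Rightarrow> 's set \<Rightarrow> ('s \<Rightarrow> 'b) \<Rightarrow> bool" where
  "germ h q O' lam \<longleftrightarrow> openin S O' \<and> q \<in> O' \<and> (\<forall>y. openin S {x \<in> O' - \<Gamma>. lam x = y}) \<and>
     (\<forall>v \<in> pverts G. p v \<in> O' \<longrightarrow> p v = q) \<and>
     (\<forall>e \<in> parcs G. \<forall>t. 0 < t \<and> t < 1 \<and> c e t \<in> O' \<longrightarrow>
        (\<exists>P. side e t P \<and> near (c e t) (\<lambda>x. lam x = (if x \<in> P then h e else h (prod.swap e)))))"

lemma edge_germ_label: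
  assumes e: "e \<in> parcs G" and t: "0 < t" "t < 1"
  shows "\<exists>O' l. germ h (c e t) O' l"
proof -
  obtain O' P where O': "openin S O'" "c e t \<in> O'" "openin S ((O' - \<Gamma>) \<inter> P)" "openin S (O' - \<Gamma> - P)"
    "\<forall>v \<in> pverts G. p v \<notin> O'"
    "\<forall>e' \<in> parcs G. \<forall>t'. 0 < t' \<and> t' < 1 \<and> c e' t' \<in> O' \<longrightarrow>
       e' = e \<and> side e' t' P \<or> e' = prod.swap e \<and> side e' t' (- P)"
    using edge_germ[OF e t] by metis
  let ?l = "\<lambda>x. if x \<in> P then h e else h (prod.swap e)"
  have "openin S {x \<in> O' - \<Gamma>. ?l x = y}" for y
  proof -
    have "{x \<in> O' - \<Gamma>. ?l x = y} = (if h e = y then (O' - \<Gamma>) \<inter> P else {}) \<union> (if h (prod.swap e) = y then O' - \<Gamma> - P else {})"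
      by auto
    then show ?thesis using O'(3,4) by auto
  qed
  moreover have "\<exists>Q. side e' t' Q \<and> near (c e' t') (\<lambda>x. ?l x = (if x \<in> Q then h e' else h (prod.swap e')))"
    if e': "e' \<in> parcs G" "0 < t' \<and> t' < 1 \<and> c e' t' \<in> O'" for e' t'
  proof -
    have n: "near (c e' t') (\<lambda>x. x \<in> O')" using near_openin[OF O'(1)] e' by blast
    consider "e' = e" "side e' t' P" | "e' = prod.swap e" "side e' t' (- P)" using O'(6) e' by blast
    then show ?thesis
    proof cases
      case 1 then show ?thesis by (intro exI[of _ P] conjI near_mono[OF n]) auto
    next
      case 2 then show ?thesis by (intro exI[of _ "- P"] conjI near_mono[OF n]) auto
    qed
  qed
  ultimately have "germ h (c e t) O' ?l" unfolding germ_def using O'(1,2,5) by simp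
  then show ?thesis by blast
qed

text \<open>In the sector between two consecutive arms, the two prescribed values are those of an
arc into the vertex and of its successor under face tracing; so they agree exactly if
\<open>h\<close> is invariant.\<close>
lemma vertex_germ_label:
  assumes g: "vertex_germ v e1 e2 e3 O' C1 C2 C3" and e: "e1 \<in> parcs G" "e2 \<in> parcs G" "e3 \<in> parcs G"
    and h: "h (prod.swap e1) = h e3" "h (prod.swap e2) = h e1" "h (prod.swap e3) = h e2"
  shows "germ h (p v) O' (\<lambda>x. if x \<in> C1 then h e1 else if x \<in> C2 then h e2 else h e3)"
proof -
  let ?l = "\<lambda>x. if x \<in> C1 then h e1 else if x \<in> C2 then h e2 else h e3"
  have O': "openin S O'" "p v \<in> O'" "\<forall>u \<in> pverts G. p u \<in> O' \<longrightarrow> u = v" and C: "openin S C1" "openin S C2" "openin S C3"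
    and part: "O' - \<Gamma> = C1 \<union> C2 \<union> C3" "C1 \<inter> C2 = {}" "C2 \<inter> C3 = {}" "C1 \<inter> C3 = {}"
    using g unfolding vertex_germ_def by - (elim conjE, assumption)+
  have A1: "\<forall>t. 0 < t \<and> t < 1 \<and> c e1 t \<in> O' \<longrightarrow> side e1 t C1 \<and> near (c e1 t) (\<lambda>x. x \<in> C1 \<union> C3)"
    and A2: "\<forall>t. 0 < t \<and> t < 1 \<and> c e2 t \<in> O' \<longrightarrow> side e2 t C2 \<and> near (c e2 t) (\<lambda>x. x \<in> C2 \<union> C1)"
    and A3: "\<forall>t. 0 < t \<and> t < 1 \<and> c e3 t \<in> O' \<longrightarrow> side e3 t C3 \<and> near (c e3 t) (\<lambda>x. x \<in> C3 \<union> C2)"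
    and A4: "\<forall>e \<in> parcs G. \<forall>t. 0 < t \<and> t < 1 \<and> c e t \<in> O' \<longrightarrow> e \<in> {e1,e2,e3} \<or> prod.swap e \<in> {e1,e2,e3}"
    using g unfolding vertex_germ_def by - (elim conjE, assumption)+
  have op: "openin S {x \<in> O' - \<Gamma>. ?l x = y}" for y
  proof -
    have "{x \<in> O' - \<Gamma>. ?l x = y} = (if h e1 = y then C1 else {}) \<union> (if h e2 = y then C2 else {}) \<union> (if h e3 = y then C3 else {})"
      unfolding part(1) using part(2-4) by (auto split: if_splits)
    then show ?thesis using C by auto
  qed
  have fw: "\<exists>P. side e t P \<and> near (c e t) (\<lambda>x. ?l x = (if x \<in> P then h e else h (prod.swap e)))"
    if ee: "e \<in> {e1,e2,e3}" "0 < t" "t < 1" "c e t \<in> O'" for e t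
  proof -
    consider "e = e1" | "e = e2" | "e = e3" using ee(1) by blast
    then show ?thesis
    proof cases
      case 1
      then have "side e t C1" "near (c e t) (\<lambda>x. x \<in> C1 \<union> C3)" using A1 ee by auto
      then show ?thesis using 1 h part by (intro exI[of _ C1] conjI) (auto elim!: near_mono)
    next
      case 2
      then have "side e t C2" "near (c e t) (\<lambda>x. x \<in> C2 \<union> C1)" using A2 ee by auto
      then show ?thesis using 2 h part by (intro exI[of _ C2] conjI) (auto elim!: near_mono)
    next
      case 3
      then have "side e t C3" "near (c e t) (\<lambda>x. x \<in> C3 \<union> C2)" using A3 ee by auto
      then show ?thesis using 3 h part by (intro exI[of _ C3] conjI) (auto elim!: near_mono)
    qed
  qed
  have "\<exists>P. side e t P \<and> near (c e t) (\<lambda>x. ?l x = (if x \<in> P then h e else h (prod.swap e)))"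
    if ee: "e \<in> parcs G" "0 < t \<and> t < 1 \<and> c e t \<in> O'" for e t
  proof -
    consider "e \<in> {e1,e2,e3}" | "prod.swap e \<in> {e1,e2,e3}" using A4 ee by blast
    then show ?thesis
    proof cases
      case 1 then show ?thesis using fw ee by blast
    next
      case 2
      have eq: "c (prod.swap e) (1 - t) = c e t" using curve(6)[OF ee(1), of "1 - t"] ee by simp
      obtain P where P: "side (prod.swap e) (1 - t) P"
        "near (c (prod.swap e) (1 - t)) (\<lambda>x. ?l x = (if x \<in> P then h (prod.swap e) else h (prod.swap (prod.swap e))))"
        using fw[OF 2, of "1 - t"] ee eq by auto
      have "side (prod.swap (prod.swap e)) (1 - (1 - t)) (- P)" by (rule side_swap[OF swap_arc[OF ee(1)] P(1)])
      then have "side e t (- P)" by simp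
      moreover have "near (c e t) (\<lambda>x. ?l x = (if x \<in> - P then h e else h (prod.swap e)))"
        using P(2) unfolding eq by (rule near_mono) auto
      ultimately show ?thesis by blast
    qed
  qed
  then show ?thesis unfolding germ_def using O' op by blast
qed

text \<open>Two germs take the same values on the left of an edge because the left side is
unique.\<close>
lemma germs_agree:
  assumes g: "germ h q O1 l1" "germ h q' O2 l2" and e: "e \<in> parcs G" "0 < t" "t < 1" "c e t \<in> O1" "c e t \<in> O2"
  shows "near (c e t) (\<lambda>x. l1 x = l2 x)"
proof -
  obtain P1 where P1: "side e t P1" "near (c e t) (\<lambda>x. l1 x = (if x \<in> P1 then h e else h (prod.swap e)))"
    using g(1) e unfolding germ_def by blast
  obtain P2 where P2: "side e t P2" "near (c e t) (\<lambda>x. l2 x = (if x \<in> P2 then h e else h (prod.swap e)))"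
    using g(2) e unfolding germ_def by blast
  show ?thesis
    by (rule near_mono[OF near_conj[OF near_conj[OF P1(2) P2(2)] side_unique[OF e(1-3) P1(1) P2(1)]]]) auto
qed

text \<open>Two germs agree near every common point of the drawing, since such a point is either a
vertex, and then the centre of both, or lies on an edge and \<open>germs_agree\<close> applies. The
drawing is compact, so that finitely many germs can be shrunk and glued to one locally constant
function around all of it.\<close>
lemma glue_germs:
  assumes germs: "\<And>q. q \<in> \<Gamma> \<Longrightarrow> germ h q (O' q) (l q)"
  obtains N \<Lambda> where "openin S N" "\<Gamma> \<subseteq> N" "\<And>y. openin S {x \<in> N - \<Gamma>. \<Lambda> x = y}"
    "\<And>e t. e \<in> parcs G \<Longrightarrow> 0 < t \<Longrightarrow> t < 1 \<Longrightarrow>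
       \<exists>P. side e t P \<and> near (c e t) (\<lambda>x. \<Lambda> x = (if x \<in> P then h e else h (prod.swap e)))"
proof -
  have g: "openin S (O' q)" "q \<in> O' q" "\<And>y. openin S {x \<in> O' q - \<Gamma>. l q x = y}"
     "\<And>v. v \<in> pverts G \<Longrightarrow> p v \<in> O' q \<Longrightarrow> p v = q"
    if "q \<in> \<Gamma>" for q using germs[OF that] unfolding germ_def by blast+
  have reg: "regular_space S" using compact hausdorff by (rule compact_Hausdorff_imp_regular_space)
  have "\<exists>W K. openin S W \<and> closedin S K \<and> q \<in> W \<and> W \<subseteq> K \<and> K \<subseteq> O' q" if "q \<in> \<Gamma>" for q
    using reg g(1,2)[OF that] unfolding neighbourhood_base_of_closedin[symmetric] neighbourhood_base_of by metis
  then obtain W K where WK: "\<And>q. q \<in> \<Gamma> \<Longrightarrow> openin S (W q) \<and> closedin S (K q) \<and> q \<in> W q \<and> W q \<subseteq> K q \<and> K q \<subseteq> O' q"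
    by metis
  have "compactin S \<Gamma>" using compact \<Gamma>_closed by (simp add: closedin_compact_space)
  moreover have "\<forall>X \<in> W ` \<Gamma>. openin S X" "\<Gamma> \<subseteq> \<Union>(W ` \<Gamma>)" using WK by blast+
  ultimately obtain \<F> where "finite \<F>" "\<F> \<subseteq> W ` \<Gamma>" "\<Gamma> \<subseteq> \<Union>\<F>" unfolding compactin_def by blast
  then obtain I where I: "finite I" "I \<subseteq> \<Gamma>" "\<Gamma> \<subseteq> \<Union>(W ` I)" by (metis finite_subset_image)
  define M where "M i j = \<Union>{T. openin S T \<and> T \<subseteq> O' i \<inter> O' j \<and> (\<forall>x \<in> T - \<Gamma>. l i x = l j x)}" for i j
  have Mopen: "openin S (M i j)" for i j unfolding M_def by (rule openin_Union) blast
  have Mval: "l i x = l j x" if "x \<in> M i j" "x \<notin> \<Gamma>" for x i j using that unfolding M_def by blast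
  have M\<Gamma>: "K i \<inter> K j \<inter> \<Gamma> \<subseteq> M i j" if ij: "i \<in> I" "j \<in> I" for i j
  proof
    fix y assume y: "y \<in> K i \<inter> K j \<inter> \<Gamma>"
    have i\<Gamma>: "i \<in> \<Gamma>" "j \<in> \<Gamma>" using I ij by auto
    have yO: "y \<in> O' i" "y \<in> O' j" using y WK[OF i\<Gamma>(1)] WK[OF i\<Gamma>(2)] by blast+
    from y have "y \<in> \<Gamma>" by blast
    then have "near y (\<lambda>x. l i x = l j x)"
    proof (cases rule: in_\<Gamma>_cases)
      case (1 v)
      then have "i = j" using g(4)[OF i\<Gamma>(1)] g(4)[OF i\<Gamma>(2)] yO by metis
      then show ?thesis unfolding near_def using g(1)[OF i\<Gamma>(1)] yO(1) by blast
    next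
      case (2 e t)
      then show ?thesis using germs_agree[OF germs[OF i\<Gamma>(1)] germs[OF i\<Gamma>(2)] 2(1-3)] yO by simp
    qed
    then obtain T where T: "openin S T" "y \<in> T" "\<forall>x \<in> T - \<Gamma>. l i x = l j x" unfolding near_def by blast
    have "openin S (T \<inter> (O' i \<inter> O' j))" using T(1) g(1)[OF i\<Gamma>(1)] g(1)[OF i\<Gamma>(2)] by auto
    then show "y \<in> M i j" unfolding M_def using T yO by blast
  qed
  define bad where "bad = (\<Union>(i,j) \<in> I \<times> I. K i \<inter> K j - M i j)"
  have "closedin S bad" unfolding bad_def
    using I WK Mopen by (intro closedin_Union) (auto intro!: closedin_diff closedin_Int)
  define N where "N = \<Union>(W ` I) - bad"
  have WO: "W i \<subseteq> O' i" "openin S (W i)" if "i \<in> I" for i using WK[of i] I that by blast+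
  have N1: "openin S N" unfolding N_def using WO(2) \<open>closedin S bad\<close> by (intro openin_diff openin_Union) auto
  have N2: "\<Gamma> \<subseteq> N" unfolding N_def bad_def using I(3) M\<Gamma> by blast
  have agree: "l i x = l j x" if "x \<in> N" "x \<notin> \<Gamma>" "i \<in> I" "x \<in> W i" "j \<in> I" "x \<in> W j" for x i j
  proof -
    have "x \<in> K i \<inter> K j" using that WK[of i] WK[of j] I by blast
    then have "x \<in> M i j" using that unfolding N_def bad_def by blast
    then show ?thesis using Mval that by blast
  qed
  define \<Lambda> where "\<Lambda> x = l (SOME i. i \<in> I \<and> x \<in> W i) x" for x
  have \<Lambda>: "\<Lambda> x = l i x" if "x \<in> N" "x \<notin> \<Gamma>" "i \<in> I" "x \<in> W i" for x i
  proof -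
    have "(SOME i. i \<in> I \<and> x \<in> W i) \<in> I \<and> x \<in> W (SOME i. i \<in> I \<and> x \<in> W i)" by (rule someI[of _ i]) (use that in blast)
    then show ?thesis unfolding \<Lambda>_def using agree that by blast
  qed
  show thesis
  proof (rule that[OF N1 N2])
    show "openin S {x \<in> N - \<Gamma>. \<Lambda> x = y}" for y
    proof -
      have eq: "{x \<in> N - \<Gamma>. \<Lambda> x = y} = N \<inter> (\<Union>i\<in>I. W i \<inter> {x \<in> O' i - \<Gamma>. l i x = y})"
      proof
        show "{x \<in> N - \<Gamma>. \<Lambda> x = y} \<subseteq> N \<inter> (\<Union>i\<in>I. W i \<inter> {x \<in> O' i - \<Gamma>. l i x = y})"
        proof
          fix x assume x: "x \<in> {x \<in> N - \<Gamma>. \<Lambda> x = y}"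
          then obtain i where i: "i \<in> I" "x \<in> W i" unfolding N_def by blast
          have xx: "x \<in> N" "x \<notin> \<Gamma>" "\<Lambda> x = y" using x by auto
          have "l i x = y" using \<Lambda>[OF xx(1,2) i] xx(3) by simp
          then have m: "x \<in> W i \<inter> {x \<in> O' i - \<Gamma>. l i x = y}" using i WO(1)[OF i(1)] xx(2) by auto
          show "x \<in> N \<inter> (\<Union>i\<in>I. W i \<inter> {x \<in> O' i - \<Gamma>. l i x = y})" by (rule IntI[OF xx(1)], rule UN_I[OF i(1)], rule m)
        qed
        show "N \<inter> (\<Union>i\<in>I. W i \<inter> {x \<in> O' i - \<Gamma>. l i x = y}) \<subseteq> {x \<in> N - \<Gamma>. \<Lambda> x = y}"
        proof
          fix x assume "x \<in> N \<inter> (\<Union>i\<in>I. W i \<inter> {x \<in> O' i - \<Gamma>. l i x = y})"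
          then obtain i where i: "x \<in> N" "i \<in> I" "x \<in> W i" "x \<notin> \<Gamma>" "l i x = y" by auto
          then show "x \<in> {x \<in> N - \<Gamma>. \<Lambda> x = y}" using \<Lambda>[OF i(1,4,2,3)] by simp
        qed
      qed
      have "openin S (W i \<inter> {x \<in> O' i - \<Gamma>. l i x = y})" if "i \<in> I" for i
        using WO(2)[OF that] g(3)[of i y] I(2) that by (intro openin_Int) auto
      then have "openin S (\<Union>i\<in>I. W i \<inter> {x \<in> O' i - \<Gamma>. l i x = y})" by (intro openin_Union) blast
      then show ?thesis unfolding eq by (rule openin_Int[OF N1])
    qed
    fix e t assume e: "e \<in> parcs G" "0 < t" "t < (1::real)"
    have "c e t \<in> \<Gamma>" using curve_in_\<Gamma>[OF e(1)] e by simp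
    then obtain i where i: "i \<in> I" "c e t \<in> W i" "c e t \<in> N" using I(3) N2 by blast
    have i\<Gamma>: "i \<in> \<Gamma>" using I i by blast
    obtain P where P: "side e t P" "near (c e t) (\<lambda>x. l i x = (if x \<in> P then h e else h (prod.swap e)))"
      using germs[OF i\<Gamma>] e i WO(1)[OF i(1)] unfolding germ_def by blast
    have "near (c e t) (\<lambda>x. \<Lambda> x = (if x \<in> P then h e else h (prod.swap e)))"
      by (rule near_mono[OF near_conj[OF P(2) near_openin[OF openin_Int[OF N1 WO(2)[OF i(1)]]]]])
        (use i \<Lambda> in auto)
    then show "\<exists>P. side e t P \<and> near (c e t) (\<lambda>x. \<Lambda> x = (if x \<in> P then h e else h (prod.swap e)))" using P by blast
  qed
qed

text \<open>Outside a large closed disc, an open disc is a connected annulus. A face is an open disc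
whose end converges to the drawing, hence the locally constant function \<open>\<Lambda>\<close> is
constant on the end of the face.\<close>
lemma face_end:
  assumes F: "F \<in> faces G S p c" and hom: "subtopology S F homeomorphic_space top_of_set (ball (0::complex) 1)"
    and N: "openin S N" "\<Gamma> \<subseteq> N" "\<And>y. openin S {x \<in> N - \<Gamma>. \<Lambda> x = y}"
  shows "\<exists>y K. closedin S K \<and> K \<inter> \<Gamma> = {} \<and> (\<forall>x \<in> F - K. \<Lambda> x = y)"
proof -
  have F\<Gamma>: "F \<subseteq> topspace S - \<Gamma>"
    using connected_components_of_subset[OF F[unfolded faces_def]] by auto
  then have tF: "topspace (subtopology S F) = F" by auto
  obtain g g' where gg: "homeomorphic_maps (subtopology S F) (top_of_set (ball (0::complex) 1)) g g'"
    using hom unfolding homeomorphic_space_def by blast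
  have g: "continuous_map (subtopology S F) (top_of_set (ball 0 1)) g" "continuous_map (top_of_set (ball 0 1)) (subtopology S F) g'"
    "\<And>x. x \<in> F \<Longrightarrow> g' (g x) = x" "\<And>w. w \<in> ball 0 1 \<Longrightarrow> g (g' w) = w"
    using gg tF unfolding homeomorphic_maps_def by auto
  have g'S: "continuous_map (top_of_set (ball 0 1)) S g'"
    using g(2) by (simp add: continuous_map_in_subtopology)
  have g'F: "g' ` ball 0 1 \<subseteq> F"
    using continuous_map_image_subset_topspace[OF g(2)] tF by auto
  have gb: "g ` F \<subseteq> ball 0 1"
    using continuous_map_image_subset_topspace[OF g(1)] tF by auto
  have "closedin S (F - N)"
  proof -
    have "closedin (subtopology S (topspace S - \<Gamma>)) F"
      using F unfolding faces_def by (rule closedin_connected_components_of)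
    then obtain T where T: "closedin S T" "F = T \<inter> (topspace S - \<Gamma>)" unfolding closedin_subtopology by blast
    have "F - N = T \<inter> (topspace S - N)" using T(2) N(2) by blast
    then show ?thesis using T(1) N(1) by auto
  qed
  then have "compactin S (F - N)" using compact by (simp add: closedin_compact_space)
  then have "compactin (subtopology S F) (F - N)" by (simp add: compactin_subtopology)
  from image_compactin[OF this g(1)] have cg: "compact (g ` (F - N))" by (simp add: compactin_subtopology)
  have "\<exists>\<rho><1. g ` (F - N) \<subseteq> cball 0 \<rho>"
  proof (cases "F - N = {}")
    case True then show ?thesis by (intro exI[of _ 0]) auto
  next
    case False
    have ne: "g ` (F - N) \<noteq> {}" using False by blast
    have cn: "continuous_on (g ` (F - N)) (norm :: complex \<Rightarrow> real)" by (intro continuous_intros)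
    obtain w where w: "w \<in> g ` (F - N)" "\<forall>w' \<in> g ` (F - N). norm w' \<le> norm w"
      using continuous_attains_sup[OF cg ne cn] by blast
    have "w \<in> ball 0 1" using w(1) gb by blast
    then show ?thesis using w(2) by (intro exI[of _ "norm w"]) auto
  qed
  then obtain \<rho> where \<rho>: "\<rho> < 1" "g ` (F - N) \<subseteq> cball 0 \<rho>" by blast
  define K where "K = g' ` cball 0 \<rho>"
  define A where "A = g' ` {w. \<rho> < norm (w - 0) \<and> norm (w - 0) < 1}"
  have cb: "cball 0 \<rho> \<subseteq> ball (0::complex) 1" using \<rho>(1) by auto
  have "compactin (top_of_set (ball (0::complex) 1)) (cball 0 \<rho>)" using cb by (simp add: compactin_subtopology)
  from image_compactin[OF this g'S] have "closedin S K"
    unfolding K_def using compactin_imp_closedin[OF hausdorff] by blast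
  moreover have "K \<inter> \<Gamma> = {}" unfolding K_def using cb g'F F\<Gamma> by blast
  moreover have FKA: "F - K \<subseteq> A"
  proof
    fix x assume x: "x \<in> F - K"
    have "g x \<in> ball 0 1" using gb x by blast
    moreover have "g x \<notin> cball 0 \<rho>" using x g(3)[of x] unfolding K_def by (metis DiffD1 DiffD2 imageI)
    ultimately show "x \<in> A" unfolding A_def using g(3)[of x] x by (intro image_eqI[of _ _ "g x"]) auto
  qed
  have AN: "A \<subseteq> N - \<Gamma>"
  proof
    fix x assume "x \<in> A"
    then obtain w where w: "x = g' w" "\<rho> < norm w" "norm w < 1" unfolding A_def by auto
    then have xF: "x \<in> F" "g x = w" using g'F g(4)[of w] by auto
    have "x \<notin> F - N" using xF w \<rho>(2) by fastforce
    then show "x \<in> N - \<Gamma>" using xF F\<Gamma> by blast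
  qed
  have conA: "connectedin S A"
    unfolding A_def
  proof (rule connectedin_continuous_map_image[OF g'S])
    have "topological_space_class.connected {w::complex. \<rho> < norm (w - 0) \<and> norm (w - 0) < 1}" by (rule connected_annulus) simp
    then show "connectedin (top_of_set (ball 0 1)) {w::complex. \<rho> < norm (w - 0) \<and> norm (w - 0) < 1}"
      by (auto simp: connectedin_subtopology)
  qed
  have "\<exists>y. \<forall>x \<in> A. \<Lambda> x = y"
  proof (cases "A = {}")
    case False
    then obtain x0 where x0: "x0 \<in> A" by blast
    let ?E1 = "{x \<in> N - \<Gamma>. \<Lambda> x = \<Lambda> x0}"
    let ?E2 = "\<Union>y \<in> - {\<Lambda> x0}. {x \<in> N - \<Gamma>. \<Lambda> x = y}"
    have "openin S ?E1" "openin S ?E2" using N(3) by auto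
    moreover have "A \<subseteq> ?E1 \<union> ?E2" "?E1 \<inter> ?E2 \<inter> A = {}" "?E1 \<inter> A \<noteq> {}" using AN x0 by auto
    ultimately have "?E2 \<inter> A = {}" using conA unfolding connectedin by blast
    then have "\<forall>x \<in> A. \<Lambda> x = \<Lambda> x0" using AN by blast
    then show ?thesis by blast
  qed simp
  ultimately show ?thesis using FKA by blast
qed

text \<open>Each value of \<open>h\<close> is the value of the glued function next to some edge,
hence the constant value at the end of some face; a face has only one such value.\<close>
lemma labels_le_faces:
  assumes cell: "\<And>F. F \<in> faces G S p c \<Longrightarrow> subtopology S F homeomorphic_space top_of_set (ball (0::complex) 1)"
    and fin: "finite (faces G S p c)"
    and germs: "\<And>q. q \<in> \<Gamma> \<Longrightarrow> \<exists>O' l. germ h q O' l"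
  shows "card (h ` parcs G) \<le> card (faces G S p c)"
proof -
  obtain O' l where Ol: "\<And>q. q \<in> \<Gamma> \<Longrightarrow> germ h q (O' q) (l q)" using germs by metis
  obtain N \<Lambda> where N: "openin S N" "\<Gamma> \<subseteq> N" "\<And>y. openin S {x \<in> N - \<Gamma>. \<Lambda> x = y}"
    "\<And>e t. e \<in> parcs G \<Longrightarrow> 0 < t \<Longrightarrow> t < 1 \<Longrightarrow>
       \<exists>P. side e t P \<and> near (c e t) (\<lambda>x. \<Lambda> x = (if x \<in> P then h e else h (prod.swap e)))"
    by (rule glue_germs[OF Ol]) blast+
  have "\<forall>F \<in> faces G S p c. \<exists>y K. closedin S K \<and> K \<inter> \<Gamma> = {} \<and> (\<forall>x \<in> F - K. \<Lambda> x = y)"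
    using face_end[OF _ cell N(1-3)] by blast
  then obtain val K where vK: "\<And>F. F \<in> faces G S p c \<Longrightarrow> closedin S (K F) \<and> K F \<inter> \<Gamma> = {} \<and> (\<forall>x \<in> F - K F. \<Lambda> x = val F)"
    by metis
  have "h ` parcs G \<subseteq> val ` faces G S p c"
  proof
    fix y assume "y \<in> h ` parcs G"
    then obtain e where e: "e \<in> parcs G" "y = h e" by blast
    obtain P where P: "side e (1/2) P" "near (c e (1/2)) (\<lambda>x. \<Lambda> x = (if x \<in> P then h e else h (prod.swap e)))"
      using N(4)[OF e(1), of "1/2"] by auto
    define T where "T = topspace S - \<Union>(K ` faces G S p c)"
    have "closedin S (\<Union>(K ` faces G S p c))" using vK fin by (intro closedin_Union) auto
    then have T: "openin S T" unfolding T_def by auto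
    have q: "c e (1/2) \<in> \<Gamma>" using curve_in_\<Gamma>[OF e(1), of "1/2"] by simp
    then have "c e (1/2) \<in> T" unfolding T_def using vK \<Gamma>_in by blast
    from near_conj[OF P(2) near_openin[OF T this]]
    have n: "near (c e (1/2)) (\<lambda>x. \<Lambda> x = (if x \<in> P then h e else h (prod.swap e)) \<and> x \<in> T)" .
    have "\<not> near (c e (1/2)) (\<lambda>x. x \<notin> P)" using P(1) unfolding side_def side_in_def both_sides_def by blast
    then obtain x where x: "x \<in> P" "x \<notin> \<Gamma>" "\<Lambda> x = h e" "x \<in> T"
    proof -
      obtain Q where Q: "openin S Q" "c e (1/2) \<in> Q" "\<forall>x \<in> Q - \<Gamma>. \<Lambda> x = (if x \<in> P then h e else h (prod.swap e)) \<and> x \<in> T"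
        using n unfolding near_def by blast
      assume "\<not> near (c e (1/2)) (\<lambda>x. x \<notin> P)"
      then obtain x where "x \<in> Q - \<Gamma>" "x \<in> P" using Q(1,2) unfolding near_def by blast
      then show ?thesis using that[of x] Q(3) by auto
    qed
    have "x \<in> topspace (subtopology S (topspace S - \<Gamma>))" using x T openin_subset by fastforce
    then obtain F where F: "F \<in> faces G S p c" "x \<in> F"
      unfolding faces_def using Union_connected_components_of[of "subtopology S (topspace S - \<Gamma>)"] by blast
    then have "x \<in> F - K F" using x(4) unfolding T_def by blast
    then have "val F = h e" using vK[OF F(1)] x(3) by auto
    then show "y \<in> val ` faces G S p c" unfolding e(2) by (rule image_eqI[OF sym F(1)])
  qed
  then have "card (h ` parcs G) \<le> card (val ` faces G S p c)" using fin by (intro card_mono) auto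
  also have "\<dots> \<le> card (faces G S p c)" using fin by (rule card_image_le)
  finally show ?thesis .
qed


text \<open>The permutation \<open>f\<close> sends an arc that enters a vertex to the next arc in
the rotation there. The last clause says that \<open>f\<close> has at most as many orbits as the
embedding has faces, expressed by functions that are constant on orbits. This is the only fact about
embeddings that is used later.\<close>
lemma face_tracing:
  assumes cubic: "\<And>v. v \<in> pverts G \<Longrightarrow> card (out v) = 3"
    and cell: "\<And>F. F \<in> faces G S p c \<Longrightarrow> subtopology S F homeomorphic_space top_of_set (ball (0::complex) 1)"
    and fin: "finite (faces G S p c)"
  shows "\<exists>f. f ` parcs G \<subseteq> parcs G \<and> inj_on f (parcs G) \<and>
    (\<forall>a \<in> parcs G. fst (f a) = snd a \<and> f a \<noteq> prod.swap a) \<and>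
    (\<forall>h :: 'v \<times> 'v \<Rightarrow> nat. (\<forall>a \<in> parcs G. h (f a) = h a) \<longrightarrow> card (h ` parcs G) \<le> card (faces G S p c))"
proof -
  have "\<exists>e1 e2 e3. out v = {e1,e2,e3} \<and> e1 \<noteq> e2 \<and> e2 \<noteq> e3 \<and> e1 \<noteq> e3 \<and>
     (\<exists>O' C1 C2 C3. vertex_germ v e1 e2 e3 O' C1 C2 C3)" if "v \<in> pverts G" for v
    using vertex_germ_exists[OF that cubic[OF that]] by blast
  then obtain x y z where xyz: "\<And>v. v \<in> pverts G \<Longrightarrow> out v = {x v, y v, z v} \<and> x v \<noteq> y v \<and> y v \<noteq> z v \<and> x v \<noteq> z v \<and>
     (\<exists>O' C1 C2 C3. vertex_germ v (x v) (y v) (z v) O' C1 C2 C3)" by metis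
  define f where "f a = (let v = snd a; b = prod.swap a in if b = x v then z v else if b = y v then x v else y v)" for a
  have sw: "prod.swap a \<in> out (snd a)" if "a \<in> parcs G" for a using swap_arc[OF that] by (simp add: out_def)
  have f_out: "f a \<in> out (snd a)" and f_ne: "f a \<noteq> prod.swap a" if a: "a \<in> parcs G" for a
    using xyz[OF arc_ends(2)[OF a]] sw[OF a] by (auto simp: f_def Let_def)
  have inj: "inj_on f (parcs G)"
  proof (rule inj_onI)
    fix a b assume ab: "a \<in> parcs G" "b \<in> parcs G" "f a = f b"
    then have s: "snd a = snd b" using outD(2)[OF f_out[OF ab(1)]] outD(2)[OF f_out[OF ab(2)]] by simp
    have "prod.swap a = prod.swap b"
      using xyz[OF arc_ends(2)[OF ab(1)]] sw[OF ab(1)] sw[OF ab(2)] ab(3) s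
      by (auto simp: f_def Let_def split: if_splits)
    then show "a = b" by (metis swap_swap)
  qed
  have germs: "\<exists>O' l. germ h q O' l" if h: "\<forall>a \<in> parcs G. h (f a) = h a" and q: "q \<in> \<Gamma>" for h :: "'v \<times> 'v \<Rightarrow> nat" and q
    using q
  proof (cases rule: in_\<Gamma>_cases)
    case (1 v)
    obtain O' C1 C2 C3 where g: "vertex_germ v (x v) (y v) (z v) O' C1 C2 C3" using xyz[OF 1(1)] by blast
    have o: "x v \<in> out v" "y v \<in> out v" "z v \<in> out v" using xyz[OF 1(1)] by auto
    have hh: "h (prod.swap e) = h (f (prod.swap e))" if "e \<in> out v" for e
      using h swap_arc[OF outD(1)[OF that]] by simp
    have fs: "f (prod.swap (x v)) = z v" "f (prod.swap (y v)) = x v" "f (prod.swap (z v)) = y v"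
      using outD(2)[OF o(1)] outD(2)[OF o(2)] outD(2)[OF o(3)] xyz[OF 1(1)] by (auto simp: f_def Let_def)
    have "germ h (p v) O' (\<lambda>w. if w \<in> C1 then h (x v) else if w \<in> C2 then h (y v) else h (z v))"
      by (rule vertex_germ_label[OF g outD(1)[OF o(1)] outD(1)[OF o(2)] outD(1)[OF o(3)]])
        (use hh[OF o(1)] hh[OF o(2)] hh[OF o(3)] fs in simp_all)
    then show ?thesis using 1 by blast
  next
    case (2 e t)
    then show ?thesis using edge_germ_label[OF 2(1-3)] by blast
  qed
  have "card (h ` parcs G) \<le> card (faces G S p c)" if h: "\<forall>a \<in> parcs G. h (f a) = h a" for h :: "'v \<times> 'v \<Rightarrow> nat"
    by (rule labels_le_faces[OF cell fin]) (use germs[OF h] in auto)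
  moreover have "f ` parcs G \<subseteq> parcs G" using f_out outD(1) by blast
  moreover have "fst (f a) = snd a" if "a \<in> parcs G" for a using outD(2)[OF f_out[OF that]] .
  ultimately show ?thesis using inj f_ne by blast
qed

end

section \<open>Closed face words and spanning trees with paired cotree edges\<close>

text \<open>A tree grown leaf by leaf, as a symmetric set of arcs.\<close>
inductive tree_on :: "'v set \<Rightarrow> ('v \<times> 'v) set \<Rightarrow> bool" where
  single: "tree_on {r} {}"
| leaf: "tree_on V T \<Longrightarrow> u \<in> V \<Longrightarrow> v \<notin> V \<Longrightarrow> tree_on (insert v V) (insert (u,v) (insert (v,u) T))"

lemma tree_on_basic:
  assumes "tree_on V T"
  shows "finite V \<and> V \<noteq> {} \<and> T \<subseteq> V \<times> V \<and> (\<forall>a \<in> T. prod.swap a \<in> T)"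
  using assms by induction auto

lemma tree_on_neighbour:
  assumes "tree_on V T" "v \<in> V" "w \<in> V" "v \<noteq> w"
  shows "\<exists>y. (v,y) \<in> T"
  using assms
proof (induction arbitrary: w)
  case (leaf V T u x)
  show ?case
  proof (cases "v = x \<or> v = u")
    case False
    then have vV: "v \<in> V" using leaf by auto
    then have "u \<noteq> v" using False by auto
    then show ?thesis using leaf.IH[OF vV leaf.hyps(2)] False by auto
  qed auto
qed auto

lemma tree_on_remove_leaf:
  assumes "tree_on V T" "v \<in> V" "w \<in> V" "v \<noteq> w" "\<And>y y'. (v,y) \<in> T \<Longrightarrow> (v,y') \<in> T \<Longrightarrow> y = y'"
  shows "tree_on (V - {v}) (T \<inter> (V - {v}) \<times> (V - {v}))"
  using assms
proof (induction arbitrary: w)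
  case (leaf V T u x)
  note B = tree_on_basic[OF leaf.hyps(1)]
  let ?T = "insert (u,x) (insert (x,u) T)"
  show ?case
  proof (cases "v = x")
    case True
    have "insert x V - {v} = V" "?T \<inter> V \<times> V = T" using True leaf.hyps B by auto
    then show ?thesis using leaf.hyps(1) by simp
  next
    case vx: False
    show ?thesis
    proof (cases "v = u")
      case True
      have "\<not> (\<exists>y. (v,y) \<in> T)"
      proof
        assume "\<exists>y. (v,y) \<in> T"
        then obtain y where "(v,y) \<in> T" by blast
        then have "y = x" using leaf.prems(4)[of y x] True by blast
        then show False using \<open>(v,y) \<in> T\<close> B leaf.hyps(3) by blast
      qed
      then have "V \<subseteq> {v}" using tree_on_neighbour[OF leaf.hyps(1)] leaf.hyps(2) True by blast
      then have V: "V = {v}" using leaf.hyps(2) True by blast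
      have "T \<subseteq> {(v,v)}" using B V by auto
      then have "T = {}" using \<open>\<not> (\<exists>y. (v,y) \<in> T)\<close> by blast
      then show ?thesis using V True vx by (simp add: insert_Diff_if tree_on.single)
    next
      case vu: False
      have vV: "v \<in> V" using leaf.prems(1) vx by simp
      have IH: "tree_on (V - {v}) (T \<inter> (V - {v}) \<times> (V - {v}))"
        using leaf.IH[OF vV leaf.hyps(2) vu] leaf.prems(4) by blast
      have "tree_on (insert x (V - {v})) (insert (u,x) (insert (x,u) (T \<inter> (V - {v}) \<times> (V - {v}))))"
        using tree_on.leaf[OF IH, of u x] leaf.hyps vu by auto
      moreover have "insert x V - {v} = insert x (V - {v})" using vx by auto
      moreover have "?T \<inter> (insert x (V - {v})) \<times> (insert x (V - {v})) = insert (u,x) (insert (x,u) (T \<inter> (V - {v}) \<times> (V - {v})))"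
        using leaf.hyps(2,3) vu B by auto
      ultimately show ?thesis by simp
    qed
  qed
qed auto

lemma tree_on_two_leaves:
  assumes t: "tree_on V T" and uv: "(u,v) \<in> T" "u \<noteq> v"
    and leaf: "\<And>y y'. (u,y) \<in> T \<Longrightarrow> (u,y') \<in> T \<Longrightarrow> y = y'" "\<And>y y'. (v,y) \<in> T \<Longrightarrow> (v,y') \<in> T \<Longrightarrow> y = y'"
  shows "V = {u,v}"
proof -
  note B = tree_on_basic[OF t]
  have V: "u \<in> V" "v \<in> V" "(v,u) \<in> T" using uv B by auto
  have t': "tree_on (V - {u}) (T \<inter> (V - {u}) \<times> (V - {u}))"
    using tree_on_remove_leaf[OF t V(1,2) uv(2) leaf(1)] .
  have "w = v" if w: "w \<in> V - {u}" for w
  proof (rule ccontr)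
    assume "w \<noteq> v"
    then obtain y where "(v,y) \<in> T \<inter> (V - {u}) \<times> (V - {u})"
      using tree_on_neighbour[OF t', of v w] V uv w by auto
    then show False using leaf(2)[of y u] V(3) by blast
  qed
  then show ?thesis using V by blast
qed

text \<open>Pairwise nonadjacent leaves can be removed at the same time.\<close>
lemma tree_on_remove_leaves:
  assumes "finite L" "tree_on V T" "L \<subseteq> K" "K \<subseteq> V"
    "\<And>v y y'. v \<in> K \<Longrightarrow> (v,y) \<in> T \<Longrightarrow> (v,y') \<in> T \<Longrightarrow> y = y'"
    "\<And>v. v \<in> K \<Longrightarrow> \<exists>y. y \<notin> K \<and> (v,y) \<in> T"
  shows "tree_on (V - L) (T \<inter> (V - L) \<times> (V - L))"
  using assms
proof (induction L rule: finite_induct)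
  case empty
  have "T \<inter> V \<times> V = T" using tree_on_basic[OF empty.prems(1)] by blast
  then show ?case using empty by simp
next
  case (insert v L)
  have IH: "tree_on (V - L) (T \<inter> (V - L) \<times> (V - L))" using insert by blast
  have vK: "v \<in> K" "v \<in> V - L" using insert by auto
  obtain y where y: "y \<notin> K" "(v,y) \<in> T" using insert.prems(5)[OF vK(1)] by blast
  have yV: "y \<in> V - L" "v \<noteq> y" using y tree_on_basic[OF insert.prems(1)] insert.prems(2) vK by auto
  have "tree_on (V - L - {v}) (T \<inter> (V - L) \<times> (V - L) \<inter> (V - L - {v}) \<times> (V - L - {v}))"
    using tree_on_remove_leaf[OF IH vK(2) yV] insert.prems(4)[OF vK(1)] by blast
  moreover have "V - L - {v} = V - insert v L" by blast
  moreover have "T \<inter> (V - L) \<times> (V - L) \<inter> (V - insert v L) \<times> (V - insert v L) = T \<inter> (V - insert v L) \<times> (V - insert v L)" by blast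
  ultimately show ?case by simp
qed

text \<open>The pairs of consecutive letters of a word, read linearly and below cyclically. Both are
sets of pairs so that cutting and joining words becomes a set computation.\<close>
fun lin :: "'a list \<Rightarrow> ('a \<times> 'a) set" where
  "lin (x # y # zs) = insert (x,y) (lin (y # zs))"
| "lin _ = {}"

definition cyc :: "'a list \<Rightarrow> ('a \<times> 'a) set" where "cyc W = (case W of [] \<Rightarrow> {} | x # xs \<Rightarrow> lin (x # xs @ [x]))"

lemma lin_append: "lin (xs @ y # ys) = lin (xs @ [y]) \<union> lin (y # ys)"
proof (induction xs)
  case (Cons x xs)
  then show ?case by (cases xs) auto
qed simp

lemma lin_zip: "lin xs = set (zip xs (tl xs))"
  by (induction xs rule: lin.induct) auto

lemma cyc_zip: "cyc W = set (zip W (rotate1 W))"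
proof (cases W)
  case (Cons x xs)
  have "zip ((x # xs) @ [x]) (xs @ [x]) = zip (x # xs) (xs @ [x])" unfolding zip_append1 by simp
  then show ?thesis using Cons by (simp add: cyc_def lin_zip)
qed (simp add: cyc_def)

lemma cyc_rotate: "cyc (xs @ ys) = cyc (ys @ xs)"
proof (cases xs)
  case (Cons a as)
  show ?thesis
  proof (cases ys)
    case (Cons b bs)
    have "cyc (xs @ ys) = lin ((a # as) @ b # (bs @ [a]))" using \<open>xs = a # as\<close> Cons by (simp add: cyc_def)
    also have "\<dots> = lin ((a # as) @ [b]) \<union> lin ((b # bs) @ [a])" using lin_append[of "a # as" b "bs @ [a]"] by simp
    also have "\<dots> = lin ((b # bs) @ a # (as @ [b]))" using lin_append[of "b # bs" a "as @ [b]"] by auto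
    also have "\<dots> = cyc (ys @ xs)" using \<open>xs = a # as\<close> Cons by (simp add: cyc_def)
    finally show ?thesis .
  qed simp
qed simp

lemma cyc_functional:
  assumes "distinct W"
  shows "(a,b) \<in> cyc W \<Longrightarrow> (a,b') \<in> cyc W \<Longrightarrow> b = b'" "(a,b) \<in> cyc W \<Longrightarrow> (a',b) \<in> cyc W \<Longrightarrow> a = a'"
    "(a,b) \<in> cyc W \<Longrightarrow> a \<in> set W \<and> b \<in> set W"
    "b \<in> set W \<Longrightarrow> \<exists>a. (a,b) \<in> cyc W" "a \<in> set W \<Longrightarrow> \<exists>b. (a,b) \<in> cyc W"
proof -
  have l: "length (rotate1 W) = length W" by simp
  show "(a,b) \<in> cyc W \<Longrightarrow> (a,b') \<in> cyc W \<Longrightarrow> b = b'"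
    unfolding cyc_zip by (rule eq_key_imp_eq_value[of "zip W (rotate1 W)"]) (use assms l in auto)
  show "(a,b) \<in> cyc W \<Longrightarrow> (a',b) \<in> cyc W \<Longrightarrow> a = a'"
  proof -
    have sw: "(x,y) \<in> set (zip W (rotate1 W)) \<Longrightarrow> (y,x) \<in> set (zip (rotate1 W) W)" for x y
      by (subst zip_commute) auto
    show "(a,b) \<in> cyc W \<Longrightarrow> (a',b) \<in> cyc W \<Longrightarrow> a = a'"
      unfolding cyc_zip
      by (rule eq_key_imp_eq_value[of "zip (rotate1 W) W" b]) (use assms l sw in auto)
  qed
  show "(a,b) \<in> cyc W \<Longrightarrow> a \<in> set W \<and> b \<in> set W"
    unfolding cyc_zip using set_zip_leftD set_zip_rightD by fastforce
  show "b \<in> set W \<Longrightarrow> \<exists>a. (a,b) \<in> cyc W"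
  proof -
    assume "b \<in> set W"
    then have "b \<in> snd ` set (zip W (rotate1 W))" using l by (metis map_snd_zip set_map set_rotate1)
    then show ?thesis unfolding cyc_zip by force
  qed
  show "a \<in> set W \<Longrightarrow> \<exists>b. (a,b) \<in> cyc W"
  proof -
    assume "a \<in> set W"
    then have "a \<in> fst ` set (zip W (rotate1 W))" using l by (metis map_fst_zip set_map)
    then show ?thesis unfolding cyc_zip by force
  qed
qed

abbreviation star :: "('v \<times> 'v) set \<Rightarrow> 'v \<Rightarrow> ('v \<times> 'v) set" where "star D v \<equiv> {a \<in> D. fst a = v}"

lemma card_le3_distinct4:
  assumes "finite X" "card X \<le> 3" "{a,b,c,d} \<subseteq> X" "a \<noteq> b" "a \<noteq> c" "b \<noteq> c" shows "d \<in> {a,b,c}"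
proof (rule ccontr)
  assume "d \<notin> {a,b,c}"
  then have "card {a,b,c,d} = 4" using assms(4-6) by auto
  then show False using card_mono[OF assms(1,3)] assms(2) by simp
qed

text \<open>If \<open>x\<close> is followed by \<open>e\<close>, and the reverse of \<open>e\<close>
by the reverse of \<open>x\<close>, then a third arc at the vertex could only be preceded by its own
reverse; but such a turn is possible at a vertex of degree one only.\<close>
lemma backtrack_degree_two:
  assumes R: "\<And>a b b'. (a,b) \<in> R \<Longrightarrow> (a,b') \<in> R \<Longrightarrow> b = b'" "\<And>a b. (a,b) \<in> R \<Longrightarrow> a \<in> D \<and> b \<in> D \<and> snd a = fst b"
      "\<And>b. b \<in> D \<Longrightarrow> \<exists>a. (a,b) \<in> R"
    and D: "finite D" "\<And>a. a \<in> D \<Longrightarrow> prod.swap a \<in> D" "\<And>v. card (star D v) \<le> 3"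
    and bt: "\<And>a. (a, prod.swap a) \<in> R \<Longrightarrow> star D (snd a) \<subseteq> {prod.swap a}"
    and x: "(x,e) \<in> R" "(prod.swap e, prod.swap x) \<in> R"
  shows "star D (fst e) \<subseteq> {e, prod.swap x}"
proof
  fix z assume z: "z \<in> star D (fst e)"
  show "z \<in> {e, prod.swap x}"
  proof (rule ccontr)
    assume nz: "z \<notin> {e, prod.swap x}"
    have ex: "e \<in> D" "prod.swap x \<in> D" "snd x = fst e" using R(2)[OF x(1)] D(2) by auto
    have "e \<noteq> prod.swap x"
    proof
      assume "e = prod.swap x"
      then have "star D (snd x) \<subseteq> {e}" using bt[of x] x(1) by simp
      then show False using z nz ex by auto
    qed
    obtain a where a: "(a,z) \<in> R" using R(3) z by blast
    have a': "prod.swap a \<in> star D (fst e)" using R(2)[OF a] D(2) z by auto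
    have "prod.swap a \<in> {e, prod.swap x, z}"
      by (rule card_le3_distinct4[of "star D (fst e)"])
        (use D(1,3) z nz a' ex \<open>e \<noteq> prod.swap x\<close> in auto)
    then consider "a = prod.swap e" | "a = x" | "a = prod.swap z" by (metis insertE singletonD swap_swap)
    then show False
    proof cases
      case 1 then show False using R(1)[OF a, of "prod.swap x"] x nz by simp
    next
      case 2 then show False using R(1)[OF a, of e] x nz by simp
    next
      case 3
      then have "star D (snd a) \<subseteq> {z}" using bt[of a] a by simp
      moreover have "snd a = fst e" using 3 z by simp
      ultimately show False using ex nz by auto
    qed
  qed
qed

text \<open>The facial walk of a one-face embedding, without the surface: a cyclic word that
contains every arc once. It may turn around only at a vertex of degree one. The surface itself is
never reconstructed.\<close>
definition face_word :: "('v \<times> 'v) list \<Rightarrow> bool" where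
  "face_word W \<longleftrightarrow> distinct W \<and> (\<forall>a \<in> set W. prod.swap a \<in> set W \<and> fst a \<noteq> snd a) \<and>
     (\<forall>a b. (a,b) \<in> cyc W \<longrightarrow> snd a = fst b) \<and>
     (\<forall>a. (a, prod.swap a) \<in> cyc W \<longrightarrow> star (set W) (snd a) \<subseteq> {prod.swap a}) \<and>
     (\<forall>v. card (star (set W) v) \<le> 3)"

lemma face_wordD:
  assumes "face_word W"
  shows "distinct W" "a \<in> set W \<Longrightarrow> prod.swap a \<in> set W" "a \<in> set W \<Longrightarrow> fst a \<noteq> snd a"
    "(a,b) \<in> cyc W \<Longrightarrow> snd a = fst b" "(a, prod.swap a) \<in> cyc W \<Longrightarrow> star (set W) (snd a) \<subseteq> {prod.swap a}"
    "card (star (set W) v) \<le> 3"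
  using assms unfolding face_word_def by blast+

lemma face_word_rotate: "face_word (xs @ ys) \<longleftrightarrow> face_word (ys @ xs)"
  unfolding face_word_def cyc_rotate[of xs ys] by (auto simp: Un_commute)

lemma face_word_degree_two:
  assumes W: "face_word W" and x: "(x,e) \<in> cyc W" "(prod.swap e, prod.swap x) \<in> cyc W"
  shows "star (set W) (fst e) \<subseteq> {e, prod.swap x}"
proof (rule backtrack_degree_two[of "cyc W" "set W" x e])
  note F = face_wordD[OF W] and C = cyc_functional[OF face_wordD(1)[OF W]]
  show "\<And>a b b'. (a,b) \<in> cyc W \<Longrightarrow> (a,b') \<in> cyc W \<Longrightarrow> b = b'" using C(1) .
  show "\<And>a b. (a,b) \<in> cyc W \<Longrightarrow> a \<in> set W \<and> b \<in> set W \<and> snd a = fst b" using C(3) F(4) by blast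
  show "\<And>b. b \<in> set W \<Longrightarrow> \<exists>a. (a,b) \<in> cyc W" using C(4) .
  show "\<And>a. a \<in> set W \<Longrightarrow> prod.swap a \<in> set W" using F(2) .
  show "\<And>v. card (star (set W) v) \<le> 3" using F(6) .
  show "\<And>a. (a, prod.swap a) \<in> cyc W \<Longrightarrow> star (set W) (snd a) \<subseteq> {prod.swap a}" using F(5) .
qed (use x in auto)

text \<open>The set \<open>T\<close> is a spanning tree and the cotree edges are matched into pairs
of adjacent edges that are centred at the vertices of \<open>K\<close>. In a cubic graph this is
Xuong's description of one-face embeddability.\<close>
definition spanning_pairing :: "('v \<times> 'v) set \<Rightarrow> ('v \<times> 'v) set \<Rightarrow> 'v set \<Rightarrow> bool" where
  "spanning_pairing D T K \<longleftrightarrow> T \<subseteq> D \<and> tree_on (fst ` D) T \<and> K \<subseteq> fst ` D \<and>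
     (\<forall>v \<in> K. 2 \<le> card (star (D - T) v)) \<and>
     (\<forall>a \<in> D - T. fst a \<in> K \<or> snd a \<in> K) \<and>
     (\<forall>u \<in> K. \<forall>v \<in> K. (u,v) \<notin> D - T)"


lemma lin_snoc: "xs \<noteq> [] \<Longrightarrow> lin (xs @ [y]) = insert (last xs, y) (lin xs)"
proof (induction xs)
  case (Cons x xs) then show ?case by (cases xs) auto
qed simp

lemma lin_sub: "lin ys \<subseteq> lin (xs @ ys @ zs)"
proof -
  have 1: "lin ys \<subseteq> lin (xs @ ys)" for xs ys :: "'a list"
  proof (cases ys)
    case (Cons y ys') then show ?thesis using lin_append[of xs y ys'] by auto
  qed simp
  have 2: "lin ys \<subseteq> lin (ys @ zs)"
  proof (cases zs)
    case (Cons z zs')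
    then show ?thesis using lin_append[of ys z zs'] lin_snoc[of ys z] by (cases "ys = []") auto
  qed simp
  show ?thesis using 1[of "ys @ zs" xs] 2 by blast
qed

lemma cyc_two:
  assumes "xs \<noteq> []" "ys \<noteq> []"
  shows "cyc (xs @ ys) = lin xs \<union> lin ys \<union> {(last xs, hd ys), (last ys, hd xs)}"
proof -
  have "cyc (xs @ ys) = lin (xs @ hd ys # (tl ys @ [hd xs]))" using assms by (cases xs; cases ys) (auto simp: cyc_def)
  also have "\<dots> = lin (xs @ [hd ys]) \<union> lin (ys @ [hd xs])"
    using lin_append[of xs "hd ys" "tl ys @ [hd xs]"] assms by (cases ys) auto
  finally show ?thesis using assms by (auto simp: lin_snoc)
qed

lemma lin_two: "xs \<noteq> [] \<Longrightarrow> ys \<noteq> [] \<Longrightarrow> lin (xs @ ys) = insert (last xs, hd ys) (lin xs \<union> lin ys)"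
  using lin_append[of xs "hd ys" "tl ys"] by (cases ys) (auto simp: lin_snoc)

lemma cyc_one: "xs \<noteq> [] \<Longrightarrow> cyc xs = insert (last xs, hd xs) (lin xs)"
  using lin_snoc[of xs "hd xs"] by (cases xs) (auto simp: cyc_def)

lemma cyc_three:
  assumes "xs \<noteq> []" "ys \<noteq> []" "zs \<noteq> []"
  shows "cyc (xs @ ys @ zs) = lin xs \<union> lin ys \<union> lin zs \<union> {(last xs, hd ys), (last ys, hd zs), (last zs, hd xs)}"
  using assms by (auto simp: cyc_two lin_two)

lemma cyc_junction: "W = xs @ ys \<Longrightarrow> xs \<noteq> [] \<Longrightarrow> ys \<noteq> [] \<Longrightarrow> (last xs, hd ys) \<in> cyc W"
  by (simp add: cyc_two)

lemma lin_in_cyc: "W = xs @ ys @ zs \<Longrightarrow> lin ys \<subseteq> cyc W"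
proof (cases "W = []")
  case False
  assume "W = xs @ ys @ zs"
  then have "lin ys \<subseteq> lin W" using lin_sub by blast
  then show ?thesis using cyc_one[OF False] by blast
qed simp

text \<open>Deleting the two edges \<open>e\<close> and \<open>d\<close>, which are consecutive and
interleaved in the word, leaves the three pieces \<open>A\<close>, \<open>B1\<close> and
\<open>B2\<close>. In the order \<open>A\<close>, \<open>B2\<close>, \<open>B1\<close> their ends
fit together again, hence the smaller graph has one face, too.\<close>
lemma face_word_delete_pair:
  fixes e d :: "'v \<times> 'v"
  assumes W: "face_word W" and Weq: "W = e # d # A @ prod.swap e # B1 @ prod.swap d # B2"
  shows "A \<noteq> [] \<and> B1 \<noteq> [] \<and> B2 \<noteq> [] \<and> snd e = fst d \<and> fst (hd A) = snd d \<and> fst (hd B1) = fst e \<and> fst (hd B2) = snd e \<and>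
    face_word (A @ B2 @ B1)"
proof -
  let ?e = "prod.swap e" and ?d = "prod.swap d"
  note F = face_wordD[OF W]
  have mem: "e \<in> set W" "d \<in> set W" "?e \<in> set W" "?d \<in> set W" using Weq by auto
  have dist: "distinct (e # d # A @ ?e # B1 @ ?d # B2)" using F(1) Weq by simp
  have p1: "(e,d) \<in> cyc W" using cyc_junction[of W "[e]" "d # A @ ?e # B1 @ ?d # B2"] Weq by simp
  have p2: "(d, hd (A @ [?e])) \<in> cyc W" using cyc_junction[of W "[e,d]" "A @ ?e # B1 @ ?d # B2"] Weq by (cases A) auto
  have p3: "(last (d # A), ?e) \<in> cyc W" using cyc_junction[of W "e # d # A" "?e # B1 @ ?d # B2"] Weq by simp
  have p4: "(?e, hd (B1 @ [?d])) \<in> cyc W" using cyc_junction[of W "e # d # A @ [?e]" "B1 @ ?d # B2"] Weq by (cases B1) auto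
  have p5: "(last (?e # B1), ?d) \<in> cyc W" using cyc_junction[of W "e # d # A @ ?e # B1" "?d # B2"] Weq by (cases B1) auto
  have p6: "(?d, hd (B2 @ [e])) \<in> cyc W"
  proof (cases B2)
    case Nil
    then show ?thesis using cyc_one[of W] Weq by simp
  next
    case (Cons b bs)
    then show ?thesis using cyc_junction[of W "e # d # A @ ?e # B1 @ [?d]" B2] Weq by simp
  qed
  have p7: "(last (?d # B2), e) \<in> cyc W" using cyc_one[of W] Weq by (cases B2) auto
  have ed: "snd e = fst d" using F(4)[OF p1] .
  have A: "A \<noteq> []"
  proof
    assume "A = []"
    then have "snd d = snd e" using F(4)[OF p2] by simp
    then show False using ed F(3)[OF mem(2)] by simp
  qed
  have B1: "B1 \<noteq> []"
  proof
    assume "B1 = []"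
    then have "fst e = snd d" using F(4)[OF p4] by simp
    then have "d = ?e" using ed by (simp add: prod_eq_iff)
    then show False using dist by simp
  qed
  have B2: "B2 \<noteq> []"
  proof
    assume "B2 = []"
    then have "fst d = fst e" using F(4)[OF p6] by simp
    then show False using ed F(3)[OF mem(1)] by simp
  qed
  have q: "(d, hd A) \<in> cyc W" "(last A, ?e) \<in> cyc W" "(?e, hd B1) \<in> cyc W" "(last B1, ?d) \<in> cyc W"
    "(?d, hd B2) \<in> cyc W" "(last B2, e) \<in> cyc W" using p2 p3 p4 p5 p6 p7 A B1 B2 by auto
  let ?W = "A @ B2 @ B1"
  have set': "set ?W = set W - {e, d, ?e, ?d}" using dist Weq by auto
  have heads: "fst (hd A) = snd d" "fst (hd B1) = fst e" "fst (hd B2) = snd e"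
    using F(4)[OF q(1)] F(4)[OF q(3)] F(4)[OF q(5)] ed by auto
  have lasts: "snd (last A) = snd e" "snd (last B1) = snd d" "snd (last B2) = fst e"
    using F(4)[OF q(2)] F(4)[OF q(4)] F(4)[OF q(6)] by auto
  have lins: "lin A \<subseteq> cyc W" "lin B1 \<subseteq> cyc W" "lin B2 \<subseteq> cyc W"
    using lin_in_cyc[of W "[e,d]" A] lin_in_cyc[of W "e # d # A @ [?e]" B1] lin_in_cyc[of W "e # d # A @ ?e # B1 @ [?d]" B2 "[]"] Weq
    by auto
  have cyc': "cyc ?W = lin A \<union> lin B2 \<union> lin B1 \<union> {(last A, hd B2), (last B2, hd B1), (last B1, hd A)}"
    by (rule cyc_three[OF A B2 B1])
  have hdin: "hd A \<in> set A" "hd B1 \<in> set B1" "hd B2 \<in> set B2" using A B1 B2 by auto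
  have "face_word ?W"
    unfolding face_word_def
  proof (intro conjI allI impI ballI)
    show "distinct ?W" using dist by auto
    fix a assume a: "a \<in> set ?W"
    show "fst a \<noteq> snd a" using F(3) a set' by blast
    have "prod.swap a \<in> set W" using F(2) a set' by blast
    moreover have "a \<notin> {e, d, ?e, ?d}" using a set' by blast
    then have "prod.swap a \<notin> {e, d, ?e, ?d}" by (cases a; cases e; cases d) auto
    ultimately show "prod.swap a \<in> set ?W" using set' by blast
  next
    fix a b assume "(a,b) \<in> cyc ?W"
    then consider "(a,b) \<in> cyc W" | "a = last A" "b = hd B2" | "a = last B2" "b = hd B1" | "a = last B1" "b = hd A"
      unfolding cyc' using lins by auto
    then show "snd a = fst b" using heads lasts F(4) by cases auto
  next
    fix a assume "(a, prod.swap a) \<in> cyc ?W"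
    then consider "(a, prod.swap a) \<in> cyc W" | "a = last A" "prod.swap a = hd B2"
      | "a = last B2" "prod.swap a = hd B1" | "a = last B1" "prod.swap a = hd A"
      unfolding cyc' using lins by auto
    then show "star (set ?W) (snd a) \<subseteq> {prod.swap a}"
    proof cases
      case 1 then show ?thesis using F(5) set' by blast
    next
      case 2
      have "z \<in> {?e, d, hd B2}" if "z \<in> star (set W) (snd e)" for z
        by (rule card_le3_distinct4[of "star (set W) (snd e)"])
          (use F(6) that mem ed heads hdin set' dist in auto)
      then show ?thesis using 2 lasts(1) set' by auto
    next
      case 3
      then have "star (set W) (fst e) \<subseteq> {e, prod.swap a}" using face_word_degree_two[OF W, of a e] q(3,6) by simp
      then show ?thesis using 3 lasts(3) set' by auto
    next
      case 4
      then have "star (set W) (fst ?d) \<subseteq> {?d, prod.swap a}" using face_word_degree_two[OF W, of a ?d] q(1,4) by simp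
      then show ?thesis using 4 lasts(2) set' by auto
    qed
  next
    fix v
    have "card (star (set ?W) v) \<le> card (star (set W) v)" by (rule card_mono) (use set' in auto)
    then show "card (star (set ?W) v) \<le> 3" using F(6)[of v] by simp
  qed
  then show ?thesis using A B1 B2 ed heads by blast
qed

text \<open>If \<open>e\<close> is followed at once by its reverse, the walk turns around, so that
the edge leads to a vertex of degree one and can be pruned.\<close>
lemma face_word_delete_leaf:
  fixes e :: "'v \<times> 'v"
  assumes W: "face_word W" and Weq: "W = e # prod.swap e # B" and B: "B \<noteq> []"
  shows "face_word B \<and> star (set W) (snd e) \<subseteq> {prod.swap e} \<and> fst (hd B) = fst e"
proof -
  let ?e = "prod.swap e"
  note F = face_wordD[OF W]
  have dist: "distinct (e # ?e # B)" using F(1) Weq by simp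
  have q: "(e,?e) \<in> cyc W" "(?e, hd B) \<in> cyc W" "(last B, e) \<in> cyc W"
    using cyc_junction[of W "[e]" "?e # B"] cyc_junction[of W "[e,?e]" B] cyc_one[of W] Weq B by auto
  have lins: "lin B \<subseteq> cyc W" using lin_in_cyc[of W "[e,?e]" B "[]"] Weq by simp
  have cyc': "cyc B = insert (last B, hd B) (lin B)" using cyc_one[OF B] .
  have set': "set B = set W - {e, ?e}" using dist Weq by auto
  have hl: "fst (hd B) = fst e" "snd (last B) = fst e" using F(4)[OF q(2)] F(4)[OF q(3)] by auto
  have "face_word B"
    unfolding face_word_def
  proof (intro conjI allI impI ballI)
    show "distinct B" using dist by auto
    fix a assume a: "a \<in> set B"
    show "fst a \<noteq> snd a" using F(3) a set' by blast
    have "prod.swap a \<in> set W" using F(2) a set' by blast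
    moreover have "a \<notin> {e, ?e}" using a set' by blast
    then have "prod.swap a \<notin> {e, ?e}" by (cases a; cases e) auto
    ultimately show "prod.swap a \<in> set B" using set' by blast
  next
    fix a b assume "(a,b) \<in> cyc B"
    then consider "(a,b) \<in> cyc W" | "a = last B" "b = hd B" unfolding cyc' using lins by auto
    then show "snd a = fst b" using F(4) hl by cases auto
  next
    fix a assume "(a, prod.swap a) \<in> cyc B"
    then consider "(a, prod.swap a) \<in> cyc W" | "a = last B" "prod.swap a = hd B" unfolding cyc' using lins by auto
    then show "star (set B) (snd a) \<subseteq> {prod.swap a}"
    proof cases
      case 1 then show ?thesis using F(5) set' by blast
    next
      case 2
      then have "star (set W) (fst e) \<subseteq> {e, prod.swap a}" using face_word_degree_two[OF W, of a e] q by simp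
      then show ?thesis using 2 hl set' by auto
    qed
  next
    fix v
    have "card (star (set B) v) \<le> card (star (set W) v)" by (rule card_mono) (use set' in auto)
    then show "card (star (set B) v) \<le> 3" using F(6)[of v] by simp
  qed
  then show ?thesis using F(5)[OF q(1)] hl by blast
qed

text \<open>Rotate the word so that the gap between an arc and its reverse is as short as
possible.\<close>
lemma face_word_innermost:
  assumes W: "face_word W" "W \<noteq> []"
  obtains e A B where "face_word (e # A @ prod.swap e # B)" "set (e # A @ prod.swap e # B) = set W"
    "length (e # A @ prod.swap e # B) = length W" "\<And>x. x \<in> set A \<Longrightarrow> prod.swap x \<notin> set A"
proof -
  define Q where "Q n \<longleftrightarrow> (\<exists>e A B. face_word (e # A @ prod.swap e # B) \<and> set (e # A @ prod.swap e # B) = set W \<and>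
     length (e # A @ prod.swap e # B) = length W \<and> length A = n)" for n
  have rot: "Q (length A)" if "face_word (xs @ e # A @ prod.swap e # ys)" "set (xs @ e # A @ prod.swap e # ys) = set W"
     "length (xs @ e # A @ prod.swap e # ys) = length W" for xs e A ys
    unfolding Q_def
    using that face_word_rotate[of xs "e # A @ prod.swap e # ys"]
    by (intro exI[of _ e] exI[of _ A] exI[of _ "ys @ xs"]) auto
  have "\<exists>n. Q n"
  proof -
    obtain e W' where We: "W = e # W'" using W(2) by (cases W) auto
    have "prod.swap e \<in> set W" "prod.swap e \<noteq> e" using face_wordD(2,3)[OF W(1), of e] We by (auto simp: prod_eq_iff)
    then obtain A B where "W' = A @ prod.swap e # B" using We by (auto dest: split_list)
    then show ?thesis using rot[of "[]" e A B] W We by auto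
  qed
  then have L: "Q (LEAST n. Q n)" by (rule LeastI_ex)
  then obtain e A B where A: "face_word (e # A @ prod.swap e # B)" "set (e # A @ prod.swap e # B) = set W"
     "length (e # A @ prod.swap e # B) = length W" "length A = (LEAST n. Q n)" unfolding Q_def by blast
  show thesis
  proof (rule that[OF A(1-3)])
    fix x assume x: "x \<in> set A"
    show "prod.swap x \<notin> set A"
    proof
      assume sx: "prod.swap x \<in> set A"
      have ne: "prod.swap x \<noteq> x" using face_wordD(3)[OF A(1), of x] x by (auto simp: prod_eq_iff)
      obtain xs y zs ys where "A = xs @ y # zs @ prod.swap y # ys"
      proof -
        obtain as bs where ab: "A = as @ x # bs" using x by (auto dest: split_list)
        then consider "prod.swap x \<in> set as" | "prod.swap x \<in> set bs" using sx ne by auto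
        then show thesis
        proof cases
          case 1
          then obtain cs ds where "as = cs @ prod.swap x # ds" by (auto dest: split_list)
          then show thesis using that[of cs "prod.swap x" ds bs] ab by simp
        next
          case 2
          then obtain cs ds where "bs = cs @ prod.swap x # ds" by (auto dest: split_list)
          then show thesis using that[of as x cs ds] ab by simp
        qed
      qed
      then have "Q (length zs)" "length zs < length A"
        using rot[of "e # xs" y zs "ys @ prod.swap e # B"] A(1-3) by auto
      then show False using A(4) not_less_Least by metis
    qed
  qed
qed

text \<open>Induction on the length of the word. Take an innermost pair of an edge \<open>e\<close>
and its reverse. If nothing lies between them, prune a leaf and add it to the tree again. Otherwise
the arc \<open>d\<close> that follows \<open>e\<close> has its reverse outside of the gap, and the
adjacent edges \<open>e\<close> and \<open>d\<close> can be deleted: they form a new pair of cotree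
edges with a centre that was of degree three, and that has degree one afterwards.\<close>
lemma face_word_spanning_pairing:
  assumes "face_word W" "W \<noteq> []"
  shows "\<exists>T K. spanning_pairing (set W) T K"
  using assms
proof (induction "length W" arbitrary: W rule: less_induct)
  case less
  obtain e A B where D: "face_word (e # A @ prod.swap e # B)" "set (e # A @ prod.swap e # B) = set W"
    "length (e # A @ prod.swap e # B) = length W" "\<And>x. x \<in> set A \<Longrightarrow> prod.swap x \<notin> set A"
    using face_word_innermost[OF less.prems] by blast
  let ?e = "prod.swap e"
  show ?case
  proof (cases A)
    case Nil
    let ?W = "e # ?e # B"
    have W: "face_word ?W" "set ?W = set W" using D Nil by auto
    have ne: "fst e \<noteq> snd e" using face_wordD(3)[OF W(1), of e] by simp
    have pair: "e = (fst e, snd e)" "?e = (snd e, fst e)" by (simp_all add: prod_eq_iff)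
    show ?thesis
    proof (cases "B = []")
      case True
      have "tree_on (insert (snd e) {fst e}) (insert (fst e, snd e) (insert (snd e, fst e) {}))"
        using ne by (intro tree_on.leaf tree_on.single) auto
      then have "spanning_pairing (set ?W) {e, ?e} {}"
        unfolding spanning_pairing_def using True pair by (simp add: insert_commute)
      then show ?thesis using W by metis
    next
      case False
      have S: "face_word B" "star (set ?W) (snd e) \<subseteq> {?e}" "fst (hd B) = fst e"
        using face_word_delete_leaf[OF W(1) refl False] by auto
      have len: "length B < length W" using D(3) Nil by simp
      obtain T K where TK: "spanning_pairing (set B) T K" using less.hyps[OF len S(1) False] by blast
      note P = TK[unfolded spanning_pairing_def]
      have dist: "e \<notin> set B" "?e \<notin> set B" using face_wordD(1)[OF W(1)] by auto
      have u: "fst e \<in> fst ` set B" using S(3) False by (metis hd_in_set imageI)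
      have v: "snd e \<notin> fst ` set B" using S(2) dist by fastforce
      have "tree_on (insert (snd e) (fst ` set B)) (insert (fst e, snd e) (insert (snd e, fst e) T))"
        using P u v by (intro tree_on.leaf) auto
      moreover have "fst ` set ?W = insert (snd e) (fst ` set B)" using u by auto
      ultimately have tr: "tree_on (fst ` set ?W) (insert e (insert ?e T))" using pair by (metis prod.collapse)
      have diff: "set ?W - insert e (insert ?e T) = set B - T" using dist P by auto
      have "spanning_pairing (set ?W) (insert e (insert ?e T)) K"
        unfolding spanning_pairing_def diff using tr P by auto
      then show ?thesis using W by metis
    qed
  next
    case (Cons d A')
    have "d \<in> set W" "d \<in> set A" using D(2) Cons by auto
    have dist: "distinct (e # d # A' @ ?e # B)" using face_wordD(1)[OF D(1)] Cons by simp
    have "prod.swap d \<in> set (e # d # A' @ ?e # B)" using face_wordD(2)[OF D(1), of d] Cons by auto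
    moreover have "prod.swap d \<notin> set (d # A')" using D(4)[of d] Cons by auto
    moreover have "d \<noteq> ?e" "d \<noteq> e" using dist by auto
    then have "prod.swap d \<noteq> e" "prod.swap d \<noteq> ?e" by (cases d; cases e; auto)+
    ultimately have "prod.swap d \<in> set B" by auto
    then obtain B1 B2 where B: "B = B1 @ prod.swap d # B2" by (auto dest: split_list)
    let ?d = "prod.swap d"
    let ?W = "e # d # A' @ ?e # B1 @ ?d # B2"
    let ?W' = "A' @ B2 @ B1"
    have W: "face_word ?W" "set ?W = set W" "length ?W = length W" using D(1-3) Cons B by auto
    note F = face_wordD[OF W(1)]
    have S: "A' \<noteq> []" "B1 \<noteq> []" "B2 \<noteq> []" "snd e = fst d" "fst (hd A') = snd d" "fst (hd B1) = fst e"
      "fst (hd B2) = snd e" "face_word ?W'"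
      using face_word_delete_pair[OF W(1) refl] by auto
    have len: "length ?W' < length W" using W(3) by simp
    obtain T K where TK: "spanning_pairing (set ?W') T K" using less.hyps[OF len S(8)] S(1) by auto
    note P = TK[unfolded spanning_pairing_def]
    let ?v = "snd e"
    have dW: "distinct ?W" using F(1) .
    have set': "set ?W = {e,d,?e,?d} \<union> set ?W'" "{e,d,?e,?d} \<inter> set ?W' = {}" using dW by auto
    have nin: "e \<notin> set ?W'" "d \<notin> set ?W'" "?e \<notin> set ?W'" "?d \<notin> set ?W'" using dW by auto
    have dd: "e \<noteq> d" "?e \<noteq> d" "?e \<noteq> e" "?d \<noteq> d" "?d \<noteq> e" "?d \<noteq> ?e" using dW by auto
    have fins: "finite (set ?W')" by simp
    have inV: "snd d \<in> fst ` set ?W'" "fst e \<in> fst ` set ?W'" "?v \<in> fst ` set ?W'"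
    proof -
      have "hd A' \<in> set ?W'" "hd B1 \<in> set ?W'" "hd B2 \<in> set ?W'" using S(1-3) by auto
      then show "snd d \<in> fst ` set ?W'" "fst e \<in> fst ` set ?W'" "?v \<in> fst ` set ?W'"
        using S(5-7) by (metis imageI)+
    qed
    have V: "fst ` set ?W = fst ` set ?W'" unfolding set'(1) using inV S(4) by auto
    have three: "3 \<le> card (star (set ?W') x)" if x: "x \<in> K" for x
    proof -
      have "x \<in> fst ` set ?W'" using P x by blast
      moreover have "fst e \<noteq> ?v" using F(3)[of e] by simp
      then obtain w where "w \<in> fst ` set ?W'" "x \<noteq> w" using inV(2,3) by metis
      ultimately obtain y where y: "(x,y) \<in> T" using tree_on_neighbour[of "fst ` set ?W'" T x w] P by blast
      have sub: "insert (x,y) (star (set ?W' - T) x) \<subseteq> star (set ?W') x" using y P by auto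
      have "card (insert (x,y) (star (set ?W' - T) x)) = Suc (card (star (set ?W' - T) x))"
        using y by (subst card_insert_disjoint) auto
      moreover have "2 \<le> card (star (set ?W' - T) x)" using P x by blast
      ultimately show ?thesis using card_mono[OF _ sub] by simp
    qed
    have notK: "x \<notin> K" if "a \<in> {e,d,?e,?d}" "fst a = x" for x a
    proof
      assume "x \<in> K"
      have sub: "insert a (star (set ?W') x) \<subseteq> star (set ?W) x" using that set'(1) by auto
      have "a \<notin> star (set ?W') x" using that set'(2) by blast
      then have "card (insert a (star (set ?W') x)) = Suc (card (star (set ?W') x))" by (subst card_insert_disjoint) auto
      then have "4 \<le> card (star (set ?W) x)" using card_mono[OF _ sub] three[OF \<open>x \<in> K\<close>] by simp
      then show False using F(6)[of x] by simp
    qed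
    have uK: "fst e \<notin> K" "snd d \<notin> K" "?v \<notin> K"
      using notK[of e] notK[of ?d] notK[of ?e] by auto
    have D': "set ?W - T = {e,d,?e,?d} \<union> (set ?W' - T)" unfolding set'(1) using set'(2) P by auto
    have vT: "star (set ?W' - T) ?v = {}"
    proof -
      have "?v \<noteq> fst e" using F(3)[of e] by auto
      then obtain y where y: "(?v,y) \<in> T" using tree_on_neighbour[of "fst ` set ?W'" T ?v "fst e"] P inV by blast
      have yW: "(?v,y) \<in> set ?W'" using y P by blast
      have "z = (?v,y)" if z: "z \<in> star (set ?W') ?v" for z
      proof -
        have m: "?e \<in> star (set ?W) ?v" "d \<in> star (set ?W) ?v" "(?v,y) \<in> star (set ?W) ?v" "z \<in> star (set ?W) ?v"
          using S(4) yW z by auto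
        have m': "{?e, d, (?v,y), z} \<subseteq> star (set ?W) ?v" using m by blast
        have ne: "?e \<noteq> (?v,y)" "d \<noteq> (?v,y)" using nin yW by metis+
        have "z \<in> {?e, d, (?v,y)}" by (rule card_le3_distinct4[OF _ F(6) m' dd(2) ne]) simp
        moreover have "z \<in> set ?W'" using z by (simp only: mem_Collect_eq)
        then have "z \<noteq> ?e" "z \<noteq> d" using nin by metis+
        ultimately show ?thesis by (simp only: insert_iff empty_iff simp_thms)
      qed
      then show ?thesis using y by blast
    qed
    have symW': "prod.swap a \<in> set ?W' - T" if "a \<in> set ?W' - T" for a
    proof -
      have "prod.swap a \<in> set ?W'" using face_wordD(2)[OF S(8)] that by blast
      moreover have "prod.swap a \<notin> T" using tree_on_basic[of _ T] P that by (metis DiffD2 swap_swap)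
      ultimately show ?thesis by blast
    qed
    have k1: "2 \<le> card (star (set ?W - T) x)" if "x \<in> insert ?v K" for x
    proof (cases "x = ?v")
      case True
      have "{?e, d} \<subseteq> star (set ?W - T) x" using True D' S(4) by auto
      then have "card {?e, d} \<le> card (star (set ?W - T) x)" by (intro card_mono) auto
      then show ?thesis using dd by simp
    next
      case False
      then have "2 \<le> card (star (set ?W' - T) x)" using that P by blast
      also have "\<dots> \<le> card (star (set ?W - T) x)" by (rule card_mono) (use D' in auto)
      finally show ?thesis .
    qed
    have k2: "fst a \<in> insert ?v K \<or> snd a \<in> insert ?v K" if "a \<in> set ?W - T" for a
      using that unfolding D' using P S(4) by auto
    have nov: "(?v, x) \<notin> set ?W - T" "(x, ?v) \<notin> set ?W - T" if x: "x \<in> insert ?v K" for x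
    proof -
      have A: "(?v, x) \<notin> {e,d,?e,?d}" "(x, ?v) \<notin> {e,d,?e,?d}"
        using x uK F(3)[of e] F(3)[of d] S(4) by (auto simp: prod_eq_iff)
      have B: "(?v, x) \<notin> set ?W' - T" using vT by auto
      have "(x, ?v) \<notin> set ?W' - T" using symW'[of "(x, ?v)"] B by auto
      then show "(?v, x) \<notin> set ?W - T" "(x, ?v) \<notin> set ?W - T" unfolding D' using A B by blast+
    qed
    have k3: "(x, y) \<notin> set ?W - T" if "x \<in> insert ?v K" "y \<in> insert ?v K" for x y
    proof (cases "x = ?v \<or> y = ?v")
      case True then show ?thesis using nov that by blast
    next
      case False
      then have xy: "x \<in> K" "y \<in> K" using that by auto
      then have "(x,y) \<notin> set ?W' - T" using P by blast
      moreover have "(x,y) \<notin> {e,d,?e,?d}" using xy uK S(4) by (auto simp: prod_eq_iff)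
      ultimately show ?thesis unfolding D' by blast
    qed
    have "spanning_pairing (set ?W) T (insert ?v K)"
      unfolding spanning_pairing_def V
    proof (intro conjI ballI)
      show "T \<subseteq> set ?W" using P set'(1) by blast
      show "tree_on (fst ` set ?W') T" using P by blast
      show "insert ?v K \<subseteq> fst ` set ?W'" using P inV by blast
    qed (use k1 k2 k3 in blast)+
    then show ?thesis using W by metis
  qed
qed

section \<open>Zero forcing along a tree\<close>

text \<open>The closure of \<open>B\<close> under the forcing rule. As a least fixed point it is
independent of the order in which the rule is applied, and monotone in \<open>B\<close>.\<close>
inductive forced :: "('v \<Rightarrow> 'v set) \<Rightarrow> 'v set \<Rightarrow> 'v \<Rightarrow> bool" for N B where
  initial: "v \<in> B \<Longrightarrow> forced N B v"
| force: "forced N B u \<Longrightarrow> w \<in> N u \<Longrightarrow> (\<And>x. x \<in> N u - {w} \<Longrightarrow> forced N B x) \<Longrightarrow> forced N B w"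

lemma forced_trans:
  assumes "forced N B v" "\<And>b. b \<in> B \<Longrightarrow> forced N C b"
  shows "forced N C v"
  using assms by induction (auto intro: forced.force)

lemma forced_mono: "forced N B v \<Longrightarrow> B \<subseteq> C \<Longrightarrow> forced N C v"
  by (rule forced_trans) (auto intro: forced.initial)

text \<open>A tree that hangs below an outside vertex \<open>p\<close>, by means of binary
branching: \<open>R\<close> is a union of subtrees whose roots are adjacent to \<open>p\<close>.
Unlike \<open>tree_on\<close> it is rooted, which supports a bottom-up argument.\<close>
inductive hanging :: "'v \<Rightarrow> 'v set \<Rightarrow> ('v \<times> 'v) set \<Rightarrow> bool" where
  empty: "hanging p {} {}"
| branch: "hanging r C T1 \<Longrightarrow> hanging p R T2 \<Longrightarrow> C \<inter> R = {} \<Longrightarrow> r \<notin> C \<union> R \<Longrightarrow> p \<notin> insert r (C \<union> R) \<Longrightarrow>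
     hanging p (insert r (C \<union> R)) ({(p,r),(r,p)} \<union> T1 \<union> T2)"

lemma hanging_arcs:
  assumes "hanging p R T"
  shows "T \<subseteq> insert p R \<times> insert p R \<and> p \<notin> R \<and> finite R"
  using assms
proof induction
  case (branch r C T1 p R T2)
  let ?X = "insert p (insert r (C \<union> R))"
  have "T1 \<subseteq> ?X \<times> ?X" by (rule order_trans[OF branch.IH(1)[THEN conjunct1] Sigma_mono]) auto
  moreover have "T2 \<subseteq> ?X \<times> ?X" by (rule order_trans[OF branch.IH(2)[THEN conjunct1] Sigma_mono]) auto
  ultimately show ?case using branch.IH branch.hyps(5) by simp
qed auto

lemma hanging_attach_leaf:
  assumes "hanging p R T" "u \<in> insert p R" "v \<notin> insert p R"
  shows "hanging p (insert v R) (insert (u,v) (insert (v,u) T))"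
  using assms
proof (induction)
  case (empty p)
  have "hanging p (insert v ({} \<union> {})) ({(p,v),(v,p)} \<union> {} \<union> {})"
    using empty by (intro hanging.branch hanging.empty) auto
  then show ?case using empty by simp
next
  case (branch r C T1 p R T2)
  show ?case
  proof (cases "u \<in> insert r C")
    case True
    have "hanging r (insert v C) (insert (u,v) (insert (v,u) T1))" using branch True by auto
    then have "hanging p (insert r (insert v C \<union> R)) ({(p,r),(r,p)} \<union> insert (u,v) (insert (v,u) T1) \<union> T2)"
      using branch by (intro hanging.branch) auto
    then show ?thesis by (simp add: insert_commute)
  next
    case False
    then have u: "u \<in> insert p R" using branch by auto
    have "hanging p (insert v R) (insert (u,v) (insert (v,u) T2))" using branch u by auto
    then have "hanging p (insert r (C \<union> insert v R)) ({(p,r),(r,p)} \<union> T1 \<union> insert (u,v) (insert (v,u) T2))"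
      using branch by (intro hanging.branch) auto
    then show ?thesis by (simp add: insert_commute)
  qed
qed

lemma tree_on_hanging:
  assumes "tree_on V T"
  shows "\<And>r. r \<in> V \<Longrightarrow> hanging r (V - {r}) T"
  using assms
proof (induction)
  case (single r') then show ?case using hanging.empty by auto
next
  case (leaf V T u v)
  show ?case
  proof (cases "r = v")
    case True
    have "hanging v (insert u ((V - {u}) \<union> {})) ({(v,u),(u,v)} \<union> T \<union> {})"
      using leaf.IH[OF leaf.hyps(2)] leaf.hyps by (intro hanging.branch hanging.empty) auto
    moreover have "insert u ((V - {u}) \<union> {}) = insert v V - {r}" using leaf.hyps True by auto
    moreover have "{(v,u),(u,v)} \<union> T \<union> {} = insert (u,v) (insert (v,u) T)" by auto
    ultimately show ?thesis using True by simp
  next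
    case False
    then have r: "r \<in> V" using leaf.prems by simp
    have "hanging r (insert v (V - {r})) (insert (u,v) (insert (v,u) T))"
      using leaf.hyps r by (intro hanging_attach_leaf leaf.IH) auto
    moreover have "insert v (V - {r}) = insert v V - {r}" using False by auto
    ultimately show ?thesis by simp
  qed
qed

text \<open>The vertices of \<open>J\<close> have degree three, and together with \<open>I\<close>
they extend an independent set.\<close>
definition isolated_branching :: "('v \<Rightarrow> 'v set) \<Rightarrow> 'v set \<Rightarrow> 'v set \<Rightarrow> bool" where
  "isolated_branching N I J \<longleftrightarrow> (\<forall>x \<in> J. card (N x) = 3 \<and> N x \<inter> I = {}) \<and> (\<forall>x \<in> J. \<forall>y \<in> J. y \<notin> N x)"

text \<open>The first of two kinds of hanging trees. With \<open>|J|\<close> vertices the tree can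
be forced once its root and the vertex \<open>p\<close> are forced from above; one additional vertex
allows it to force itself completely, without help, so that afterwards it may act on
\<open>p\<close>. As the root is not in \<open>J\<close>, the parent may be.\<close>
definition through_type where
  "through_type N I p r R \<longleftrightarrow> (\<exists>Bu Bd J. Bu \<subseteq> R \<and> Bd \<subseteq> R \<and> J \<subseteq> R - {r} \<and> isolated_branching N I J \<and>
     card Bu \<le> card J + 1 \<and> card Bd \<le> card J \<and> (\<forall>v \<in> R. forced N (I \<union> Bu) v) \<and>
     (\<forall>Y. I \<union> Bd \<subseteq> Y \<longrightarrow> forced N Y r \<longrightarrow> forced N Y p \<longrightarrow> (\<forall>v \<in> R. forced N Y v)))"

text \<open>The second kind: with \<open>|J|\<close> vertices the root gets forced from inside, and
the remaining vertices follow once \<open>p\<close> is forced.\<close>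
definition closed_type where
  "closed_type N I p r R \<longleftrightarrow> (\<exists>B J. B \<subseteq> R \<and> J \<subseteq> R \<and> isolated_branching N I J \<and> card B \<le> card J \<and>
     forced N (I \<union> B) r \<and> (\<forall>Y. I \<union> B \<subseteq> Y \<longrightarrow> forced N Y p \<longrightarrow> (\<forall>v \<in> R. forced N Y v)))"

lemma through_typeI:
  assumes "Bu \<subseteq> R" "Bd \<subseteq> R" "J \<subseteq> R - {r}" "isolated_branching N I J"
     "card Bu \<le> card J + 1" "card Bd \<le> card J" "\<forall>v \<in> R. forced N (I \<union> Bu) v"
     "\<And>Y. I \<union> Bd \<subseteq> Y \<Longrightarrow> forced N Y r \<Longrightarrow> forced N Y p \<Longrightarrow> \<forall>v \<in> R. forced N Y v"
  shows "through_type N I p r R"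
  unfolding through_type_def by (intro exI conjI allI impI; fact assms)

lemma closed_typeI:
  assumes "B \<subseteq> R" "J \<subseteq> R" "isolated_branching N I J" "card B \<le> card J" "forced N (I \<union> B) r"
     "\<And>Y. I \<union> B \<subseteq> Y \<Longrightarrow> forced N Y p \<Longrightarrow> \<forall>v \<in> R. forced N Y v"
  shows "closed_type N I p r R"
  unfolding closed_type_def by (intro exI conjI allI impI; fact assms)

lemma through_typeE:
  assumes "through_type N I p r R"
  obtains Bu Bd J where "Bu \<subseteq> R" "Bd \<subseteq> R" "J \<subseteq> R - {r}" "isolated_branching N I J"
     "card Bu \<le> card J + 1" "card Bd \<le> card J" "\<forall>v \<in> R. forced N (I \<union> Bu) v"
     "\<forall>Y. I \<union> Bd \<subseteq> Y \<longrightarrow> forced N Y r \<longrightarrow> forced N Y p \<longrightarrow> (\<forall>v \<in> R. forced N Y v)"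
  using assms unfolding through_type_def by (elim exE conjE) (rule that)

lemma closed_typeE:
  assumes "closed_type N I p r R"
  obtains B J where "B \<subseteq> R" "J \<subseteq> R" "isolated_branching N I J" "card B \<le> card J" "forced N (I \<union> B) r"
     "\<forall>Y. I \<union> B \<subseteq> Y \<longrightarrow> forced N Y p \<longrightarrow> (\<forall>v \<in> R. forced N Y v)"
  using assms unfolding closed_type_def by (elim exE conjE) (rule that)

lemma isolated_branching_Un:
  assumes "isolated_branching N I J1" "isolated_branching N I J2"
    "\<And>x y. x \<in> J1 \<Longrightarrow> y \<in> J2 \<Longrightarrow> y \<notin> N x \<and> x \<notin> N y"
  shows "isolated_branching N I (J1 \<union> J2)"
  using assms unfolding isolated_branching_def by blast

text \<open>Bottom-up induction. If the root has a child of the second kind, or at most one child,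
the tree is of the first kind: the sets \<open>J\<close> of the subtrees are united, and the
additional vertex is the one of a subtree of the first kind or the root itself. A root with two
children of the first kind is itself put into \<open>J\<close>, and the tree is of the second kind:
the new member of \<open>J\<close> pays for letting one of the two subtrees force itself and then
the root. It is a legitimate member because the roots of the subtrees are not in
\<open>J\<close>.\<close>
lemma hanging_types:
  fixes N :: "'v \<Rightarrow> 'v set"
  assumes "hanging r C T" "p \<notin> insert r C" "p \<in> N r"
    and "\<And>x. finite (N x) \<and> card (N x) \<le> 3"
    and "\<And>x y. (x,y) \<in> T \<Longrightarrow> y \<in> N x"
    and "\<And>x y. x \<in> insert r C \<Longrightarrow> y \<in> N x \<Longrightarrow> y \<in> I \<or> (x,y) \<in> T \<or> x = r \<and> y = p"
    and "insert p (insert r C) \<inter> I = {}"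
  shows "through_type N I p r (insert r C) \<or> closed_type N I p r (insert r C)"
  using assms
proof (induction "card C" arbitrary: r C T p rule: less_induct)
  case less
  note N3 = less.prems(4) and TN = less.prems(5) and NT = less.prems(6)
  note A = hanging_arcs[OF less.prems(1)]
  have child: "through_type N I r r1 (insert r1 C1) \<or> closed_type N I r r1 (insert r1 C1)"
    if h: "hanging r1 C1 T1" and sub: "insert r1 C1 \<subseteq> C" "T1 \<subseteq> T" "(r,r1) \<in> T" "(r1,r) \<in> T"
      and arcs: "\<And>x y. x \<in> insert r1 C1 \<Longrightarrow> (x,y) \<in> T \<Longrightarrow> (x,y) \<in> T1 \<or> x = r1 \<and> y = r" for r1 C1 T1
  proof (rule less.hyps[OF _ h])
    have "r1 \<notin> C1" using hanging_arcs[OF h] by blast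
    then have "C1 \<subset> C" using sub(1) by blast
    then show "card C1 < card C" using A psubset_card_mono by blast
    show "r \<notin> insert r1 C1" using A sub(1) by blast
    show "r \<in> N r1" using TN sub(4) by blast
    show "finite (N x) \<and> card (N x) \<le> 3" for x by (rule N3)
    show "y \<in> N x" if "(x,y) \<in> T1" for x y using that sub(2) TN by blast
    show "y \<in> I \<or> (x,y) \<in> T1 \<or> x = r1 \<and> y = r" if xy: "x \<in> insert r1 C1" "y \<in> N x" for x y
    proof -
      have "x \<in> C" using xy(1) sub(1) by blast
      then have "x \<noteq> r" using A by blast
      then have "y \<in> I \<or> (x,y) \<in> T" using NT[of x y] xy(2) \<open>x \<in> C\<close> by blast
      then show ?thesis using arcs[OF xy(1), of y] by blast
    qed
    show "insert r (insert r1 C1) \<inter> I = {}" using less.prems(7) sub(1) by blast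
  qed
  from less.prems(1) show ?case
  proof (cases rule: hanging.cases)
    case empty
    have "through_type N I p r {r}"
      by (rule through_typeI[of "{r}" _ "{}" "{}"]) (auto simp: isolated_branching_def intro: forced.initial)
    then show ?thesis using empty by simp
  next
    case (branch r1 C1 T1 R T2)
    note B = branch
    have h1: "hanging r1 C1 T1" and h2: "hanging r R T2" using branch by auto
    have C: "C = insert r1 (C1 \<union> R)" and T: "T = {(r,r1),(r1,r)} \<union> T1 \<union> T2" using branch by auto
    have d: "C1 \<inter> R = {}" "r1 \<notin> C1 \<union> R" "r \<notin> insert r1 (C1 \<union> R)" using branch by auto
    note A1 = hanging_arcs[OF h1] and A2 = hanging_arcs[OF h2]
    let ?R1 = "insert r1 C1"
    have t1: "through_type N I r r1 ?R1 \<or> closed_type N I r r1 ?R1"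
      by (rule child[OF h1]) (use C T d A1 A2 in auto)
    from h2 show ?thesis
    proof (cases rule: hanging.cases)
      case empty
      have Nr: "N r \<subseteq> I \<union> {p, r1}"
      proof
        fix y assume "y \<in> N r"
        then have "y \<in> I \<or> (r,y) \<in> T \<or> y = p" using NT[of r y] by blast
        then show "y \<in> I \<union> {p,r1}" using T empty A1 d by auto
      qed
      have R: "insert r C = insert r ?R1" using C empty by auto
      have r1N: "r1 \<in> N r" using TN T by blast
      have rp: "r \<noteq> p" "p \<notin> I" "p \<noteq> r1" using less.prems(2,7) C by auto
      from t1 show ?thesis
      proof
        assume "through_type N I r r1 ?R1"
        then obtain Bu Bd J where U: "Bu \<subseteq> ?R1" "Bd \<subseteq> ?R1" "J \<subseteq> ?R1 - {r1}" "isolated_branching N I J"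
           "card Bu \<le> card J + 1" "card Bd \<le> card J" "\<forall>v \<in> ?R1. forced N (I \<union> Bu) v"
           "\<forall>Y. I \<union> Bd \<subseteq> Y \<longrightarrow> forced N Y r1 \<longrightarrow> forced N Y r \<longrightarrow> (\<forall>v \<in> ?R1. forced N Y v)"
          by (rule through_typeE)
        have fr: "forced N (I \<union> Bu) r"
        proof (rule forced.force[of _ _ r1])
          show "forced N (I \<union> Bu) r1" using U by blast
          show "r \<in> N r1" using TN T by blast
          fix x assume x: "x \<in> N r1 - {r}"
          then have "x \<in> I \<or> (r1,x) \<in> T" using NT[of r1 x] C A by blast
          then have "x \<in> I \<or> x \<in> ?R1" using T empty A1 x d by auto
          then show "forced N (I \<union> Bu) x" using U by (auto intro: forced.initial)
        qed
        have "\<forall>v \<in> insert r ?R1. forced N Y v" if Y: "I \<union> Bd \<subseteq> Y" "forced N Y r" "forced N Y p" for Y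
        proof -
          have "forced N Y r1"
            by (rule forced.force[OF Y(2) r1N]) (use Nr Y in \<open>auto intro: forced.initial\<close>)
          then show ?thesis using U(8) Y by blast
        qed
        note f2 = this
        have sub: "Bu \<subseteq> insert r ?R1" "Bd \<subseteq> insert r ?R1" "J \<subseteq> insert r ?R1 - {r}" using U(1-3) d by blast+
        have f1: "\<forall>v \<in> insert r ?R1. forced N (I \<union> Bu) v" using fr U(7) by blast
        have "through_type N I p r (insert r ?R1)" by (rule through_typeI[OF sub U(4,5,6) f1 f2])
        then show ?thesis using R by simp
      next
        assume "closed_type N I r r1 ?R1"
        then obtain B J where U: "B \<subseteq> ?R1" "J \<subseteq> ?R1" "isolated_branching N I J" "card B \<le> card J"
           "forced N (I \<union> B) r1" "\<forall>Y. I \<union> B \<subseteq> Y \<longrightarrow> forced N Y r \<longrightarrow> (\<forall>v \<in> ?R1. forced N Y v)"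
          by (rule closed_typeE)
        have fr: "forced N (I \<union> insert r B) r" by (rule forced.initial) simp
        have IB: "I \<union> B \<subseteq> I \<union> insert r B" by blast
        have f1: "\<forall>v \<in> insert r ?R1. forced N (I \<union> insert r B) v" using U(6) IB fr by blast
        have f2: "\<forall>v \<in> insert r ?R1. forced N Y v" if Y: "I \<union> B \<subseteq> Y" "forced N Y r" for Y
          using U(6) Y by blast
        have c: "card (insert r B) \<le> card J + 1" using U(4) card_insert_le_m1[of "card J + 1" B r] by simp
        have sub: "insert r B \<subseteq> insert r ?R1" "B \<subseteq> insert r ?R1" "J \<subseteq> insert r ?R1 - {r}" using U(1,2) d by blast+
        have "through_type N I p r (insert r ?R1)" by (rule through_typeI[OF sub U(3) c U(4) f1 f2])
        then show ?thesis using R by simp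
      qed
    next
      case (branch r2 C2 T3 R' T4)
      have h3: "hanging r2 C2 T3" and h4: "hanging r R' T4" using branch by auto
      have R: "R = insert r2 (C2 \<union> R')" and T2: "T2 = {(r,r2),(r2,r)} \<union> T3 \<union> T4" using branch by auto
      have d2: "C2 \<inter> R' = {}" "r2 \<notin> C2 \<union> R'" "r \<notin> insert r2 (C2 \<union> R')" using branch by auto
      note A3 = hanging_arcs[OF h3] and A4 = hanging_arcs[OF h4]
      have in3: "p \<in> N r" "r1 \<in> N r" "r2 \<in> N r" using less.prems(3) TN T T2 by auto
      have pr: "p \<noteq> r" "p \<noteq> r1" "p \<noteq> r2" "r1 \<noteq> r2" using less.prems(2) C R d by auto
      have Nr: "N r = {p, r1, r2}"
      proof (rule card_seteq[symmetric])
        show "finite (N r)" using N3 by blast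
        show "{p, r1, r2} \<subseteq> N r" using in3 by blast
        show "card (N r) \<le> card {p, r1, r2}" using N3[of r] pr by simp
      qed
      from h4 have R'0: "R' = {} \<and> T4 = {}"
      proof (cases rule: hanging.cases)
        case (branch r3 C3 T5 R'' T6)
        then have "(r,r3) \<in> T" "r3 \<in> R'" using T T2 by auto
        then have "r3 \<in> N r" "r3 \<noteq> p" "r3 \<noteq> r1" "r3 \<noteq> r2" using TN less.prems(2) C R d d2 by auto
        then show ?thesis using Nr by blast
      qed blast
      let ?R2 = "insert r2 C2"
      have R2: "R = ?R2" using R R'0 by simp
      have t2: "through_type N I r r2 ?R2 \<or> closed_type N I r r2 ?R2"
        by (rule child[OF h3]) (use C T T2 R2 R'0 d d2 A1 A3 in auto)
      have RR: "insert r C = insert r (?R1 \<union> ?R2)" using C R2 by auto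
      have disj: "?R1 \<inter> ?R2 = {}" "r \<notin> ?R1" "r \<notin> ?R2" using d R2 by auto
      have I0: "?R1 \<inter> I = {}" "?R2 \<inter> I = {}" "r \<notin> I" "p \<notin> I" using less.prems(7) C R2 by auto
      have N1: "y \<in> I \<or> y \<in> ?R1 \<or> x = r1 \<and> y = r" if xy: "x \<in> ?R1" "y \<in> N x" for x y
      proof -
        have "x \<noteq> r" "x \<in> insert r C" using xy(1) disj C by auto
        then have "y \<in> I \<or> (x,y) \<in> T" using NT[of x y] xy(2) by blast
        then show ?thesis using T T2 R'0 xy(1) disj A1 A3 by auto
      qed
      have N2: "y \<in> I \<or> y \<in> ?R2 \<or> x = r2 \<and> y = r" if xy: "x \<in> ?R2" "y \<in> N x" for x y
      proof -
        have "x \<noteq> r" "x \<in> insert r C" using xy(1) disj C R2 by auto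
        then have "y \<in> I \<or> (x,y) \<in> T" using NT[of x y] xy(2) by blast
        then show ?thesis using T T2 R'0 xy(1) disj A1 A3 by auto
      qed
      have fin: "finite ?R1" "finite ?R2" using A1 A3 by auto
      have cross: "y \<notin> N x \<and> x \<notin> N y" if "x \<in> ?R1" "y \<in> ?R2" for x y
        using N1[of x y] N2[of y x] that disj I0 by auto
      have JUn: "isolated_branching N I (J1 \<union> J2)" "card (J1 \<union> J2) = card J1 + card J2"
        if "J1 \<subseteq> ?R1" "J2 \<subseteq> ?R2" "isolated_branching N I J1" "isolated_branching N I J2" for J1 J2
      proof -
        show "isolated_branching N I (J1 \<union> J2)"
          by (rule isolated_branching_Un[OF that(3,4)]) (use cross that(1,2) in blast)
        show "card (J1 \<union> J2) = card J1 + card J2"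
          using that(1,2) disj fin by (intro card_Un_disjoint) (auto intro: finite_subset)
      qed
      have step1: "forced N Y r" if "\<forall>v \<in> ?R1. forced N Y v" "I \<subseteq> Y" for Y
      proof (rule forced.force[of _ _ r1])
        show "forced N Y r1" using that by blast
        show "r \<in> N r1" using TN T by blast
        show "forced N Y x" if "x \<in> N r1 - {r}" for x
          using N1[of r1 x] that \<open>\<forall>v \<in> ?R1. forced N Y v\<close> \<open>I \<subseteq> Y\<close> by (auto intro: forced.initial)
      qed
      have step2: "forced N Y r" if "\<forall>v \<in> ?R2. forced N Y v" "I \<subseteq> Y" for Y
      proof (rule forced.force[of _ _ r2])
        show "forced N Y r2" using that by blast
        show "r \<in> N r2" using TN T T2 by blast
        show "forced N Y x" if "x \<in> N r2 - {r}" for x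
          using N2[of r2 x] that \<open>\<forall>v \<in> ?R2. forced N Y v\<close> \<open>I \<subseteq> Y\<close> by (auto intro: forced.initial)
      qed
      have down: "forced N Y y" if "forced N Y r" "{p,r1,r2} = {x,z,y}" "forced N Y x" "forced N Y z" for Y x y z
        by (rule forced.force[OF that(1), of y]) (use Nr that in auto)
      have up: "\<And>v. v \<in> X \<Longrightarrow> forced N (I \<union> B) v \<Longrightarrow> forced N (I \<union> (B \<union> B')) v" for X v B B'
        by (rule forced_mono) auto
      consider "through_type N I r r1 ?R1" "through_type N I r r2 ?R2" | "through_type N I r r1 ?R1" "closed_type N I r r2 ?R2"
        | "closed_type N I r r1 ?R1" "through_type N I r r2 ?R2" | "closed_type N I r r1 ?R1" "closed_type N I r r2 ?R2"
        using t1 t2 by blast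
      then have "through_type N I p r (insert r (?R1 \<union> ?R2)) \<or> closed_type N I p r (insert r (?R1 \<union> ?R2))"
      proof cases
        case 1
        obtain Bu Bd1 J1 where U0: "Bu \<subseteq> ?R1" "Bd1 \<subseteq> ?R1" "J1 \<subseteq> ?R1 - {r1}" "isolated_branching N I J1"
           "card Bu \<le> card J1 + 1" "card Bd1 \<le> card J1" "\<forall>v \<in> ?R1. forced N (I \<union> Bu) v"
           "\<forall>Y. I \<union> Bd1 \<subseteq> Y \<longrightarrow> forced N Y r1 \<longrightarrow> forced N Y r \<longrightarrow> (\<forall>v \<in> ?R1. forced N Y v)"
          by (rule through_typeE[OF 1(1)])
        obtain Bu2 Bd J2 where W0: "Bu2 \<subseteq> ?R2" "Bd \<subseteq> ?R2" "J2 \<subseteq> ?R2 - {r2}" "isolated_branching N I J2"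
           "card Bu2 \<le> card J2 + 1" "card Bd \<le> card J2" "\<forall>v \<in> ?R2. forced N (I \<union> Bu2) v"
           "\<forall>Y. I \<union> Bd \<subseteq> Y \<longrightarrow> forced N Y r2 \<longrightarrow> forced N Y r \<longrightarrow> (\<forall>v \<in> ?R2. forced N Y v)"
          by (rule through_typeE[OF 1(2)])
        note U = U0(1,3,4,5,7) and W = W0(2,3,4,6,8)
        have J12: "J1 \<subseteq> ?R1" "J2 \<subseteq> ?R2" using U(2) W(2) by auto
        let ?J = "insert r (J1 \<union> J2)" and ?B = "Bu \<union> Bd"
        have rJ: "x \<notin> N r \<and> r \<notin> N x" if "x \<in> J1 \<union> J2" for x
          using that U(2) W(2) Nr N1[of x r] N2[of x r] disj I0 less.prems(2) C R2 by auto
        have "r \<notin> N r" using Nr pr disj by auto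
        then have J: "isolated_branching N I ?J"
          using JUn(1)[OF J12 U(3) W(3)] rJ Nr pr I0 unfolding isolated_branching_def by auto
        have cJ: "card ?J = card J1 + card J2 + 1"
        proof -
          have "r \<notin> J1 \<union> J2" "finite (J1 \<union> J2)" using J12 disj fin by (auto intro: finite_subset)
          then show ?thesis using JUn(2)[OF J12 U(3) W(3)] by simp
        qed
        have cB: "card ?B \<le> card ?J" using card_Un_le[of Bu Bd] U(4) W(4) cJ by simp
        have R1Y: "\<forall>v \<in> ?R1. forced N Y v" if "I \<union> ?B \<subseteq> Y" for Y using U(5) that forced_mono[of N "I \<union> Bu" _ Y] by blast
        have rY: "forced N Y r" if "I \<union> ?B \<subseteq> Y" for Y using step1[OF R1Y[OF that]] that by blast
        have all: "\<forall>v \<in> insert r (?R1 \<union> ?R2). forced N Y v" if Y: "I \<union> ?B \<subseteq> Y" "forced N Y p" for Y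
        proof -
          have "forced N Y r1" using R1Y[OF Y(1)] by blast
          then have "forced N Y r2" by (intro down[OF rY[OF Y(1)] refl Y(2)])
          then have "\<forall>v \<in> ?R2. forced N Y v" using W(5) Y rY[OF Y(1)] by blast
          then show ?thesis using R1Y[OF Y(1)] rY[OF Y(1)] by blast
        qed
        have sub: "?B \<subseteq> insert r (?R1 \<union> ?R2)" "?J \<subseteq> insert r (?R1 \<union> ?R2)" using U(1) W(1) J12 by blast+
        have "closed_type N I p r (insert r (?R1 \<union> ?R2))" by (rule closed_typeI[OF sub J cB rY[OF order_refl] all])
        then show ?thesis by blast
      next
        case 2
        obtain Bu Bd J1 where U: "Bu \<subseteq> ?R1" "Bd \<subseteq> ?R1" "J1 \<subseteq> ?R1 - {r1}" "isolated_branching N I J1"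
           "card Bu \<le> card J1 + 1" "card Bd \<le> card J1" "\<forall>v \<in> ?R1. forced N (I \<union> Bu) v"
           "\<forall>Y. I \<union> Bd \<subseteq> Y \<longrightarrow> forced N Y r1 \<longrightarrow> forced N Y r \<longrightarrow> (\<forall>v \<in> ?R1. forced N Y v)"
          by (rule through_typeE[OF 2(1)])
        obtain B J2 where W: "B \<subseteq> ?R2" "J2 \<subseteq> ?R2" "isolated_branching N I J2" "card B \<le> card J2"
           "forced N (I \<union> B) r2" "\<forall>Y. I \<union> B \<subseteq> Y \<longrightarrow> forced N Y r \<longrightarrow> (\<forall>v \<in> ?R2. forced N Y v)"
          by (rule closed_typeE[OF 2(2)])
        have J12: "J1 \<subseteq> ?R1" "J2 \<subseteq> ?R2" using U(3) W(2) by auto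
        note J = JUn[OF J12 U(4) W(3)]
        have c1: "card (Bu \<union> B) \<le> card (J1 \<union> J2) + 1" using card_Un_le[of Bu B] U(5) W(4) J(2) by simp
        have c2: "card (Bd \<union> B) \<le> card (J1 \<union> J2)" using card_Un_le[of Bd B] U(6) W(4) J(2) by simp
        have f1: "\<forall>v \<in> insert r (?R1 \<union> ?R2). forced N (I \<union> (Bu \<union> B)) v"
        proof -
          have a: "\<forall>v \<in> ?R1. forced N (I \<union> (Bu \<union> B)) v"
            using U(7) forced_mono[of N "I \<union> Bu" _ "I \<union> (Bu \<union> B)"] by blast
          have b: "forced N (I \<union> (Bu \<union> B)) r" using step1[OF a] by blast
          have ib: "I \<union> B \<subseteq> I \<union> (Bu \<union> B)" by blast
          have "\<forall>v \<in> ?R2. forced N (I \<union> (Bu \<union> B)) v" by (intro ballI W(6)[rule_format, OF ib b])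
          then show ?thesis using a b by blast
        qed
        have f2: "\<forall>v \<in> insert r (?R1 \<union> ?R2). forced N Y v" if Y: "I \<union> (Bd \<union> B) \<subseteq> Y" "forced N Y r" "forced N Y p" for Y
        proof -
          have yb: "I \<union> B \<subseteq> Y" "I \<union> Bd \<subseteq> Y" using Y(1) by blast+
          have a: "\<forall>v \<in> ?R2. forced N Y v" by (intro ballI W(6)[rule_format, OF yb(1) Y(2)])
          then have fr2: "forced N Y r2" by blast
          have "{p, r1, r2} = {p, r2, r1}" by blast
          from down[OF Y(2) this Y(3) fr2] have fr1: "forced N Y r1" .
          have "\<forall>v \<in> ?R1. forced N Y v" by (intro ballI U(8)[rule_format, OF yb(2) fr1 Y(2)])
          then show ?thesis using a Y by blast
        qed
        have sub: "Bu \<union> B \<subseteq> insert r (?R1 \<union> ?R2)" "Bd \<union> B \<subseteq> insert r (?R1 \<union> ?R2)" "J1 \<union> J2 \<subseteq> insert r (?R1 \<union> ?R2) - {r}"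
          using U(1,2) W(1) J12 disj by blast+
        have "through_type N I p r (insert r (?R1 \<union> ?R2))" by (rule through_typeI[OF sub J(1) c1 c2 f1 f2])
        then show ?thesis by blast
      next
        case 3
        obtain Bu Bd J1 where U: "Bu \<subseteq> ?R2" "Bd \<subseteq> ?R2" "J1 \<subseteq> ?R2 - {r2}" "isolated_branching N I J1"
           "card Bu \<le> card J1 + 1" "card Bd \<le> card J1" "\<forall>v \<in> ?R2. forced N (I \<union> Bu) v"
           "\<forall>Y. I \<union> Bd \<subseteq> Y \<longrightarrow> forced N Y r2 \<longrightarrow> forced N Y r \<longrightarrow> (\<forall>v \<in> ?R2. forced N Y v)"
          by (rule through_typeE[OF 3(2)])
        obtain B J2 where W: "B \<subseteq> ?R1" "J2 \<subseteq> ?R1" "isolated_branching N I J2" "card B \<le> card J2"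
           "forced N (I \<union> B) r1" "\<forall>Y. I \<union> B \<subseteq> Y \<longrightarrow> forced N Y r \<longrightarrow> (\<forall>v \<in> ?R1. forced N Y v)"
          by (rule closed_typeE[OF 3(1)])
        have J12: "J2 \<subseteq> ?R1" "J1 \<subseteq> ?R2" using U(3) W(2) by auto
        note J = JUn[OF J12 W(3) U(4)]
        have c1: "card (Bu \<union> B) \<le> card (J2 \<union> J1) + 1" using card_Un_le[of Bu B] U(5) W(4) J(2) by simp
        have c2: "card (Bd \<union> B) \<le> card (J2 \<union> J1)" using card_Un_le[of Bd B] U(6) W(4) J(2) by simp
        have f1: "\<forall>v \<in> insert r (?R1 \<union> ?R2). forced N (I \<union> (Bu \<union> B)) v"
        proof -
          have a: "\<forall>v \<in> ?R2. forced N (I \<union> (Bu \<union> B)) v"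
            using U(7) forced_mono[of N "I \<union> Bu" _ "I \<union> (Bu \<union> B)"] by blast
          have b: "forced N (I \<union> (Bu \<union> B)) r" using step2[OF a] by blast
          have ib: "I \<union> B \<subseteq> I \<union> (Bu \<union> B)" by blast
          have "\<forall>v \<in> ?R1. forced N (I \<union> (Bu \<union> B)) v" by (intro ballI W(6)[rule_format, OF ib b])
          then show ?thesis using a b by blast
        qed
        have f2: "\<forall>v \<in> insert r (?R1 \<union> ?R2). forced N Y v" if Y: "I \<union> (Bd \<union> B) \<subseteq> Y" "forced N Y r" "forced N Y p" for Y
        proof -
          have yb: "I \<union> B \<subseteq> Y" "I \<union> Bd \<subseteq> Y" using Y(1) by blast+
          have a: "\<forall>v \<in> ?R1. forced N Y v" by (intro ballI W(6)[rule_format, OF yb(1) Y(2)])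
          then have fr1: "forced N Y r1" by blast
          from down[OF Y(2) refl Y(3) fr1] have fr2: "forced N Y r2" .
          have "\<forall>v \<in> ?R2. forced N Y v" by (intro ballI U(8)[rule_format, OF yb(2) fr2 Y(2)])
          then show ?thesis using a Y by blast
        qed
        have sub: "Bu \<union> B \<subseteq> insert r (?R1 \<union> ?R2)" "Bd \<union> B \<subseteq> insert r (?R1 \<union> ?R2)" "J2 \<union> J1 \<subseteq> insert r (?R1 \<union> ?R2) - {r}"
          using U(1,2) W(1) J12 disj by blast+
        have "through_type N I p r (insert r (?R1 \<union> ?R2))" by (rule through_typeI[OF sub J(1) c1 c2 f1 f2])
        then show ?thesis by blast
      next
        case 4
        obtain B1 J1 where U: "B1 \<subseteq> ?R1" "J1 \<subseteq> ?R1" "isolated_branching N I J1" "card B1 \<le> card J1"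
           "forced N (I \<union> B1) r1" "\<forall>Y. I \<union> B1 \<subseteq> Y \<longrightarrow> forced N Y r \<longrightarrow> (\<forall>v \<in> ?R1. forced N Y v)"
          by (rule closed_typeE[OF 4(1)])
        obtain B2 J2 where W: "B2 \<subseteq> ?R2" "J2 \<subseteq> ?R2" "isolated_branching N I J2" "card B2 \<le> card J2"
           "forced N (I \<union> B2) r2" "\<forall>Y. I \<union> B2 \<subseteq> Y \<longrightarrow> forced N Y r \<longrightarrow> (\<forall>v \<in> ?R2. forced N Y v)"
          by (rule closed_typeE[OF 4(2)])
        note J = JUn[OF U(2) W(2) U(3) W(3)]
        have c2: "card (B1 \<union> B2) \<le> card (J1 \<union> J2)" using card_Un_le[of B1 B2] U(4) W(4) J(2) by simp
        have c1: "card (insert r (B1 \<union> B2)) \<le> card (J1 \<union> J2) + 1"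
          using c2 card_insert_le_m1[of "card (J1 \<union> J2) + 1" "B1 \<union> B2" r] by simp
        have f2: "\<forall>v \<in> insert r (?R1 \<union> ?R2). forced N Y v" if Y: "I \<union> (B1 \<union> B2) \<subseteq> Y" "forced N Y r" for Y
        proof -
          have yb: "I \<union> B1 \<subseteq> Y" "I \<union> B2 \<subseteq> Y" using Y(1) by blast+
          show ?thesis using U(6)[rule_format, OF yb(1) Y(2)] W(6)[rule_format, OF yb(2) Y(2)] Y(2) by auto
        qed
        have f1: "\<forall>v \<in> insert r (?R1 \<union> ?R2). forced N (I \<union> insert r (B1 \<union> B2)) v"
          by (rule f2) (auto intro: forced.initial)
        have sub: "insert r (B1 \<union> B2) \<subseteq> insert r (?R1 \<union> ?R2)" "B1 \<union> B2 \<subseteq> insert r (?R1 \<union> ?R2)" "J1 \<union> J2 \<subseteq> insert r (?R1 \<union> ?R2) - {r}"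
          using U(1,2) W(1,2) disj by blast+
        have "through_type N I p r (insert r (?R1 \<union> ?R2))" by (rule through_typeI[OF sub J(1) c1 c2 f1 f2])
        then show ?thesis by blast
      qed
      then show ?thesis using RR by simp
    qed
  qed
qed

text \<open>Hang the tree on one of its vertices. The single surplus vertex of \<open>B\<close>
starts the process at the root.\<close>
lemma tree_forcing:
  fixes N :: "'v \<Rightarrow> 'v set"
  assumes t: "tree_on R T" and N3: "\<And>x. finite (N x) \<and> card (N x) \<le> 3"
    and TN: "\<And>x y. (x,y) \<in> T \<Longrightarrow> y \<in> N x"
    and NT: "\<And>x y. x \<in> R \<Longrightarrow> y \<in> N x \<Longrightarrow> y \<in> I \<or> (x,y) \<in> T" and RI: "R \<inter> I = {}"
  obtains B J where "B \<subseteq> R" "J \<subseteq> R" "isolated_branching N I J" "card B \<le> card J + 1" "\<forall>v \<in> R. forced N (I \<union> B) v"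
proof -
  note Bs = tree_on_basic[OF t]
  from t show thesis
  proof (cases rule: tree_on.cases)
    case (single r)
    show ?thesis
      by (rule that[of "{r}" "{}"]) (use single in \<open>auto simp: isolated_branching_def intro: forced.initial\<close>)
  next
    case (leaf V T' u v)
    have h: "hanging u (V - {u}) T'" by (rule tree_on_hanging[OF leaf(3,4)])
    have V: "insert u (V - {u}) = V" using leaf by auto
    note B' = tree_on_basic[OF leaf(3)]
    have "through_type N I v u (insert u (V - {u})) \<or> closed_type N I v u (insert u (V - {u}))"
    proof (rule hanging_types[OF h])
      show "v \<notin> insert u (V - {u})" using leaf by auto
      show "v \<in> N u" using TN leaf by auto
      show "finite (N x) \<and> card (N x) \<le> 3" for x by (rule N3)
      show "y \<in> N x" if "(x,y) \<in> T'" for x y using TN leaf that by auto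
      show "y \<in> I \<or> (x,y) \<in> T' \<or> x = u \<and> y = v" if "x \<in> insert u (V - {u})" "y \<in> N x" for x y
        using NT[of x y] that leaf by auto
      show "insert v (insert u (V - {u})) \<inter> I = {}" using RI leaf by auto
    qed
    then show ?thesis
    proof
      assume "through_type N I v u (insert u (V - {u}))"
      then have "through_type N I v u V" unfolding V .
      then obtain B J where U: "B \<subseteq> V" "J \<subseteq> V" "isolated_branching N I J" "card B \<le> card J + 1" "\<forall>x \<in> V. forced N (I \<union> B) x"
        by (rule through_typeE) blast
      have "forced N (I \<union> B) v"
      proof (rule forced.force[of _ _ u])
        show "forced N (I \<union> B) u" using U leaf by blast
        show "v \<in> N u" using TN leaf by auto
        fix x assume x: "x \<in> N u - {v}"
        then have "x \<in> I \<or> (u,x) \<in> T'" using NT[of u x] leaf by auto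
        then show "forced N (I \<union> B) x" using U(5) B' by (auto intro: forced.initial)
      qed
      then show ?thesis using that[of B J] U leaf by auto
    next
      assume "closed_type N I v u (insert u (V - {u}))"
      then have "closed_type N I v u V" unfolding V .
      then obtain B J where U: "B \<subseteq> V" "J \<subseteq> V" "isolated_branching N I J" "card B \<le> card J"
         "forced N (I \<union> B) u" "\<forall>Y. I \<union> B \<subseteq> Y \<longrightarrow> forced N Y v \<longrightarrow> (\<forall>x \<in> V. forced N Y x)"
        by (rule closed_typeE)
      have fv: "forced N (I \<union> insert v B) v" by (rule forced.initial) simp
      have "I \<union> B \<subseteq> I \<union> insert v B" by blast
      then have "\<forall>x \<in> V. forced N (I \<union> insert v B) x" using U(6) fv by blast
      moreover have "card (insert v B) \<le> card J + 1" using U(4) card_insert_le_m1[of "card J + 1" B v] by simp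
      ultimately show ?thesis using that[of "insert v B" J] U fv leaf by auto
    qed
  qed
qed

section \<open>From face tracing to a single face word\<close>

lemma orbit_word:
  fixes f :: "'a \<Rightarrow> 'a"
  assumes A: "finite A" "f ` A \<subseteq> A" "inj_on f A" "a \<in> A"
  obtains W where "distinct W" "W \<noteq> []" "a \<in> set W" "set W \<subseteq> A" "\<And>x y. (x,y) \<in> cyc W \<Longrightarrow> y = f x"
proof -
  have inA: "(f ^^ i) a \<in> A" for i by (induction i) (use A in auto)
  have cancel: "(f ^^ j) a = a" if "(f ^^ (i + j)) a = (f ^^ i) a" for i j
    using that
  proof (induction i)
    case (Suc i)
    then have "f ((f ^^ (i + j)) a) = f ((f ^^ i) a)" by simp
    then show ?case using Suc.IH inj_onD[OF A(3)] inA by blast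
  qed simp
  have "\<not> inj (\<lambda>i. (f ^^ i) a)"
    using A(1) inA by (meson finite_subset image_subset_iff infinite_UNIV_nat inj_on_finite)
  then obtain i j where "i < j" "(f ^^ i) a = (f ^^ j) a" unfolding inj_on_def by (metis linorder_neqE_nat)
  then have ex: "\<exists>n. 0 < n \<and> (f ^^ n) a = a" using cancel[of i "j - i"] by (intro exI[of _ "j - i"]) auto
  define n where "n = (LEAST n. 0 < n \<and> (f ^^ n) a = a)"
  have n: "0 < n" "(f ^^ n) a = a" using LeastI_ex[OF ex] unfolding n_def by auto
  have least: "(f ^^ m) a \<noteq> a" if "0 < m" "m < n" for m
    using not_less_Least[of m "\<lambda>n. 0 < n \<and> (f ^^ n) a = a"] that unfolding n_def by auto
  define g where "g i = (f ^^ i) a" for i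
  define W where "W = map g [0..<n]"
  have Wne: "W \<noteq> []" using n by (simp add: W_def)
  have hdW: "hd W = a" using n by (simp add: W_def g_def hd_map)
  have "inj_on g {0..<n}"
  proof (rule linorder_inj_onI)
    fix i j assume ij: "i < j" "i \<in> {0..<n}" "j \<in> {0..<n}"
    show "g i \<noteq> g j"
    proof
      assume "g i = g j"
      then have "(f ^^ (i + (j - i))) a = (f ^^ i) a" using ij by (simp add: g_def)
      moreover have "0 < j - i" "j - i < n" using ij by (simp, simp add: less_imp_diff_less)
      ultimately show False using cancel[of i "j - i"] least[of "j - i"] by blast
    qed
  qed auto
  then have dW: "distinct W" by (simp add: W_def distinct_map)
  have lin: "y = f x" if "(x,y) \<in> lin (map g [0..<Suc m])" for x y m
    using that
  proof (induction m)
    case (Suc m)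
    have split: "map g [0..<Suc (Suc m)] = map g [0..<Suc m] @ [g (Suc m)]" by simp
    have ne: "map g [0..<Suc m] \<noteq> []" and last: "last (map g [0..<Suc m]) = g m" by simp_all
    have "(x,y) = (g m, g (Suc m)) \<or> (x,y) \<in> lin (map g [0..<Suc m])"
      using Suc.prems unfolding split lin_snoc[OF ne] last by blast
    moreover have "g (Suc m) = f (g m)" by (simp add: g_def)
    ultimately show ?case using Suc.IH by auto
  qed simp
  have gn: "g n = a" using n by (simp add: g_def)
  have "cyc W = lin (W @ [hd W])" using Wne by (cases W) (auto simp: cyc_def)
  also have "W @ [hd W] = map g [0..<Suc n]" unfolding hdW by (simp add: W_def gn)
  finally have cycW: "cyc W = lin (map g [0..<Suc n])" .
  show thesis
  proof (rule that[OF dW Wne])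
    show "a \<in> set W" using hdW Wne hd_in_set by metis
    show "set W \<subseteq> A" using inA by (auto simp: W_def g_def)
    show "y = f x" if "(x,y) \<in> cyc W" for x y using lin that unfolding cycW by blast
  qed
qed

lemma orbit_word_closed:
  assumes "distinct W" "\<And>x y. (x,y) \<in> cyc W \<Longrightarrow> y = f x"
  shows "x \<in> set W \<Longrightarrow> f x \<in> set W"
    and "inj_on f A \<Longrightarrow> set W \<subseteq> A \<Longrightarrow> x \<in> A \<Longrightarrow> f x \<in> set W \<Longrightarrow> x \<in> set W"
proof -
  show "f x \<in> set W" if x: "x \<in> set W"
  proof -
    obtain y where y: "(x,y) \<in> cyc W" using cyc_functional(5)[OF assms(1) x] by blast
    then show ?thesis using assms(2)[OF y] cyc_functional(3)[OF assms(1) y] by simp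
  qed
  show "x \<in> set W" if x: "inj_on f A" "set W \<subseteq> A" "x \<in> A" "f x \<in> set W"
  proof -
    obtain z where z: "(z, f x) \<in> cyc W" using cyc_functional(4)[OF assms(1) x(4)] by blast
    have "z \<in> set W" using cyc_functional(3)[OF assms(1) z] by blast
    moreover have "f x = f z" using assms(2)[OF z] .
    ultimately show ?thesis using inj_onD[OF x(1)] x(2,3) by blast
  qed
qed

locale face_traced =
  fixes A :: "('v \<times> 'v) set" and V :: "'v set" and f
  assumes fin: "finite A" and AV: "A \<subseteq> V \<times> V" and sym: "a \<in> A \<Longrightarrow> prod.swap a \<in> A" and loopfree: "a \<in> A \<Longrightarrow> fst a \<noteq> snd a"
    and cubic: "v \<in> V \<Longrightarrow> card (star A v) = 3"
    and conn: "X \<subseteq> V \<Longrightarrow> X \<noteq> {} \<Longrightarrow> (\<And>u v. (u,v) \<in> A \<Longrightarrow> u \<in> X \<Longrightarrow> v \<in> X) \<Longrightarrow> X = V"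
    and f: "f ` A \<subseteq> A" "inj_on f A" and f_head: "a \<in> A \<Longrightarrow> fst (f a) = snd a" and f_turn: "a \<in> A \<Longrightarrow> f a \<noteq> prod.swap a"
    and nonempty: "V \<noteq> {}"
begin

lemma card_star: "card (star A v) \<le> 3"
proof (cases "v \<in> V")
  case False
  then have "star A v = {}" using AV by auto
  then show ?thesis by (metis card.empty le0)
qed (use cubic in simp)

lemma V_arcs: "fst ` A = V"
proof
  show "fst ` A \<subseteq> V" using AV by auto
  show "V \<subseteq> fst ` A"
  proof
    fix v assume "v \<in> V"
    then have "card (star A v) = 3" by (rule cubic)
    then have "star A v \<noteq> {}" by (metis card.empty zero_neq_numeral)
    then show "v \<in> fst ` A" by force
  qed
qed

lemma nonempty_arcs: "A \<noteq> {}" using V_arcs nonempty by blast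

lemma one_face_word:
  assumes W: "distinct W" "set W = A" "\<And>x y. (x,y) \<in> cyc W \<Longrightarrow> y = f x"
  shows "face_word W"
  unfolding face_word_def
proof (intro conjI allI impI ballI)
  show "distinct W" by (rule W(1))
  show "prod.swap a \<in> set W" "fst a \<noteq> snd a" if "a \<in> set W" for a using that sym loopfree W(2) by auto
  show "snd a = fst b" if "(a,b) \<in> cyc W" for a b
    using W(3)[OF that] f_head cyc_functional(3)[OF W(1) that] W(2) by metis
  show "star (set W) (snd a) \<subseteq> {prod.swap a}" if "(a, prod.swap a) \<in> cyc W" for a
    using W(3)[OF that] f_turn cyc_functional(3)[OF W(1) that] W(2) by metis
  show "card (star (set W) v) \<le> 3" for v using card_star W(2) by simp
qed

lemma no_degree_two:
  assumes "x \<in> A" "e \<in> A" "f x = e" "f (prod.swap e) = prod.swap x"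
  shows False
proof -
  let ?R = "{(a, b). a \<in> A \<and> b = f a}"
  have onto: "\<exists>a. (a, b) \<in> ?R" if "b \<in> A" for b
  proof -
    have "b \<in> f ` A" using that endo_inj_surj[OF fin f] by simp
    then show ?thesis by auto
  qed
  have "star A (fst e) \<subseteq> {e, prod.swap x}"
  proof (rule backtrack_degree_two[of ?R A x e])
    show "b = b'" if "(a,b) \<in> ?R" "(a,b') \<in> ?R" for a b b' using that by simp
    show "\<And>a b. (a,b) \<in> ?R \<Longrightarrow> a \<in> A \<and> b \<in> A \<and> snd a = fst b" using f f_head by auto
    show "\<And>b. b \<in> A \<Longrightarrow> \<exists>a. (a,b) \<in> ?R" using onto .
    show "star A (snd a) \<subseteq> {prod.swap a}" if "(a, prod.swap a) \<in> ?R" for a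
    proof -
      have "a \<in> A" "f a = prod.swap a" using that by auto
      then show ?thesis using f_turn[of a] by simp
    qed
    show "(x, e) \<in> ?R" "(prod.swap e, prod.swap x) \<in> ?R" using assms sym[OF assms(2)] by simp_all
  qed (use fin sym card_star in auto)
  then have "card (star A (fst e)) \<le> card {e, prod.swap x}" by (intro card_mono) auto
  also have "\<dots> \<le> 2" by (simp add: card_insert_if)
  finally show False using cubic[of "fst e"] AV assms(2) by auto
qed

text \<open>Deleting an edge that lies on both faces merges the two facial walks into one.\<close>
lemma two_face_word:
  assumes W1: "distinct W1" "\<And>x y. (x,y) \<in> cyc W1 \<Longrightarrow> y = f x" and W2: "distinct W2" "\<And>x y. (x,y) \<in> cyc W2 \<Longrightarrow> y = f x"
    and W: "set W1 \<union> set W2 = A" "set W1 \<inter> set W2 = {}" and eq: "W1 = e # A1" "W2 = prod.swap e # B1"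
  shows "face_word (A1 @ B1) \<and> set (A1 @ B1) = A - {e, prod.swap e} \<and> A1 @ B1 \<noteq> []"
proof -
  let ?e = "prod.swap e"
  have eA: "e \<in> A" "?e \<in> A" using W eq by auto
  have A1: "A1 \<noteq> []"
  proof
    assume "A1 = []"
    then have "(e,e) \<in> cyc W1" using eq by (simp add: cyc_def)
    then show False using W1(2) f_head[OF eA(1)] loopfree[OF eA(1)] by metis
  qed
  have B1: "B1 \<noteq> []"
  proof
    assume "B1 = []"
    then have "(?e,?e) \<in> cyc W2" using eq by (simp add: cyc_def)
    then show False using W2(2) f_head[OF eA(2)] loopfree[OF eA(2)] by metis
  qed
  have j: "f e = hd A1" "f (last A1) = e" "f ?e = hd B1" "f (last B1) = ?e"
    using W1(2)[of e "hd A1"] W1(2)[of "last A1" e] W2(2)[of ?e "hd B1"] W2(2)[of "last B1" ?e]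
      cyc_two[of "[e]" A1] cyc_two[of "[?e]" B1] A1 B1 eq by auto
  have lins: "y = f x" if "(x,y) \<in> lin A1 \<union> lin B1" for x y
    using that W1(2)[of x y] W2(2)[of x y] lin_in_cyc[of W1 "[e]" A1 "[]"] lin_in_cyc[of W2 "[?e]" B1 "[]"] eq by auto
  have ins: "set A1 \<subseteq> A" "set B1 \<subseteq> A" using W eq by auto
  have inA: "last A1 \<in> A" "last B1 \<in> A" "hd A1 \<in> A" "hd B1 \<in> A" using ins A1 B1 by auto
  have set': "set (A1 @ B1) = A - {e, ?e}" using W W1(1) W2(1) eq by auto
  have cyc': "cyc (A1 @ B1) = lin A1 \<union> lin B1 \<union> {(last A1, hd B1), (last B1, hd A1)}" by (rule cyc_two[OF A1 B1])
  have dist: "distinct (A1 @ B1)" using W1(1) W2(1) W eq by auto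
  have "face_word (A1 @ B1)"
    unfolding face_word_def
  proof (intro conjI allI impI ballI)
    show "distinct (A1 @ B1)" by (rule dist)
    fix a assume a: "a \<in> set (A1 @ B1)"
    then have aA: "a \<in> A" "a \<notin> {e, ?e}" unfolding set' by blast+
    then show "fst a \<noteq> snd a" using loopfree by blast
    have "prod.swap a \<notin> {e, ?e}" using aA(2) by (cases a; cases e) auto
    then show "prod.swap a \<in> set (A1 @ B1)" unfolding set' using sym[OF aA(1)] by blast
  next
    fix a b assume ab: "(a,b) \<in> cyc (A1 @ B1)"
    have aA: "a \<in> A" using cyc_functional(3)[OF dist ab] set' by blast
    from ab consider "(a,b) \<in> lin A1 \<union> lin B1" | "a = last A1" "b = hd B1" | "a = last B1" "b = hd A1" unfolding cyc' by blast
    then show "snd a = fst b"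
    proof cases
      case 1 then show ?thesis using lins f_head[OF aA] by metis
    next
      case 2
      then show ?thesis using f_head[OF inA(1)] f_head[OF eA(2)] j by simp
    next
      case 3
      then show ?thesis using f_head[OF inA(2)] f_head[OF eA(1)] j by simp
    qed
  next
    fix a assume ab: "(a, prod.swap a) \<in> cyc (A1 @ B1)"
    have aA: "a \<in> A" using cyc_functional(3)[OF dist ab] set' by blast
    from ab consider "(a,prod.swap a) \<in> lin A1 \<union> lin B1" | "a = last A1" "prod.swap a = hd B1" | "a = last B1" "prod.swap a = hd A1"
      unfolding cyc' by blast
    then have False
    proof cases
      case 1 then show ?thesis using lins f_turn[OF aA] by metis
    next
      case 2 then show ?thesis using no_degree_two[OF aA eA(1)] j by simp
    next
      case 3 then show ?thesis using no_degree_two[OF aA eA(2)] j by simp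
    qed
    then show "star (set (A1 @ B1)) (snd a) \<subseteq> {prod.swap a}" by blast
  next
    fix v
    have "card (star (set (A1 @ B1)) v) \<le> card (star A v)" by (rule card_mono) (use set' fin in auto)
    then show "card (star (set (A1 @ B1)) v) \<le> 3" using card_star[of v] by simp
  qed
  then show ?thesis using set' A1 by blast
qed

text \<open>An orbit that contains the reverse of each of its arcs contains all arcs at its
vertices, since the vertices have degree three; by connectedness it is everything. Hence with two
orbits, some edge lies on both.\<close>
lemma orbit_not_swap_closed:
  assumes W: "W \<subseteq> A" "W \<noteq> {}" "W \<noteq> A" "\<And>x. x \<in> W \<Longrightarrow> f x \<in> W" "\<And>x. x \<in> A \<Longrightarrow> f x \<in> W \<Longrightarrow> x \<in> W"
  shows "\<exists>e \<in> W. prod.swap e \<notin> W"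
proof (rule ccontr)
  assume "\<not> ?thesis"
  then have sw: "prod.swap e \<in> W" if "e \<in> W" for e using that by blast
  have star: "star A u \<subseteq> W" if x: "x \<in> W" "fst x = u" for x u
  proof
    fix z assume z: "z \<in> star A u"
    show "z \<in> W"
    proof (rule ccontr)
      assume zW: "z \<notin> W"
      let ?r = "\<lambda>y. f (prod.swap y)"
      have r: "?r y \<in> star A u" "?r y \<noteq> y" if "y \<in> star A u" for y
      proof -
        have "prod.swap y \<in> A" using that sym by blast
        then have "?r y \<in> A" "fst (?r y) = fst y" "?r y \<noteq> y"
          using f(1) f_head[of "prod.swap y"] f_turn[of "prod.swap y"] by auto
        then show "?r y \<in> star A u" "?r y \<noteq> y" using that by simp_all
      qed
      have xs: "x \<in> star A u" using x W(1) by blast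
      have "?r x \<in> W" using W(4) sw x by blast
      moreover have "?r z \<notin> W"
      proof
        assume "?r z \<in> W"
        then have "prod.swap z \<in> W" using W(5) sym z by blast
        then show False using sw[of "prod.swap z"] zW by simp
      qed
      ultimately have "card {x, ?r x, z, ?r z} = 4" using r(2)[OF xs] r(2)[OF z] x zW by (auto simp: card_insert_if)
      moreover have "{x, ?r x, z, ?r z} \<subseteq> star A u" using r(1)[OF xs] r(1)[OF z] xs z by blast
      then have "card {x, ?r x, z, ?r z} \<le> card (star A u)" using fin by (intro card_mono) auto
      ultimately show False using card_star[of u] by simp
    qed
  qed
  have "fst ` W = V"
  proof (rule conn)
    show "fst ` W \<subseteq> V" using W(1) AV by auto
    show "fst ` W \<noteq> {}" using W(2) by blast
    fix u v assume uv: "(u,v) \<in> A" "u \<in> fst ` W"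
    then have "(u,v) \<in> W" using star by force
    then have "(v,u) \<in> W" using sw by force
    then show "v \<in> fst ` W" by force
  qed
  moreover have "A \<subseteq> W"
  proof
    fix a assume a: "a \<in> A"
    then have "a \<in> V \<times> V" using AV by blast
    then have "fst a \<in> fst ` W" using calculation by (simp only: mem_Times_iff)
    then show "a \<in> W" using star a by blast
  qed
  ultimately show False using W(1,3) by blast
qed

text \<open>The indicator functions of orbits are invariant; with at most two invariant values there
are at most two orbits.\<close>
lemma face_words:
  assumes k: "\<And>h :: 'v \<times> 'v \<Rightarrow> nat. (\<forall>a \<in> A. h (f a) = h a) \<Longrightarrow> card (h ` A) \<le> k" and "k = 1 \<or> k = 2"
  shows "(\<exists>W. face_word W \<and> set W = A \<and> W \<noteq> []) \<or>
     (k = 2 \<and> (\<exists>W e. e \<in> A \<and> face_word W \<and> set W = A - {e, prod.swap e} \<and> W \<noteq> []))"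
proof -
  obtain a where a: "a \<in> A" using nonempty_arcs by blast
  obtain W1 where W1: "distinct W1" "W1 \<noteq> []" "a \<in> set W1" "set W1 \<subseteq> A" "\<And>x y. (x,y) \<in> cyc W1 \<Longrightarrow> y = f x"
    using orbit_word[OF fin f a] by blast
  have cl1: "x \<in> set W1 \<Longrightarrow> f x \<in> set W1" "x \<in> A \<Longrightarrow> f x \<in> set W1 \<Longrightarrow> x \<in> set W1" for x
    using orbit_word_closed(1)[of W1 f x] orbit_word_closed(2)[of W1 f A x] W1(1,4,5) f(2) by blast+
  show ?thesis
  proof (cases "set W1 = A")
    case True
    then show ?thesis using one_face_word[OF W1(1) True W1(5)] W1(2) by blast
  next
    case False
    then obtain b where b: "b \<in> A" "b \<notin> set W1" using W1(4) by blast
    obtain W2 where W2: "distinct W2" "W2 \<noteq> []" "b \<in> set W2" "set W2 \<subseteq> A" "\<And>x y. (x,y) \<in> cyc W2 \<Longrightarrow> y = f x"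
      using orbit_word[OF fin f b(1)] by blast
    have cl2: "x \<in> set W2 \<Longrightarrow> f x \<in> set W2" "x \<in> A \<Longrightarrow> f x \<in> set W2 \<Longrightarrow> x \<in> set W2" for x
    using orbit_word_closed(1)[of W2 f x] orbit_word_closed(2)[of W2 f A x] W2(1,4,5) f(2) by blast+
    define h :: "'v \<times> 'v \<Rightarrow> nat" where "h x = (if x \<in> set W1 then 0 else if x \<in> set W2 then 1 else 2)" for x
    have "h (f x) = h x" if x: "x \<in> A" for x
    proof -
      have "f x \<in> set W1 \<longleftrightarrow> x \<in> set W1" using cl1 x by blast
      moreover have "f x \<in> set W2 \<longleftrightarrow> x \<in> set W2" using cl2 x by blast
      ultimately show ?thesis by (simp add: h_def)
    qed
    then have hk: "card (h ` A) \<le> k" using k by blast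
    have h01: "{0, 1} \<subseteq> h ` A"
    proof -
      have "h a = 0" "h b = 1" using W1(3) W2(3) b by (auto simp: h_def)
      then show ?thesis using a b by (metis empty_subsetI imageI insert_subset)
    qed
    have finh: "finite (h ` A)" using fin by simp
    have "card {0, 1::nat} \<le> card (h ` A)" by (rule card_mono[OF finh h01])
    then have k2: "k = 2" using hk assms(2) by auto
    have h2: "{0,1} = h ` A"
      by (rule card_seteq[OF finh h01]) (use hk k2 in simp)
    have cover: "set W1 \<union> set W2 = A"
    proof
      show "set W1 \<union> set W2 \<subseteq> A" using W1(4) W2(4) by blast
      show "A \<subseteq> set W1 \<union> set W2"
      proof
        fix x assume "x \<in> A"
        then have "h x \<in> h ` A" by (rule imageI)
        then have "h x \<in> {0,1}" unfolding h2 .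
        then show "x \<in> set W1 \<union> set W2" unfolding h_def by (auto split: if_splits)
      qed
    qed
    have disj: "set W1 \<inter> set W2 = {}"
    proof (rule ccontr)
      assume "set W1 \<inter> set W2 \<noteq> {}"
      then obtain y where y: "y \<in> set W1" "y \<in> set W2" by blast
      have cW: "\<And>x. x \<in> set W1 \<inter> set W2 \<Longrightarrow> f x \<in> set W1 \<inter> set W2" using cl1(1) cl2(1) by blast
      obtain xs ys where W2e: "W2 = xs @ y # ys" using y(2) by (auto dest: split_list)
      have rot: "cyc W2 = cyc (y # ys @ xs)" unfolding W2e using cyc_rotate[of xs "y # ys"] by simp
      have all: "set (y # zs) \<subseteq> set W1" if "lin (y # zs) \<subseteq> {(x, w). w = f x}" "y \<in> set W1" for zs y
        using that
      proof (induction zs arbitrary: y)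
        case (Cons z zs)
        have zl: "(y, z) \<in> {(x, w). w = f x}" "lin (z # zs) \<subseteq> {(x, w). w = f x}"
          using Cons.prems(1) unfolding lin.simps by blast+
        then have z: "z \<in> set W1" using cl1(1)[OF Cons.prems(2)] by simp
        have "set (z # zs) \<subseteq> set W1" by (rule Cons.IH[OF zl(2) z])
        then show ?case using Cons.prems(2) by simp
      qed simp
      have "lin (y # ys @ xs) \<subseteq> cyc W2" unfolding rot using cyc_one[of "y # ys @ xs"] by auto
      then have "lin (y # ys @ xs) \<subseteq> {(x, w). w = f x}" using W2(5) by force
      then have "set (y # ys @ xs) \<subseteq> set W1" using all[of y "ys @ xs"] y(1) by blast
      then have "b \<in> set W1" using W2(3) unfolding W2e by auto
      then show False using b by blast
    qed
    have "\<exists>e \<in> set W1. prod.swap e \<notin> set W1"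
      by (rule orbit_not_swap_closed) (use W1 False cl1 in auto)
    then obtain e where e: "e \<in> set W1" "prod.swap e \<notin> set W1" by blast
    have eA: "e \<in> A" using e W1(4) by blast
    have e2: "prod.swap e \<in> set W2" using sym[OF eA] e cover by blast
    obtain xs ys where X: "W1 = xs @ e # ys" using e(1) by (auto dest: split_list)
    obtain xs' ys' where Y: "W2 = xs' @ prod.swap e # ys'" using e2 by (auto dest: split_list)
    have cX: "cyc (e # ys @ xs) = cyc W1" and cY: "cyc (prod.swap e # ys' @ xs') = cyc W2"
      unfolding X Y using cyc_rotate[of xs "e # ys"] cyc_rotate[of xs' "prod.swap e # ys'"] by simp_all
    have "face_word ((ys @ xs) @ (ys' @ xs')) \<and> set ((ys @ xs) @ (ys' @ xs')) = A - {e, prod.swap e} \<and> (ys @ xs) @ (ys' @ xs') \<noteq> []"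
    proof (rule two_face_word[of "e # ys @ xs" "prod.swap e # ys' @ xs'"])
      show "distinct (e # ys @ xs)" using W1(1) X by auto
      show "distinct (prod.swap e # ys' @ xs')" using W2(1) Y by auto
      show "\<And>x y. (x,y) \<in> cyc (e # ys @ xs) \<Longrightarrow> y = f x" using W1(5) unfolding cX .
      show "\<And>x y. (x,y) \<in> cyc (prod.swap e # ys' @ xs') \<Longrightarrow> y = f x" using W2(5) unfolding cY .
      show "set (e # ys @ xs) \<union> set (prod.swap e # ys' @ xs') = A" using cover X Y by auto
      show "set (e # ys @ xs) \<inter> set (prod.swap e # ys' @ xs') = {}" using disj X Y by auto
    qed simp_all
    then show ?thesis using k2 eA by blast
  qed
qed

end

section \<open>Zero forcing sets from spanning pairings\<close>

definition nbr :: "('v \<times> 'v) set \<Rightarrow> 'v \<Rightarrow> 'v set" where "nbr D v = {w. (v,w) \<in> D}"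

lemma card_nbr: "card (nbr D v) = card (star D v)"
proof -
  have "star D v = Pair v ` nbr D v" by (auto simp: nbr_def image_iff)
  moreover have "inj_on (Pair v) (nbr D v)" by (simp add: inj_on_def)
  ultimately show ?thesis by (simp add: card_image)
qed

text \<open>The vertices of \<open>K\<close> are leaves of the spanning tree, so \<open>T\<close>
restricted to the remaining vertices is a tree, and every cotree edge ends in \<open>K\<close>. Once
\<open>K\<close> is blue, forcing takes place along this tree only.\<close>
lemma pairing_forcing:
  assumes P: "spanning_pairing D T K" and D: "finite D" "\<And>a. a \<in> D \<Longrightarrow> prod.swap a \<in> D" "\<And>a. a \<in> D \<Longrightarrow> fst a \<noteq> snd a"
     "\<And>v. card (star D v) \<le> 3"
  obtains B J where "B \<subseteq> fst ` D" "J \<subseteq> fst ` D" "K \<subseteq> fst ` D" "K \<inter> J = {}" "card B \<le> card J + 1"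
    "\<forall>u \<in> K \<union> J. \<forall>v \<in> K \<union> J. (u,v) \<notin> D" "\<forall>u \<in> K \<union> J. card (star D u) = 3"
    "\<forall>v \<in> fst ` D. forced (nbr D) (K \<union> B) v"
proof -
  let ?V = "fst ` D"
  have TD: "T \<subseteq> D" and t: "tree_on ?V T" and KV: "K \<subseteq> ?V" and K2: "\<forall>v \<in> K. 2 \<le> card (star (D - T) v)"
    and cover: "\<forall>a \<in> D - T. fst a \<in> K \<or> snd a \<in> K" and KDT: "\<forall>u \<in> K. \<forall>v \<in> K. (u,v) \<notin> D - T"
    using P unfolding spanning_pairing_def by - (elim conjE, assumption)+
  have sndV: "snd a \<in> ?V" if "a \<in> D" for a
    using imageI[OF D(2)[OF that], of fst] by simp
  have ex: "\<exists>y. (v,y) \<in> T" if v: "v \<in> ?V" for v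
  proof -
    obtain a where a: "v = fst a" "a \<in> D" using v by (rule imageE)
    show ?thesis by (rule tree_on_neighbour[OF t v sndV[OF a(2)]]) (use D(3)[OF a(2)] a(1) in simp)
  qed
  have finT: "finite T" by (rule finite_subset[OF TD D(1)])
  have fins: "finite (star D v)" "finite (star (D - T) v)" "finite (star T v)" for v using D(1) finT by simp_all
  have one: "card (star T v) \<le> 1" and deg: "card (star D v) = 3" if v: "v \<in> K" for v
  proof -
    have "star D v = star T v \<union> star (D - T) v" using TD by blast
    moreover have "star T v \<inter> star (D - T) v = {}" by blast
    ultimately have sum: "card (star D v) = card (star T v) + card (star (D - T) v)"
      by (simp only: card_Un_disjoint[OF fins(3,2)])
    have two: "2 \<le> card (star (D - T) v)" using K2 v by blast
    have "v \<in> ?V" using KV v by blast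
    then obtain y where "(v,y) \<in> T" using ex by blast
    then have "star T v \<noteq> {}" by force
    then have "1 \<le> card (star T v)" using fins(3) by (simp add: Suc_leI card_gt_0_iff)
    then show "card (star T v) \<le> 1" "card (star D v) = 3" using sum two D(4)[of v] by linarith+
  qed
  have leaf: "y = y'" if v: "v \<in> K" and y: "(v,y) \<in> T" "(v,y') \<in> T" for v y y'
  proof -
    have "(v,y) \<in> star T v" "(v,y') \<in> star T v" using y by simp_all
    then have "(v,y) = (v,y')" using one[OF v] fins(3)[of v] card_le_Suc0_iff_eq[of "star T v"] by auto
    then show ?thesis by simp
  qed
  have KK: "(u,v) \<notin> T" if uv: "u \<in> K" "v \<in> K" for u v
  proof
    assume T: "(u,v) \<in> T"
    then have "(u,v) \<in> D" using TD by blast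
    then have ne: "u \<noteq> v" using D(3)[of "(u,v)"] by simp
    have V: "?V = {u,v}"
      by (rule tree_on_two_leaves[OF t T ne]) (fact leaf[OF uv(1)], fact leaf[OF uv(2)])
    have "star D u \<subseteq> {(u,v)}"
    proof
      fix a assume a: "a \<in> star D u"
      then have "a \<in> D" "fst a = u" by simp_all
      moreover from this have "snd a = v" using sndV[of a] D(3)[of a] V by auto
      ultimately show "a \<in> {(u,v)}" by (cases a) simp
    qed
    then have "card (star D u) \<le> card {(u,v)}" by (rule card_mono[rotated]) simp
    then show False using deg[OF uv(1)] by simp
  qed
  have finK: "finite K" by (rule finite_subset[OF KV]) (use D(1) in simp)
  let ?R = "?V - K"
  have tR: "tree_on ?R (T \<inter> ?R \<times> ?R)"
  proof (rule tree_on_remove_leaves[OF finK t order_refl KV])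
    show "y = y'" if "v \<in> K" "(v,y) \<in> T" "(v,y') \<in> T" for v y y' using leaf[OF that] .
    show "\<exists>y. y \<notin> K \<and> (v,y) \<in> T" if v: "v \<in> K" for v
    proof -
      have "v \<in> ?V" using KV v by blast
      then obtain y where "(v,y) \<in> T" using ex by blast
      then show ?thesis using KK[OF v] by blast
    qed
  qed
  have finN: "finite (nbr D x)" for x
  proof -
    have "nbr D x \<subseteq> snd ` D" by (force simp: nbr_def)
    then show ?thesis by (rule finite_subset) (use D(1) in simp)
  qed
  have nb3: "finite (nbr D x) \<and> card (nbr D x) \<le> 3" for x using finN D(4)[of x] by (simp add: card_nbr)
  obtain B J where BJ: "B \<subseteq> ?R" "J \<subseteq> ?R" "isolated_branching (nbr D) K J" "card B \<le> card J + 1"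
    "\<forall>v \<in> ?R. forced (nbr D) (K \<union> B) v"
  proof (rule tree_forcing[OF tR nb3])
    show "y \<in> nbr D x" if "(x,y) \<in> T \<inter> ?R \<times> ?R" for x y using that TD unfolding nbr_def by blast
    show "y \<in> K \<or> (x,y) \<in> T \<inter> ?R \<times> ?R" if x: "x \<in> ?R" "y \<in> nbr D x" for x y
    proof -
      have xy: "(x,y) \<in> D" using x by (simp add: nbr_def)
      have y: "y \<in> ?V" using sndV[OF xy] by simp
      have "(x,y) \<in> T \<or> y \<in> K" using bspec[OF cover, of "(x,y)"] xy x(1) by auto
      then show ?thesis using x(1) y by blast
    qed
    show "?R \<inter> K = {}" by blast
  qed
  have J3: "card (star D x) = 3" if "x \<in> J" for x
    using BJ(3) that unfolding isolated_branching_def card_nbr by blast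
  have JK: "(x,y) \<notin> D" if "x \<in> J" "y \<in> K \<union> J" for x y
    using BJ(3) that unfolding isolated_branching_def nbr_def by blast
  have ind: "(u,v) \<notin> D" if uv: "u \<in> K \<union> J" "v \<in> K \<union> J" for u v
  proof
    assume d: "(u,v) \<in> D"
    then have d': "(v,u) \<in> D" using D(2)[of "(u,v)"] by simp
    have K: "u \<in> K" "v \<in> K" using JK[of u v] JK[of v u] uv d d' by blast+
    then have "(u,v) \<notin> D - T" using KDT by blast
    then show False using KK[OF K] d by blast
  qed
  have all: "\<forall>v \<in> ?V. forced (nbr D) (K \<union> B) v"
  proof
    fix v assume v: "v \<in> ?V"
    show "forced (nbr D) (K \<union> B) v"
    proof (cases "v \<in> K")
      case True then show ?thesis by (intro forced.initial) simp
    next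
      case False then show ?thesis using BJ(5) v by blast
    qed
  qed
  show thesis
  proof (rule that[of B J])
    show "B \<subseteq> ?V" "J \<subseteq> ?V" "K \<inter> J = {}" using BJ(1,2) by blast+
    show "\<forall>u \<in> K \<union> J. card (star D u) = 3" using deg J3 by blast
    show "\<forall>u \<in> K \<union> J. \<forall>v \<in> K \<union> J. (u,v) \<notin> D" using ind by blast
  qed (fact KV BJ(4) all)+
qed

text \<open>A new edge spoils a force only as long as exactly one of its ends is blue. Adding one of
the ends as an initial vertex removes this obstacle; if the two ends become blue or stay white
together, any vertex does.\<close>
lemma forced_extra_edge:
  assumes B: "\<And>v. v \<in> V \<Longrightarrow> forced N B v"
    and M: "\<And>u. N u \<subseteq> M u" "\<And>u w. w \<in> M u \<Longrightarrow> w \<in> N u \<or> u = x \<and> w = y \<or> u = y \<and> w = x" and xy: "x \<in> V" "y \<in> V"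
  shows "\<exists>z \<in> V. \<forall>v \<in> V. forced M (insert z B) v"
proof -
  have all: "forced M C v" if C: "B \<subseteq> C" "forced M C x \<longleftrightarrow> forced M C y" and v: "forced N B v" for C v
    using v
  proof induction
    case (initial v) then show ?case using C(1) by (auto intro: forced.initial)
  next
    case (force u w)
    show ?case
    proof (rule forced.force[OF force.IH(1)])
      show "w \<in> M u" using M(1) force by blast
      show "forced M C z" if "z \<in> M u - {w}" for z
        using M(2)[of z u] that force.IH C(2) by blast
    qed
  qed
  obtain z where z: "z \<in> V" "forced M (insert z B) x \<longleftrightarrow> forced M (insert z B) y"
  proof (cases "forced M B x \<longleftrightarrow> forced M B y")
    case True
    show ?thesis
    proof (cases "forced M B x")
      case True
      then show ?thesis using that[of x] \<open>forced M B x \<longleftrightarrow> forced M B y\<close> xy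
        by (meson forced_mono subset_insertI)
    next
      case False
      have "forced M B v" if "v \<in> V" for v using all[OF order_refl True B[OF that]] .
      then show ?thesis using that[of x] xy by (meson forced_mono subset_insertI)
    qed
  next
    case False
    then consider "forced M B x" | "forced M B y" by blast
    then show ?thesis
    proof cases
      case 1
      have "forced M (insert y B) x" using 1 by (rule forced_mono) auto
      moreover have "forced M (insert y B) y" by (rule forced.initial) simp
      ultimately show ?thesis using that[of y] xy by blast
    next
      case 2
      have "forced M (insert x B) y" using 2 by (rule forced_mono) auto
      moreover have "forced M (insert x B) x" by (rule forced.initial) simp
      ultimately show ?thesis using that[of x] xy by blast
    qed
  qed
  then show ?thesis using all[OF subset_insertI z(2)] B by blast
qed

text \<open>A reachable blue set of maximal size is closed under the forcing rule, hence contains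
all forced vertices.\<close>
lemma forced_imp_zero_forcing_set:
  assumes fin: "finite (pverts G)" and wf: "\<And>u. neighbors G u \<subseteq> pverts G" and B: "B \<subseteq> pverts G"
    and forced: "\<And>v. v \<in> pverts G \<Longrightarrow> forced (neighbors G) B v"
  shows "zero_forcing_set G B"
proof -
  have reach: "X \<subseteq> pverts G \<and> B \<subseteq> X" if "(force_step G)\<^sup>*\<^sup>* B X" for X
    using that
  proof induction
    case (step X Y)
    then obtain u w where "neighbors G u - X = {w}" "Y = insert w X" unfolding force_step_def by blast
    then show ?case using step.IH wf[of u] by blast
  qed (use B in auto)
  define S where "S = {X. (force_step G)\<^sup>*\<^sup>* B X}"
  have "S \<subseteq> Pow (pverts G)"
  proof
    fix X assume "X \<in> S"
    then have "(force_step G)\<^sup>*\<^sup>* B X" by (simp add: S_def)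
    from reach[OF this] show "X \<in> Pow (pverts G)" by simp
  qed
  then have finS: "finite S" by (rule finite_subset) (simp add: fin)
  have "B \<in> S" by (simp add: S_def)
  then have "card ` S \<noteq> {}" by blast
  then have "Max (card ` S) \<in> card ` S" by (rule Max_in[OF finite_imageI[OF finS]])
  then obtain X where max: "Max (card ` S) = card X" and X: "X \<in> S" by (rule imageE)
  have X_max: "card Y \<le> card X" if "Y \<in> S" for Y
    unfolding max[symmetric] by (rule Max_ge[OF finite_imageI[OF finS]]) (rule imageI[OF that])
  have reachX: "(force_step G)\<^sup>*\<^sup>* B X" using X by (simp add: S_def)
  have XV: "X \<subseteq> pverts G" "B \<subseteq> X" using reach[OF reachX] by simp_all
  have "v \<in> X" if "forced (neighbors G) B v" for v
    using that
  proof induction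
    case (initial v) show ?case by (rule subsetD[OF XV(2) initial])
  next
    case (force u w)
    show ?case
    proof (rule ccontr)
      assume w: "w \<notin> X"
      have "neighbors G u - X = {w}"
      proof
        show "{w} \<subseteq> neighbors G u - X" using force.hyps w by simp
        show "neighbors G u - X \<subseteq> {w}"
        proof
          fix z assume z: "z \<in> neighbors G u - X"
          then have "z \<in> neighbors G u" "z \<notin> X" by simp_all
          then show "z \<in> {w}" using force.IH(2)[of z] by auto
        qed
      qed
      then have "force_step G X (insert w X)" unfolding force_step_def using force.IH(1) by blast
      with reachX have "(force_step G)\<^sup>*\<^sup>* B (insert w X)" by (rule rtranclp.rtrancl_into_rtrancl)
      then have "card (insert w X) \<le> card X" by (intro X_max) (simp add: S_def)
      moreover have "finite X" by (rule finite_subset[OF XV(1) fin])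
      ultimately show False using w by simp
    qed
  qed
  then have "pverts G \<subseteq> X" using forced by (intro subsetI) simp
  then have "X = pverts G" using XV(1) by (rule equalityI[rotated])
  then show ?thesis using reachX B by (simp add: zero_forcing_set_def)
qed

lemma zero_forcing_number_le:
  assumes "finite (pverts G)" "zero_forcing_set G B"
  shows "zero_forcing_number G \<le> card B"
proof -
  have "finite {B. zero_forcing_set G B}"
    by (rule finite_subset[of _ "Pow (pverts G)"]) (use assms(1) in \<open>auto simp: zero_forcing_set_def\<close>)
  then show ?thesis unfolding zero_forcing_number_def using assms(2) by (intro Min_le) auto
qed

lemma independence_number_ge:
  assumes "finite (pverts G)" "independent_vertices G I"
  shows "card I \<le> independence_number G"
proof -
  have "finite {I. independent_vertices G I}"
    by (rule finite_subset[of _ "Pow (pverts G)"]) (use assms(1) in \<open>auto simp: independent_vertices_def\<close>)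
  then show ?thesis unfolding independence_number_def using assms(2) by (intro Max_ge) auto
qed

section \<open>The bound for embeddings with one or two faces\<close>

text \<open>For one face the word of all arcs gives \<open>K\<close>, \<open>J\<close> and
\<open>B\<close> with the independent set \<open>K \<union> J\<close> and the zero forcing set
\<open>K \<union> B\<close>. For two faces one edge is deleted first. Its ends then have degree two,
so they are not in \<open>K \<union> J\<close>, and this set is independent in the whole graph as
well; restoring the edge costs one more blue vertex.\<close>
lemma cellular_embedding_bound:
  fixes G :: "'v pair_pre_digraph" and S :: "'s topology" and p :: "'v \<Rightarrow> 's" and c :: "'v \<times> 'v \<Rightarrow> real \<Rightarrow> 's"
  assumes G: "pair_graph G" "Digraph_Component.connected (with_proj G)" "cubic G"
    and S: "closed_orientable_surface S" "cellular_embedding G S p c" "card (faces G S p c) = k" and k: "k = 1 \<or> k = 2"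
  shows "zero_forcing_number G \<le> independence_number G + k"
proof -
  obtain \<A> where A: "oriented_atlas S \<A>" using S(1) unfolding closed_orientable_surface_def by (elim conjE exE)
  have haus: "Hausdorff_space S" and comp: "compact_space S" using S(1) by (simp_all add: closed_orientable_surface_def)
  have drawing: "graph_drawing G S p c" using S(2) by (simp add: cellular_embedding_def)
  interpret D: oriented_drawing G S \<A> p c by (rule oriented_drawing.intro[OF G(1) haus comp A drawing])
  let ?A = "parcs G" and ?V = "pverts G"
  have cub: "card (D.out v) = 3" if "v \<in> ?V" for v
    using G(3) that unfolding cubic_def out_degree_def out_arcs_def D.out_def by simp
  have finF: "finite (faces G S p c)" using S(3) k by (intro card_ge_0_finite) auto
  have cell: "subtopology S F homeomorphic_space top_of_set (ball (0::complex) 1)" if "F \<in> faces G S p c" for F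
    using S(2) that by (simp add: cellular_embedding_def)
  obtain f where f': "f ` ?A \<subseteq> ?A \<and> inj_on f ?A \<and> (\<forall>a \<in> ?A. fst (f a) = snd a \<and> f a \<noteq> prod.swap a) \<and>
    (\<forall>h :: 'v \<times> 'v \<Rightarrow> nat. (\<forall>a \<in> ?A. h (f a) = h a) \<longrightarrow> card (h ` ?A) \<le> card (faces G S p c))"
    using D.face_tracing[OF cub cell finF] by (rule exE)
  have f: "f ` ?A \<subseteq> ?A" "inj_on f ?A" and f_turn: "\<And>a. a \<in> ?A \<Longrightarrow> fst (f a) = snd a" "\<And>a. a \<in> ?A \<Longrightarrow> f a \<noteq> prod.swap a"
    using f' by simp_all
  have f_faces: "card (h ` ?A) \<le> k" if "\<forall>a \<in> ?A. h (f a) = h a" for h :: "'v \<times> 'v \<Rightarrow> nat"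
    using f' that S(3) by simp
  have sc: "strongly_connected (mk_symmetric (with_proj G))" using G(2) unfolding Digraph_Component.connected_def .
  have arcs: "arcs_ends (with_proj (mk_symmetric (with_proj G))) = ?A"
  proof -
    have "parcs (mk_symmetric (with_proj G)) = ?A"
    proof
      show "parcs (mk_symmetric (with_proj G)) \<subseteq> ?A"
      proof
        fix a assume "a \<in> parcs (mk_symmetric (with_proj G))"
        then obtain e where e: "e \<in> ?A" "a = e \<or> a = prod.swap e" by (auto simp: mk_symmetric_def)
        then show "a \<in> ?A" using D.swap_arc[OF e(1)] by auto
      qed
      show "?A \<subseteq> parcs (mk_symmetric (with_proj G))" by (auto simp: mk_symmetric_def)
    qed
    then show ?thesis by (simp add: arcs_ends_def arc_to_ends_def)
  qed
  have conn: "X = ?V" if X: "X \<subseteq> ?V" "X \<noteq> {}" "\<And>u v. (u,v) \<in> ?A \<Longrightarrow> u \<in> X \<Longrightarrow> v \<in> X" for X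
  proof -
    obtain u where u: "u \<in> X" using X(2) by (meson ex_in_conv)
    have "v \<in> X" if "v \<in> ?V" for v
    proof -
      have "u \<rightarrow>\<^sup>*\<^bsub>with_proj (mk_symmetric (with_proj G))\<^esub> v"
        using sc subsetD[OF X(1) u] that by (simp add: strongly_connected_def)
      then have "(u,v) \<in> (arcs_ends (with_proj (mk_symmetric (with_proj G))))\<^sup>*"
        by (rule reachable_rtranclI)
      then have "(u,v) \<in> ?A\<^sup>*" unfolding arcs .
      then show ?thesis 
      proof induction
        case base show ?case by (rule u)
      next
        case (step y z) show ?case by (rule X(3)[OF step.hyps(2) step.IH])
      qed
    qed
    then have "?V \<subseteq> X" by (rule subsetI)
    with X(1) show ?thesis by (rule equalityI)
  qed
  have Vne: "?V \<noteq> {}" using sc unfolding strongly_connected_def by simp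
  have star3: "card (star ?A v) = 3" if "v \<in> ?V" for v using cub[OF that] unfolding D.out_def .
  interpret F: face_traced ?A ?V f
  proof
    show "finite ?A" by (rule D.finites)
    show "?A \<subseteq> ?V \<times> ?V" using D.arc_ends by (auto simp: mem_Times_iff)
  qed (fact D.swap_arc D.no_loop star3 conn f f_turn Vne)+
  have nbrG: "neighbors G = nbr ?A" by (auto simp: neighbors_def nbr_def fun_eq_iff)
  have nbV: "neighbors G u \<subseteq> ?V" for u using D.arc_ends by (auto simp: neighbors_def)
  have words: "(\<exists>W. face_word W \<and> set W = ?A \<and> W \<noteq> []) \<or>
     (k = 2 \<and> (\<exists>W e. e \<in> ?A \<and> face_word W \<and> set W = ?A - {e, prod.swap e} \<and> W \<noteq> []))"
  proof (rule F.face_words[OF _ k])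
    show "card (h ` ?A) \<le> k" if "\<forall>a \<in> ?A. h (f a) = h a" for h :: "'v \<times> 'v \<Rightarrow> nat"
      using that by (rule f_faces)
  qed
  from words show ?thesis
  proof
    assume "\<exists>W. face_word W \<and> set W = ?A \<and> W \<noteq> []"
    then obtain W where 1: "face_word W" "set W = ?A" "W \<noteq> []" by (elim exE conjE) (rule that)
    obtain T K where P: "spanning_pairing ?A T K" using face_word_spanning_pairing[OF 1(1,3)] unfolding 1(2) by blast
    obtain B J where BJ: "B \<subseteq> fst ` ?A" "J \<subseteq> fst ` ?A" "K \<subseteq> fst ` ?A" "K \<inter> J = {}" "card B \<le> card J + 1"
      "\<forall>u \<in> K \<union> J. \<forall>v \<in> K \<union> J. (u,v) \<notin> ?A" "\<forall>u \<in> K \<union> J. card (star ?A u) = 3"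
      "\<forall>v \<in> fst ` ?A. forced (nbr ?A) (K \<union> B) v"
      by (rule pairing_forcing[OF P F.fin F.sym F.loopfree F.card_star])
    have KJ: "independent_vertices G (K \<union> J)"
      unfolding independent_vertices_def using BJ(2,3,6) unfolding F.V_arcs by simp
    have finKJ: "finite K" "finite J" using BJ(2,3) F.fin by (auto intro: finite_subset)
    have "zero_forcing_set G (K \<union> B)"
      by (rule forced_imp_zero_forcing_set[OF D.finites(1) nbV]) (use BJ(1,3,8) in \<open>simp_all add: F.V_arcs nbrG\<close>)
    then have "zero_forcing_number G \<le> card (K \<union> B)" by (rule zero_forcing_number_le[OF D.finites(1)])
    also have "\<dots> \<le> card K + card B" by (rule card_Un_le)
    also have "\<dots> \<le> card (K \<union> J) + 1" using BJ(5) card_Un_disjoint[OF finKJ BJ(4)] by simp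
    also have "\<dots> \<le> independence_number G + 1" using independence_number_ge[OF D.finites(1) KJ] by simp
    finally show ?thesis using k by auto
  next
    assume "k = 2 \<and> (\<exists>W e. e \<in> ?A \<and> face_word W \<and> set W = ?A - {e, prod.swap e} \<and> W \<noteq> [])"
    then obtain W e where 2: "k = 2" "e \<in> ?A" "face_word W" "set W = ?A - {e, prod.swap e}" "W \<noteq> []"
      by (elim exE conjE) (rule that)
    let ?D = "?A - {e, prod.swap e}"
    have swD: "prod.swap a \<in> ?D" if "a \<in> ?D" for a
      using that F.sym[of a] by (cases a; cases e) auto
    have lfD: "fst a \<noteq> snd a" if "a \<in> ?D" for a using that F.loopfree by blast
    have finD: "finite ?D" using F.fin by simp
    have stD: "star ?D v \<subseteq> star ?A v" for v by blast
    have c3D: "card (star ?D v) \<le> 3" for v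
    proof -
      have "card (star ?D v) \<le> card (star ?A v)" by (rule card_mono[OF _ stD]) (simp add: F.fin)
      then show ?thesis using F.card_star[of v] by simp
    qed
    obtain T K where P: "spanning_pairing ?D T K" using face_word_spanning_pairing[OF 2(3,5)] unfolding 2(4) by blast
    obtain B J where BJ: "B \<subseteq> fst ` ?D" "J \<subseteq> fst ` ?D" "K \<subseteq> fst ` ?D" "K \<inter> J = {}" "card B \<le> card J + 1"
      "\<forall>u \<in> K \<union> J. \<forall>v \<in> K \<union> J. (u,v) \<notin> ?D" "\<forall>u \<in> K \<union> J. card (star ?D u) = 3"
      "\<forall>v \<in> fst ` ?D. forced (nbr ?D) (K \<union> B) v"
      by (rule pairing_forcing[OF P finD swD lfD c3D])
    have VD: "fst ` ?D = ?V"
    proof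
      show "fst ` ?D \<subseteq> ?V" using F.V_arcs by blast
      show "?V \<subseteq> fst ` ?D"
      proof
        fix v assume v: "v \<in> ?V"
        have "\<not> star ?A v \<subseteq> {e, prod.swap e}"
        proof
          assume "star ?A v \<subseteq> {e, prod.swap e}"
          then have "card (star ?A v) \<le> card {e, prod.swap e}" by (intro card_mono) auto
          also have "\<dots> \<le> 2" by (simp add: card_insert_if)
          finally show False using star3[OF v] by simp
        qed
        then obtain a where "a \<in> star ?A v" "a \<notin> {e, prod.swap e}" by blast
        then have "a \<in> ?D" "fst a = v" by simp_all
        then show "v \<in> fst ` ?D" by force
      qed
    qed
    have notend: "fst a \<notin> K \<union> J" if "a \<in> {e, prod.swap e}" for a
    proof
      assume a: "fst a \<in> K \<union> J"
      have "a \<in> ?A" using that 2(2) F.sym[OF 2(2)] by auto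
      then have sub: "insert a (star ?D (fst a)) \<subseteq> star ?A (fst a)" by blast
      have "a \<notin> star ?D (fst a)" using that by blast
      then have "card (insert a (star ?D (fst a))) = 4" using BJ(7) a finD by (subst card_insert_disjoint) auto
      moreover have "card (insert a (star ?D (fst a))) \<le> card (star ?A (fst a))" by (rule card_mono[OF _ sub]) (use F.fin in simp)
      ultimately show False using F.card_star[of "fst a"] by simp
    qed
    have KJ: "independent_vertices G (K \<union> J)"
      unfolding independent_vertices_def
    proof (intro conjI ballI)
      show "K \<union> J \<subseteq> ?V" using BJ(2,3) by (simp add: VD)
      fix u v assume uv: "u \<in> K \<union> J" "v \<in> K \<union> J"
      have "(u,v) \<notin> {e, prod.swap e}" using notend[of "(u,v)"] uv by auto
      then show "(u,v) \<notin> ?A" using BJ(6)[rule_format, OF uv] by simp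
    qed
    have finKJ: "finite K" "finite J" using BJ(2,3) finD by (auto intro: finite_subset)
    have eV: "fst e \<in> ?V" "snd e \<in> ?V" using D.arc_ends 2(2) by auto
    have "\<exists>z \<in> ?V. \<forall>v \<in> ?V. forced (neighbors G) (insert z (K \<union> B)) v"
    proof (rule forced_extra_edge[OF _ _ _ eV])
      show "forced (nbr ?D) (K \<union> B) v" if "v \<in> ?V" for v using BJ(8) that unfolding VD by (rule bspec)
      show "nbr ?D u \<subseteq> neighbors G u" for u unfolding nbrG by (auto simp: nbr_def)
      show "w \<in> nbr ?D u \<or> u = fst e \<and> w = snd e \<or> u = snd e \<and> w = fst e" if "w \<in> neighbors G u" for u w
        using that unfolding nbrG by (cases e) (auto simp: nbr_def)
    qed
    then obtain z where z: "z \<in> ?V" "\<And>v. v \<in> ?V \<Longrightarrow> forced (neighbors G) (insert z (K \<union> B)) v" by blast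
    have "zero_forcing_set G (insert z (K \<union> B))"
      by (rule forced_imp_zero_forcing_set[OF D.finites(1) nbV _ z(2)]) (use BJ(1,3) VD z(1) in auto)
    then have "zero_forcing_number G \<le> card (insert z (K \<union> B))" by (rule zero_forcing_number_le[OF D.finites(1)])
    also have "\<dots> \<le> card (K \<union> B) + 1" using card_insert_le_m1[of "card (K \<union> B) + 1" "K \<union> B" z] by simp
    also have "\<dots> \<le> card K + card B + 1" using card_Un_le[of K B] by simp
    also have "\<dots> \<le> card (K \<union> J) + 2" using BJ(5) card_Un_disjoint[OF finKJ BJ(4)] by simp
    also have "\<dots> \<le> independence_number G + 2" using independence_number_ge[OF D.finites(1) KJ] by simp
    finally show ?thesis using 2(1) by simp
  qed
qed

theorem corollary10:
  fixes G :: "'v pair_pre_digraph"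
  assumes "pair_graph G" and "Digraph_Component.connected (with_proj G)" and "cubic G"
  shows "(orientably_face_embeddable TYPE('s) 1 G \<longrightarrow>
            zero_forcing_number G \<le> independence_number G + 1) \<and>
         (orientably_face_embeddable TYPE('s) 2 G \<longrightarrow>
            zero_forcing_number G \<le> independence_number G + 2)"
proof (intro conjI impI)
  show "zero_forcing_number G \<le> independence_number G + 1" if "orientably_face_embeddable TYPE('s) 1 G"
    using that unfolding orientably_face_embeddable_def
    by (elim exE conjE) (rule cellular_embedding_bound[OF assms], assumption+, simp)
  show "zero_forcing_number G \<le> independence_number G + 2" if "orientably_face_embeddable TYPE('s) 2 G"
    using that unfolding orientably_face_embeddable_def
    by (elim exE conjE) (rule cellular_embedding_bound[OF assms], assumption+, simp)
qed

end
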